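(* Let $R$ be a countable Borel equivalence relation on a standard measure space $(X,\mu)$ and let $\mu$ be $R$-quasi-invariant and $R$-ergodic. Let $d$ denote the $L^{1}$-distance on $\mathrm{C}_{\mu}(R)$. Consider a symmetric finitely supported probability measure $\nu$ on $[R]$. Let $G$ be the subgroup of $[R]$ generated by the support of $\nu$, let $\hat\nu$ be the corresponding switch-walk-switch measure on $\mathrm{C}_\mu(G)\rtimes G$, and let $\hat g_n=(c_n,g_n)$ be the position at time $n$ of the left $\hat\nu$-random walk started at the identity. Let $O_n(x)$ denote the inverted orbit of $x$ under the first $n$ steps of the $\nu$-random walk on $G$. Then the following statements hold. (1) For every $\epsilon\in(0,1)$ (and every $n$), $$(1-\epsilon)\,\mathbb P(d(c_n,\emptyset)<\epsilon)\ \le\ \int_X\mathbb E\,2^{-|O_n(x)|}\,\mathrm d\mu(x).$$ In particular, if the strong Kesten property holds for $\mathrm{C}_\mu(G)\rtimes G$ or $\mathrm{C}_\mu(R)\rtimes[R]$, then $\int_X\mathbb E\,2^{-|O_n(x)|}\,\mathrm d\mu(x)$ decays subexponentially. (2) For every $\epsilon\in(0,1)$ (and every $n$), $$\tfrac12\,\mathbb P\!\left(d(c_n,\emptyset)<\tfrac{\epsilon}{2}n\right)-e^{-\epsilon n/2}\ \le\ \int_X\mathbb P(|O_n(x)|\le 4\epsilon n)\,\mathrm d\mu(x).$$ In particular, if the Kesten property holds for $\mathrm{C}_\mu(G)\rtimes G$ or $\mathrm{C}_\mu(R)\rtimes[R]$, then $\int_X\mathbb P(|O_n(x)|\le\epsilon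 n)\,\mathrm d\mu(x)$ decays subexponentially for each $\epsilon>0$.
   Context: A standard measure space $(X,\mu)$ is a standard Borel space $X$ with a non-atomic Borel probability measure $\mu$. A countable Borel equivalence relation on $X$ is an equivalence relation $R\subseteq X\times X$ that is Borel with all classes countable. $[R]_B$ is the group of Borel automorphisms of $X$ whose graph is contained in $R$; $\mu$ is $R$-quasi-invariant if $[R]_B$ preserves its measure class, and then $R$-ergodic if every $R$-invariant Borel set is null or co-null. The full group $[R]$ is the group of Borel automorphisms preserving the measure class of $\mu$ (identified when they agree a.e.) whose graph is contained in $R$ on a set of full measure; it carries the uniform topology generated by the metric $(g,h)\mapsto\mu(\{x\mid g(x)\neq h(x)\})$. For Borel $A\subseteq R$ put $A_x=\{y\mid(x,y)\in A\}$ and $\mu_R(A)=\int_X|A_x|\,\mathrm d\mu(x)$. $\mathrm{C}_\mu(R)$ is the abelian group, under symmetric difference, of $\mu_R$-equivalence classes of Borel $A\subseteq R$ with $\mu_R(A)<\infty$; its identity is $\emptyset$; the $L^1$-distance is $d(A,B)=\mu_R(A\triangle B)$, generating the $L^1$-topology. The action $g(x,y)=(x,gy)$ induces an isometric action of $[R]$ on $\mathrm{C}_\mu(R)$, and $\mathrm{C}_\mu(R)\rtimes[R]$ is the corresponding semidirect product, with multiplication $(c,g)(c',g')=(c+gc',gg')$, endowed with the product topology (it is a topological group). For a countable subgroup $G\le[R]$, $\mathrm{C}_\mu(G)$ is the subgroup of $\mathrm{C}_\mu(R)$ generated by the graphs of the elements of $G$; it is $G$-invariant, and $\mathrm{C}_\mu(G)\rtimes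 G$ is regarded as a topological subgroup of $\mathrm{C}_\mu(R)\rtimes[R]$. (A countable $G$ acts genuinely on an $R$-invariant set of full measure.) The switch-walk-switch measure is $\hat\nu=\tfrac12(\delta_\emptyset+\delta_I)*\nu*\tfrac12(\delta_\emptyset+\delta_I)$, where $\emptyset$ is the trivial element of $\mathrm{C}_\mu(R)$, $I\subseteq R$ is the graph of the identity map, and $\mathrm{C}_\mu(G)$ and $G$ are viewed as subgroups of the semidirect product. The left $\hat\nu$-random walk is $\hat g_n=\hat h_n\cdots\hat h_1$ with i.i.d. increments $\hat h_i$ of law $\hat\nu$. In (1) and (2), probabilities involving $c_n$ are with respect to the $\hat\nu$-random walk; expectations and probabilities involving $O_n(x)$ are with respect to the $\nu$-random walk. For a sequence $h=(h_1,\dots,h_n)$ in $G$ and $x\in X$, the inverted orbit of $x$ under $h$ is $\{x,h_nx,h_nh_{n-1}x,\dots,h_nh_{n-1}\cdots h_1x\}$. $O_n(x)$ is the random set obtained when $h_1,\dots,h_n$ are i.i.d. of law $\nu$. A sequence $(a_n)_{n\ge1}$ in $[0,1]$ decays subexponentially if $\limsup_{n\to\infty}a_n^{1/n}=1$. A topological group $H$ has the Kesten property (resp. strong Kesten property) if for every open identity neighborhood $U$ in $H$ and every symmetric regular Borel probability measure $\theta$ on $H$ with countable support (i.e. a countable convex combination of point masses), $\limsup_{n\to\infty}\theta^n(U^n)^{1/n}=1$ (resp. $\limsup_{n\to\infty}\theta^n(U)^{1/n}=1$), where $\theta^n$ is the $n$-fold convolution power and $U^n$ is the $n$-fold product set.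
   Formalization: Inequality (1) is stated for every n ≥ 1: at n = 0 one has c_0 = ∅ and |O_0(x)| = 1, so it would read 1 − ε ≤ 1/2, which is false for ε < 1/2. *)

theory Defs
  imports
    "HOL-Analysis.Analysis"
    "HOL-Probability.Probability"
    "HOL-Algebra.Algebra"
begin

subsection \<open>Standard measure spaces and countable Borel equivalence relations\<close>

definition standard_borel :: "'a measure \<Rightarrow> bool" where
  "standard_borel M \<longleftrightarrow>
     (\<exists>T. topspace T = space M \<and> completely_metrizable_space T \<and> second_countable T \<and>
          sets M = sigma_sets (space M) {U. openin T U})"

definition non_atomic :: "'a measure \<Rightarrow> bool" where
  "non_atomic M \<longleftrightarrow>
     (\<forall>A\<in>sets M. emeasure M A > 0 \<longrightarrow>
        (\<exists>B\<in>sets M. B \<subseteq> A \<and> 0 < emeasure M B \<and> emeasure M B < emeasure M A))"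

definition standard_measure_space :: "'a measure \<Rightarrow> bool" where
  "standard_measure_space M \<longleftrightarrow> prob_space M \<and> standard_borel M \<and> non_atomic M"

definition countable_borel_equiv :: "'a measure \<Rightarrow> ('a \<times> 'a) set \<Rightarrow> bool" where
  "countable_borel_equiv M R \<longleftrightarrow>
     equiv (space M) R \<and> R \<in> sets (M \<Otimes>\<^sub>M M) \<and> (\<forall>x\<in>space M. countable (R `` {x}))"

text \<open>As in \<^const>\<open>Bij\<close>, automorphisms are extensional, i.e. \<^term>\<open>undefined\<close> off the space.\<close>

definition borel_automorphisms :: "'a measure \<Rightarrow> ('a \<Rightarrow> 'a) set" where
  "borel_automorphisms M =
     {g \<in> Bij (space M). g \<in> measurable M M \<and> inv_into (space M) g \<in> measurable M M}"

definition preserves_measure_class :: "'a measure \<Rightarrow> ('a \<Rightarrow> 'a) \<Rightarrow> bool" where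
  "preserves_measure_class M g \<longleftrightarrow> null_sets (distr M M g) = null_sets M"

definition borel_full_group :: "'a measure \<Rightarrow> ('a \<times> 'a) set \<Rightarrow> ('a \<Rightarrow> 'a) set" where
  "borel_full_group M R = {g \<in> borel_automorphisms M. \<forall>x\<in>space M. (x, g x) \<in> R}"

definition quasi_invariant :: "'a measure \<Rightarrow> ('a \<times> 'a) set \<Rightarrow> bool" where
  "quasi_invariant M R \<longleftrightarrow> (\<forall>g\<in>borel_full_group M R. preserves_measure_class M g)"

definition ergodic :: "'a measure \<Rightarrow> ('a \<times> 'a) set \<Rightarrow> bool" where
  "ergodic M R \<longleftrightarrow>
     (\<forall>A\<in>sets M. R `` A \<subseteq> A \<longrightarrow> emeasure M A = 0 \<or> emeasure M (space M - A) = 0)"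


subsection \<open>The full group\<close>

text \<open>
  Identification of automorphisms that agree almost everywhere is expressed as a quotient group,
  so an element of the full group is a set of functions.
\<close>

definition full_group_pre :: "'a measure \<Rightarrow> ('a \<times> 'a) set \<Rightarrow> ('a \<Rightarrow> 'a) monoid" where
  "full_group_pre M R = (BijGroup (space M))
     \<lparr>carrier := {g \<in> borel_automorphisms M.
                    preserves_measure_class M g \<and> (AE x in M. (x, g x) \<in> R)}\<rparr>"

definition full_group :: "'a measure \<Rightarrow> ('a \<times> 'a) set \<Rightarrow> ('a \<Rightarrow> 'a) set monoid" where
  "full_group M R =
     full_group_pre M R Mod {g \<in> carrier (full_group_pre M R). AE x in M. g x = x}"

definition rep :: "'b set \<Rightarrow> 'b" where
  "rep c = (SOME a. a \<in> c)"

definition uniform_dist :: "'a measure \<Rightarrow> ('a \<Rightarrow> 'a) set \<Rightarrow> ('a \<Rightarrow> 'a) set \<Rightarrow> real" where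
  "uniform_dist M g h = measure M {x \<in> space M. rep g x \<noteq> rep h x}"

definition uniform_topology :: "'a measure \<Rightarrow> ('a \<times> 'a) set \<Rightarrow> ('a \<Rightarrow> 'a) set topology" where
  "uniform_topology M R = Metric_space.mtopology (carrier (full_group M R)) (uniform_dist M)"


subsection \<open>The group of finite measure subsets of the relation\<close>

definition mu_rel :: "'a measure \<Rightarrow> ('a \<times> 'a) set \<Rightarrow> ennreal" where
  "mu_rel M A = (\<integral>\<^sup>+ x. emeasure (count_space UNIV) (A `` {x}) \<partial>M)"

definition finite_subsets_group :: "'a measure \<Rightarrow> ('a \<times> 'a) set \<Rightarrow> ('a \<times> 'a) set monoid" where
  "finite_subsets_group M R =
     \<lparr>carrier = {A \<in> sets (M \<Otimes>\<^sub>M M). A \<subseteq> R \<and> mu_rel M A < \<infinity>},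
      mult = sym_diff, one = {}\<rparr>"

definition null_subsets :: "'a measure \<Rightarrow> ('a \<times> 'a) set \<Rightarrow> ('a \<times> 'a) set set" where
  "null_subsets M R = {A \<in> carrier (finite_subsets_group M R). mu_rel M A = 0}"

definition C_group :: "'a measure \<Rightarrow> ('a \<times> 'a) set \<Rightarrow> ('a \<times> 'a) set set monoid" where
  "C_group M R = finite_subsets_group M R Mod null_subsets M R"

definition C_class :: "'a measure \<Rightarrow> ('a \<times> 'a) set \<Rightarrow> ('a \<times> 'a) set \<Rightarrow> ('a \<times> 'a) set set" where
  "C_class M R A = null_subsets M R #>\<^bsub>finite_subsets_group M R\<^esub> A"

definition L1_dist :: "'a measure \<Rightarrow> ('a \<times> 'a) set set \<Rightarrow> ('a \<times> 'a) set set \<Rightarrow> real" where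
  "L1_dist M c c' = enn2real (mu_rel M (sym_diff (rep c) (rep c')))"

definition L1_topology :: "'a measure \<Rightarrow> ('a \<times> 'a) set \<Rightarrow> ('a \<times> 'a) set set topology" where
  "L1_topology M R = Metric_space.mtopology (carrier (C_group M R)) (L1_dist M)"

text \<open>
  A representative of an element of the full group stays inside the relation only almost
  everywhere, so images and graphs are cut down to the relation; by quasi-invariance this
  changes them by null sets only.
\<close>

definition C_act ::
    "'a measure \<Rightarrow> ('a \<times> 'a) set \<Rightarrow> ('a \<Rightarrow> 'a) set \<Rightarrow> ('a \<times> 'a) set set \<Rightarrow> ('a \<times> 'a) set set" where
  "C_act M R g c = C_class M R ((\<lambda>(x, y). (x, rep g y)) ` rep c \<inter> R)"

definition graph_class :: "'a measure \<Rightarrow> ('a \<times> 'a) set \<Rightarrow> ('a \<Rightarrow> 'a) set \<Rightarrow> ('a \<times> 'a) set set" where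
  "graph_class M R g = C_class M R ((\<lambda>x. (x, rep g x)) ` space M \<inter> R)"

definition C_subgroup ::
    "'a measure \<Rightarrow> ('a \<times> 'a) set \<Rightarrow> ('a \<Rightarrow> 'a) set set \<Rightarrow> ('a \<times> 'a) set set set" where
  "C_subgroup M R G = generate (C_group M R) (graph_class M R ` G)"


subsection \<open>The semidirect product\<close>

definition semidirect_product ::
    "('c, 'r) monoid_scheme \<Rightarrow> ('g, 's) monoid_scheme \<Rightarrow> ('g \<Rightarrow> 'c \<Rightarrow> 'c) \<Rightarrow> ('c \<times> 'g) monoid" where
  "semidirect_product N H act =
     \<lparr>carrier = carrier N \<times> carrier H,
      mult = (\<lambda>(c, g) (c', g'). (c \<otimes>\<^bsub>N\<^esub> act g c', g \<otimes>\<^bsub>H\<^esub> g')),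
      one = (\<one>\<^bsub>N\<^esub>, \<one>\<^bsub>H\<^esub>)\<rparr>"

type_synonym 'a CR = "('a \<times> 'a) set set \<times> ('a \<Rightarrow> 'a) set"

definition CR_group :: "'a measure \<Rightarrow> ('a \<times> 'a) set \<Rightarrow> 'a CR monoid" where
  "CR_group M R = semidirect_product (C_group M R) (full_group M R) (C_act M R)"

definition CR_topology :: "'a measure \<Rightarrow> ('a \<times> 'a) set \<Rightarrow> 'a CR topology" where
  "CR_topology M R = prod_topology (L1_topology M R) (uniform_topology M R)"

definition CG_group :: "'a measure \<Rightarrow> ('a \<times> 'a) set \<Rightarrow> ('a \<Rightarrow> 'a) set set \<Rightarrow> 'a CR monoid" where
  "CG_group M R G = (CR_group M R)\<lparr>carrier := C_subgroup M R G \<times> G\<rparr>"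

definition CG_topology :: "'a measure \<Rightarrow> ('a \<times> 'a) set \<Rightarrow> ('a \<Rightarrow> 'a) set set \<Rightarrow> 'a CR topology" where
  "CG_topology M R G = subtopology (CR_topology M R) (carrier (CG_group M R G))"


subsection \<open>Convolution, random walks and Kesten properties\<close>

text \<open>Countable convex combinations of point masses on a group are rendered as \<^type>\<open>pmf\<close>s
  supported in its carrier.\<close>

definition convolution :: "('g, 'r) monoid_scheme \<Rightarrow> 'g pmf \<Rightarrow> 'g pmf \<Rightarrow> 'g pmf" where
  "convolution H p q = map_pmf (\<lambda>(g, h). g \<otimes>\<^bsub>H\<^esub> h) (pair_pmf p q)"

primrec convolution_power :: "('g, 'r) monoid_scheme \<Rightarrow> 'g pmf \<Rightarrow> nat \<Rightarrow> 'g pmf" where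
  "convolution_power H p 0 = return_pmf \<one>\<^bsub>H\<^esub>"
| "convolution_power H p (Suc n) = convolution H (convolution_power H p n) p"

primrec set_power :: "('g, 'r) monoid_scheme \<Rightarrow> 'g set \<Rightarrow> nat \<Rightarrow> 'g set" where
  "set_power H U 0 = {\<one>\<^bsub>H\<^esub>}"
| "set_power H U (Suc n) = set_power H U n <#>\<^bsub>H\<^esub> U"

definition symmetric_pmf_on :: "('g, 'r) monoid_scheme \<Rightarrow> 'g pmf \<Rightarrow> bool" where
  "symmetric_pmf_on H p \<longleftrightarrow> set_pmf p \<subseteq> carrier H \<and> map_pmf (\<lambda>g. inv\<^bsub>H\<^esub> g) p = p"

definition kesten_property :: "('g, 'r) monoid_scheme \<Rightarrow> 'g topology \<Rightarrow> bool" where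
  "kesten_property H T \<longleftrightarrow>
     (\<forall>U \<theta>. openin T U \<and> \<one>\<^bsub>H\<^esub> \<in> U \<and> symmetric_pmf_on H \<theta> \<longrightarrow>
        limsup (\<lambda>n. ereal (root n (measure_pmf.prob (convolution_power H \<theta> n) (set_power H U n))))
          = 1)"

definition strong_kesten_property :: "('g, 'r) monoid_scheme \<Rightarrow> 'g topology \<Rightarrow> bool" where
  "strong_kesten_property H T \<longleftrightarrow>
     (\<forall>U \<theta>. openin T U \<and> \<one>\<^bsub>H\<^esub> \<in> U \<and> symmetric_pmf_on H \<theta> \<longrightarrow>
        limsup (\<lambda>n. ereal (root n (measure_pmf.prob (convolution_power H \<theta> n) U))) = 1)"

definition decays_subexponentially :: "(nat \<Rightarrow> real) \<Rightarrow> bool" where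
  "decays_subexponentially a \<longleftrightarrow>
     (\<forall>n\<ge>1. a n \<in> {0..1}) \<and> limsup (\<lambda>n. ereal (root n (a n))) = 1"

text \<open>A list \<^term>\<open>[h\<^sub>1, h\<^sub>2, h\<^sub>3]\<close> of increments leads to the position
  \<^term>\<open>h\<^sub>3 \<otimes>\<^bsub>H\<^esub> (h\<^sub>2 \<otimes>\<^bsub>H\<^esub> (h\<^sub>1 \<otimes>\<^bsub>H\<^esub> \<one>\<^bsub>H\<^esub>))\<close>.\<close>

definition left_walk :: "('g, 'r) monoid_scheme \<Rightarrow> 'g pmf \<Rightarrow> nat \<Rightarrow> 'g pmf" where
  "left_walk H p n = map_pmf (\<lambda>hs. fold (\<lambda>h g. h \<otimes>\<^bsub>H\<^esub> g) hs \<one>\<^bsub>H\<^esub>) (replicate_pmf n p)"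

definition switch :: "'a measure \<Rightarrow> ('a \<times> 'a) set \<Rightarrow> 'a CR pmf" where
  "switch M R = map_pmf
     (\<lambda>b. (if b then graph_class M R \<one>\<^bsub>full_group M R\<^esub> else \<one>\<^bsub>C_group M R\<^esub>,
           \<one>\<^bsub>full_group M R\<^esub>))
     (bernoulli_pmf (1/2))"

definition switch_walk_switch ::
    "'a measure \<Rightarrow> ('a \<times> 'a) set \<Rightarrow> ('a \<Rightarrow> 'a) set pmf \<Rightarrow> 'a CR pmf" where
  "switch_walk_switch M R \<nu> =
     convolution (CR_group M R)
       (convolution (CR_group M R) (switch M R) (map_pmf (\<lambda>g. (\<one>\<^bsub>C_group M R\<^esub>, g)) \<nu>))
       (switch M R)"

text \<open>
  The \<open>k\<close>-th point below is \<open>h\<^sub>n \<dots> h\<^sub>k\<^sub>+\<^sub>1 x\<close> for \<open>hs = [h\<^sub>1, \<dots>, h\<^sub>n]\<close>.  Via \<^const>\<open>rep\<close> it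
  depends on the choice of representatives only on a null set of points \<open>x\<close>.
\<close>

definition inverted_orbit :: "('a \<Rightarrow> 'a) set list \<Rightarrow> 'a \<Rightarrow> 'a set" where
  "inverted_orbit hs x = {fold (\<lambda>h y. rep h y) (drop k hs) x |k. k \<le> length hs}"

text \<open>Law of the inverted orbit of \<open>x\<close> under the first \<open>n\<close> steps of the \<open>\<nu>\<close>-walk.\<close>

definition random_inverted_orbit :: "('a \<Rightarrow> 'a) set pmf \<Rightarrow> nat \<Rightarrow> 'a \<Rightarrow> 'a set pmf" where
  "random_inverted_orbit \<nu> n x = map_pmf (\<lambda>hs. inverted_orbit hs x) (replicate_pmf n \<nu>)"

end

theory Submission
  imports Defs
begin

text \<open>
  After \<open>n \<ge> 1\<close> steps the lamp configuration is \<open>c\<^sub>n = \<Sum>\<^sub>k t\<^sub>k graph (h\<^sub>n \<dots> h\<^sub>k\<^sub>+\<^sub>1)\<close> with independent fair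
  coins \<open>t\<^sub>0, \<dots>, t\<^sub>n\<close>.  Hence, conditionally on the increments, the section of \<open>c\<^sub>n\<close> over \<open>x\<close> is a
  uniformly distributed subset of the inverted orbit of \<open>x\<close>: it is empty with probability
  \<open>2 powr -|O\<^sub>n(x)|\<close>, and by Hoeffding's inequality it rarely contains less than a quarter of
  \<open>O\<^sub>n(x)\<close>.  Since \<open>d(c\<^sub>n, \<emptyset>)\<close> is the integral of the cardinalities of the sections, Markov's
  inequality and Fubini give both estimates.  The Kesten properties are applied to balls
  \<open>d(c, \<emptyset>) < r\<close>, whose \<open>n\<close>-fold products lie in \<open>d(c, \<emptyset>) < r n\<close>.

  That \<open>d\<close> is a metric, and even that null elements have empty sections almost everywhere,
  requires the cardinality of the sections of a Borel set to be measurable for the completed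
  measure; this comes from the measurable projection theorem, proved with Souslin's operation.
\<close>

subsection \<open>Measurable projection\<close>

text \<open>The coins number \<open>n + 1\<close> because the right lamp of each new increment meets
  the top lamp of the old position: their product is the lamp of the xor, and the xor of a bit with
  an independent fair coin is a fair coin. At time 0 no coin has been thrown, which is why (1) is
  restricted to \<open>n \<ge> 1\<close>. Increments are listed latest first, so that a step of the
  walk is a \<open>Cons\<close> and the section over \<open>x\<close> evolves by applying an
  injective map and toggling \<open>x\<close>. The constants come from Markov's inequality with
  threshold \<open>t\<close>. In (1), \<open>t = 1\<close>: fewer than one lit point means none. In
  (2), the bound \<open>\<epsilon> n / 2\<close> on the distance and \<open>t = \<epsilon> n\<close>
  give the factor 1/2, and an orbit of more than \<open>4 t\<close> points has fewer than
  \<open>t\<close> lit ones with probability at most \<open>exp (- t / 2)\<close>. The obstacle is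
  that group elements are classes with arbitrarily chosen representatives. Orbits and lamp sections
  are therefore defined at every point from these choices, and tied to the group only almost
  everywhere; the algebra of the walk takes place in \<open>CG\<close>, where the laws of the action
  are proved.\<close>

definition souslin_scheme :: "'z set set \<Rightarrow> (nat \<Rightarrow> (nat \<Rightarrow> nat) \<Rightarrow> 'z set) \<Rightarrow> bool" where
  "souslin_scheme P Q \<longleftrightarrow>
     (\<forall>m \<sigma> \<tau>. (\<forall>i\<le>m. \<sigma> i = \<tau> i) \<longrightarrow> Q m \<sigma> = Q m \<tau>) \<and> (\<forall>m \<sigma>. Q m \<sigma> \<in> P)"

text \<open>The union over all branches of the intersection along the branch. Whole sequences serve
  as indices in place of finite words; \<open>souslin_scheme\<close> demands that depth
  \<open>m\<close> sees only the entries up to \<open>m\<close>, and branches can then be recoded by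
  pairing functions.\<close>

definition souslin_operation :: "(nat \<Rightarrow> (nat \<Rightarrow> nat) \<Rightarrow> 'z set) \<Rightarrow> 'z set" where
  "souslin_operation Q = {z. \<exists>\<sigma>. \<forall>m. z \<in> Q m \<sigma>}"

definition souslin :: "'z set set \<Rightarrow> 'z set set" where
  "souslin P = souslin_operation ` {Q. souslin_scheme P Q}"

lemma souslin_schemeI:
  assumes "\<And>m \<sigma> \<tau>. (\<And>i. i \<le> m \<Longrightarrow> \<sigma> i = \<tau> i) \<Longrightarrow> Q m \<sigma> = Q m \<tau>"
    and "\<And>m \<sigma>. Q m \<sigma> \<in> P"
  shows "souslin_scheme P Q"
  unfolding souslin_scheme_def
proof (intro conjI allI impI)
  show "Q m \<sigma> = Q m \<tau>" if "\<forall>i\<le>m. \<sigma> i = \<tau> i" for m \<sigma> \<tau>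
    by (rule assms(1)) (use that in simp)
qed (rule assms(2))

lemma souslin_scheme_cong:
  "souslin_scheme P Q \<Longrightarrow> (\<And>i. i \<le> m \<Longrightarrow> \<sigma> i = \<tau> i) \<Longrightarrow> Q m \<sigma> = Q m \<tau>"
  by (simp add: souslin_scheme_def)

lemma souslin_scheme_in: "souslin_scheme P Q \<Longrightarrow> Q m \<sigma> \<in> P"
  by (simp add: souslin_scheme_def)

lemma souslin_operation_iff: "z \<in> souslin_operation Q \<longleftrightarrow> (\<exists>\<sigma>. \<forall>m. z \<in> Q m \<sigma>)"
  by (simp add: souslin_operation_def)

lemma souslinI: "souslin_scheme P Q \<Longrightarrow> souslin_operation Q \<in> souslin P"
  by (simp add: souslin_def)

lemma souslin_basic:
  assumes "A \<in> P"
  shows "A \<in> souslin P"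
proof -
  have "souslin_operation (\<lambda>m \<sigma>. A) \<in> souslin P"
    using assms by (intro souslinI souslin_schemeI) auto
  then show ?thesis by (simp add: souslin_operation_def)
qed

lemma souslin_choice:
  assumes "\<And>i. S i \<in> souslin P"
  obtains Q where "\<And>i. souslin_scheme P (Q i)" "\<And>i. S i = souslin_operation (Q i)"
proof -
  have "\<forall>i. \<exists>Q. souslin_scheme P Q \<and> S i = souslin_operation Q"
    using assms unfolding souslin_def by blast
  then show ?thesis using that by metis
qed

text \<open>When countably many sequences are interleaved into one, the initial segment up to
  \<open>prod_encode (i, n)\<close> must contain the entries up to \<open>n\<close> of the
  \<open>i\<close>-th sequence.\<close>

lemma prod_encode_mono2: "k \<le> n \<Longrightarrow> prod_encode (i, k) \<le> prod_encode (i, n)"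
  by (simp add: prod_encode_def triangle_def add_mono div_le_mono mult_le_mono)

text \<open>A point of the intersection has one branch for each \<open>i\<close>; all of them are
  interleaved into a single branch, and depth \<open>prod_encode (i, n)\<close> of the new scheme
  tests depth \<open>n\<close> of the \<open>i\<close>-th one.\<close>

lemma souslin_INT:
  assumes "\<And>i::nat. S i \<in> souslin P"
  shows "(\<Inter>i. S i) \<in> souslin P"
proof -
  obtain Q where Q: "\<And>i. souslin_scheme P (Q i)" "\<And>i. S i = souslin_operation (Q i)"
    using souslin_choice[where S=S, OF assms] by blast
  define Q' where "Q' m \<sigma> = (case prod_decode m of (i, n) \<Rightarrow> Q i n (\<lambda>k. \<sigma> (prod_encode (i, k))))"
    for m \<sigma>
  have "souslin_scheme P Q'"
  proof (rule souslin_schemeI)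
    fix m \<sigma> \<tau> assume eq: "\<And>i::nat. i \<le> m \<Longrightarrow> \<sigma> i = (\<tau> i :: nat)"
    obtain i n where mn: "prod_decode m = (i, n)" by force
    then have "m = prod_encode (i, n)" by (metis prod_decode_inverse)
    then have "Q i n (\<lambda>k. \<sigma> (prod_encode (i, k))) = Q i n (\<lambda>k. \<tau> (prod_encode (i, k)))"
      using eq prod_encode_mono2[of _ n i] by (intro souslin_scheme_cong[OF Q(1)]) auto
    then show "Q' m \<sigma> = Q' m \<tau>"
      by (simp add: mn Q'_def)
  next
    show "Q' m \<sigma> \<in> P" for m \<sigma>
      by (auto simp: Q'_def souslin_scheme_in[OF Q(1)] split: prod.split)
  qed
  moreover have "(\<Inter>i. S i) = souslin_operation Q'"
  proof (intro equalityI subsetI)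
    fix z assume "z \<in> (\<Inter>i. S i)"
    then have "\<forall>i. \<exists>\<sigma>. \<forall>m. z \<in> Q i m \<sigma>" using Q(2) by (auto simp: souslin_operation_iff)
    then obtain s where s: "\<And>i m. z \<in> Q i m (s i)" by metis
    have "\<forall>m. z \<in> Q' m (\<lambda>j. case prod_decode j of (i, k) \<Rightarrow> s i k)"
      using s by (auto simp: Q'_def split: prod.split)
    then show "z \<in> souslin_operation Q'" by (auto simp: souslin_operation_iff)
  next
    fix z assume "z \<in> souslin_operation Q'"
    then obtain \<sigma> where \<sigma>: "\<And>m. z \<in> Q' m \<sigma>" by (auto simp: souslin_operation_iff)
    have "z \<in> Q i n (\<lambda>k. \<sigma> (prod_encode (i, k)))" for i n
      using \<sigma>[of "prod_encode (i, n)"] by (simp add: Q'_def)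
    then show "z \<in> (\<Inter>i. S i)" using Q(2) by (auto simp: souslin_operation_iff)
  qed
  ultimately show ?thesis using souslinI by metis
qed

text \<open>The index \<open>i\<close> of the union is stored together with the old entry 0 in the
  new entry 0, so it is already known at depth 0.\<close>

lemma souslin_UN:
  assumes "\<And>i::nat. S i \<in> souslin P"
  shows "(\<Union>i. S i) \<in> souslin P"
proof -
  obtain Q where Q: "\<And>i. souslin_scheme P (Q i)" "\<And>i. S i = souslin_operation (Q i)"
    using souslin_choice[where S=S, OF assms] by blast
  define h where "h \<sigma> = fst (prod_decode (\<sigma> 0))" for \<sigma> :: "nat \<Rightarrow> nat"
  define t where "t \<sigma> k = (if k = 0 then snd (prod_decode (\<sigma> 0)) else \<sigma> k)" for \<sigma> :: "nat \<Rightarrow> nat" and k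
  define Q' where "Q' m \<sigma> = Q (h \<sigma>) m (t \<sigma>)" for m \<sigma>
  have "souslin_scheme P Q'"
  proof (rule souslin_schemeI)
    fix m \<sigma> \<tau> assume eq: "\<And>i::nat. i \<le> m \<Longrightarrow> \<sigma> i = (\<tau> i :: nat)"
    have "h \<sigma> = h \<tau>" using eq[of 0] by (simp add: h_def)
    moreover have "t \<sigma> i = t \<tau> i" if "i \<le> m" for i using eq[of 0] eq[of i] that by (simp add: t_def)
    ultimately show "Q' m \<sigma> = Q' m \<tau>"
      unfolding Q'_def using souslin_scheme_cong[OF Q(1)] by metis
  qed (simp add: Q'_def souslin_scheme_in[OF Q(1)])
  moreover have "(\<Union>i. S i) = souslin_operation Q'"
  proof (intro equalityI subsetI)
    fix z assume "z \<in> (\<Union>i. S i)"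
    then obtain i \<sigma> where \<sigma>: "\<And>m. z \<in> Q i m \<sigma>" using Q(2) by (auto simp: souslin_operation_iff)
    let ?\<sigma> = "\<sigma>(0 := prod_encode (i, \<sigma> 0))"
    have "t ?\<sigma> = \<sigma>" "h ?\<sigma> = i" by (auto simp: t_def h_def)
    then have "\<forall>m. z \<in> Q' m ?\<sigma>" using \<sigma> by (simp add: Q'_def)
    then show "z \<in> souslin_operation Q'" by (auto simp: souslin_operation_iff)
  qed (auto simp: Q(2) souslin_operation_iff Q'_def)
  ultimately show ?thesis using souslinI by metis
qed

text \<open>Souslin sets need not be closed under complement, so the induction carries a set and its
  complement together; a union then becomes an intersection on the other side.\<close>

lemma sigma_sets_souslin:
  assumes P: "P \<subseteq> Pow \<Omega>" "{} \<in> P" "\<Omega> \<in> P" and compl: "\<And>A. A \<in> P \<Longrightarrow> \<Omega> - A \<in> souslin P"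
  shows "sigma_sets \<Omega> P \<subseteq> souslin P"
proof -
  have "S \<in> souslin P \<and> \<Omega> - S \<in> souslin P \<and> S \<subseteq> \<Omega>" if "S \<in> sigma_sets \<Omega> P" for S
    using that
  proof induction
    case (Basic a)
    then show ?case using P compl souslin_basic by auto
  next
    case Empty
    then show ?case using P souslin_basic by auto
  next
    case (Compl a)
    then show ?case by (auto simp: double_diff)
  next
    case (Union a)
    have "\<Omega> - (\<Union>i. a i) = (\<Inter>i. \<Omega> - a i)" by auto
    then show ?case using Union souslin_UN[of a P] souslin_INT[of "\<lambda>i. \<Omega> - a i" P] by auto
  qed
  then show ?thesis by blast
qed

text \<open>Koenig's lemma: with entry \<open>i\<close> bounded by \<open>a i\<close> the tree of
  admissible initial segments is finitely branching, so witnesses at all depths yield one infinite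
  branch. \<open>ext n \<sigma>\<close> says that the first \<open>n\<close> entries of
  \<open>\<sigma>\<close> extend to a bounded witness at every depth.\<close>

lemma bounded_branch:
  fixes P :: "nat \<Rightarrow> (nat \<Rightarrow> nat) \<Rightarrow> bool"
  assumes dep: "\<And>n \<sigma> \<tau>. (\<And>i. i \<le> n \<Longrightarrow> \<sigma> i = \<tau> i) \<Longrightarrow> P n \<sigma> = P n \<tau>"
    and anti: "\<And>n \<sigma>. P (Suc n) \<sigma> \<Longrightarrow> P n \<sigma>"
    and ex: "\<And>n. \<exists>\<sigma>. (\<forall>i\<le>n. \<sigma> i \<le> a i) \<and> P n \<sigma>"
  shows "\<exists>\<sigma>. \<forall>n. P n \<sigma>"
proof -
  have antimono: "P n \<sigma>" if "P m \<sigma>" "n \<le> m" for n m \<sigma>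
    using that(2,1) by (induction rule: dec_induct) (auto intro: anti)
  define ext where "ext n \<sigma> \<longleftrightarrow> (\<forall>N. \<exists>\<tau>. (\<forall>i<n. \<tau> i = \<sigma> i) \<and> (\<forall>i\<le>N. \<tau> i \<le> a i) \<and> P N \<tau>)"
    for n \<sigma>
  have step: "\<exists>v. ext (Suc n) (\<sigma>(n := v))" if "ext n \<sigma>" for n \<sigma>
  proof (rule ccontr)
    assume "\<nexists>v. ext (Suc n) (\<sigma>(n := v))"
    then have "\<forall>v. \<exists>N. \<not> (\<exists>\<tau>. (\<forall>i<Suc n. \<tau> i = (\<sigma>(n := v)) i) \<and> (\<forall>i\<le>N. \<tau> i \<le> a i) \<and> P N \<tau>)"
      unfolding ext_def by blast
    then obtain N where N: "\<And>v \<tau>. (\<forall>i<Suc n. \<tau> i = (\<sigma>(n := v)) i) \<Longrightarrow>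
        (\<forall>i\<le>N v. \<tau> i \<le> a i) \<Longrightarrow> \<not> P (N v) \<tau>" by metis
    \<comment> \<open>If each value \<open>v\<close> failed at some depth \<open>N v\<close>, a
      witness at depth \<open>K\<close> would contradict the failure of its own entry
      \<open>n\<close>. Including \<open>n\<close> in the maximum ensures that this entry obeys the
      bound \<open>a n\<close>.\<close>
    define K where "K = Max (insert n (N ` {..a n}))"
    have K: "n \<le> K" "\<And>v. v \<le> a n \<Longrightarrow> N v \<le> K"
      unfolding K_def by (rule Max_ge; auto)+
    obtain \<tau> where \<tau>: "\<forall>i<n. \<tau> i = \<sigma> i" "\<forall>i\<le>K. \<tau> i \<le> a i" "P K \<tau>"
      using \<open>ext n \<sigma>\<close> unfolding ext_def by blast
    have *: "N (\<tau> n) \<le> K" using \<tau>(2) K by simp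
    have "\<not> P (N (\<tau> n)) \<tau>" using \<tau> * by (intro N) (auto simp: less_Suc_eq)
    moreover have "P (N (\<tau> n)) \<tau>" using \<tau>(3) * by (rule antimono)
    ultimately show False by blast
  qed
  have "\<exists>s. \<forall>n. ext n (s n) \<and> (\<exists>v. s (Suc n) = (s n)(n := v))"
  proof (rule dependent_nat_choice)
    show "\<exists>s. ext 0 s" using ex by (auto simp: ext_def)
    show "\<exists>y. ext (Suc n) y \<and> (\<exists>v. y = x(n := v))" if "ext n x" for x n
      using step[OF that] by blast
  qed
  then obtain s where s: "\<And>n. ext n (s n)" "\<And>n. \<exists>v. s (Suc n) = (s n)(n := v)" by blast
  \<comment> \<open>Step \<open>n\<close> of the choice alters coordinate \<open>n\<close> alone, so
    coordinate \<open>i\<close> is final from stage \<open>Suc i\<close> on.\<close>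
  define \<sigma> where "\<sigma> i = s (Suc i) i" for i
  have agree: "s m i = \<sigma> i" if "Suc i \<le> m" for m i
    using that
  proof (induction rule: dec_induct)
    case (step n)
    then show ?case using s(2)[of n] by auto
  qed (simp add: \<sigma>_def)
  have "P n \<sigma>" for n
  proof -
    obtain \<tau> where \<tau>: "\<forall>i<Suc n. \<tau> i = s (Suc n) i" "P n \<tau>"
      using s(1)[of "Suc n"] unfolding ext_def by (meson le_refl lessI less_imp_le)
    then have "P n \<tau> = P n \<sigma>"
      using agree by (intro dep) auto
    with \<tau> show ?thesis by simp
  qed
  then show ?thesis by blast
qed

text \<open>Capacitability: bounds on the branch entries are chosen one at a time so that the outer
  measure stays above \<open>c\<close>. Under these bounds only finitely many initial segments
  survive at each depth, which gives decreasing measurable sets, and Koenig's lemma places their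
  intersection inside \<open>S\<close>.\<close>

lemma (in finite_measure) souslin_inner_approx:
  assumes S: "S \<in> souslin (sets M)" and c: "c < outer_measure_of M S"
  shows "\<exists>T\<in>sets M. T \<subseteq> S \<and> c \<le> emeasure M T"
proof -
  obtain Q0 where Q0: "souslin_scheme (sets M) Q0" "S = souslin_operation Q0"
    using S by (auto simp: souslin_def)
  \<comment> \<open>Intersecting along the branch makes the scheme decreasing in the depth without
    changing the set it defines.\<close>
  define Q where "Q m \<sigma> = (\<Inter>j\<le>m. Q0 j \<sigma>)" for m \<sigma>
  have Q_dep: "Q m \<sigma> = Q m \<tau>" if "\<And>i. i \<le> m \<Longrightarrow> \<sigma> i = \<tau> i" for m \<sigma> \<tau>
    unfolding Q_def using that by (intro INF_cong souslin_scheme_cong[OF Q0(1)]) auto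
  have Q_sets: "Q m \<sigma> \<in> sets M" for m \<sigma>
    unfolding Q_def using souslin_scheme_in[OF Q0(1)] by auto
  have Q_anti: "Q (Suc m) \<sigma> \<subseteq> Q m \<sigma>" for m \<sigma> unfolding Q_def by auto
  have S_eq: "S = {z. \<exists>\<sigma>. \<forall>m. z \<in> Q m \<sigma>}" unfolding Q0(2) souslin_operation_def Q_def by auto
  define B where "B n a = {z. \<exists>\<sigma>. (\<forall>i<n. \<sigma> i \<le> a i) \<and> (\<forall>m. z \<in> Q m \<sigma>)}" for n and a :: "nat \<Rightarrow> nat"
  have B_cong: "B n a = B n b" if "\<And>i. i < n \<Longrightarrow> a i = b i" for n a b
    using that by (auto simp: B_def)
  have B_space: "B n a \<subseteq> space M" for n a
    using sets.sets_into_space[OF Q_sets[of 0]] by (auto simp: B_def)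
  have "\<exists>a. \<forall>n. c < outer_measure_of M (B n (a n)) \<and> (\<exists>v. a (Suc n) = (a n)(n := v))"
  proof (rule dependent_nat_choice)
    show "\<exists>a. c < outer_measure_of M (B 0 a)" using c by (simp add: B_def S_eq)
  next
    fix a n assume *: "c < outer_measure_of M (B n a)"
    have "B n a = (\<Union>v. B (Suc n) (a(n := v)))"
    proof (intro equalityI subsetI)
      fix z assume "z \<in> B n a"
      then obtain \<sigma> where "\<forall>i<n. \<sigma> i \<le> a i" "\<forall>m. z \<in> Q m \<sigma>" by (auto simp: B_def)
      then have "z \<in> B (Suc n) (a(n := \<sigma> n))" by (auto simp: B_def intro!: exI[of _ \<sigma>])
      then show "z \<in> (\<Union>v. B (Suc n) (a(n := v)))" by blast
    next
      fix z assume "z \<in> (\<Union>v. B (Suc n) (a(n := v)))"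
      then obtain v \<sigma> where "\<forall>i<Suc n. \<sigma> i \<le> (a(n := v)) i" "\<forall>m. z \<in> Q m \<sigma>"
        unfolding B_def by blast
      moreover from this(1) have "\<forall>i<n. \<sigma> i \<le> a i" by (metis fun_upd_other less_SucI less_irrefl)
      ultimately show "z \<in> B n a" unfolding B_def by blast
    qed
    moreover have "incseq (\<lambda>v. B (Suc n) (a(n := v)))"
    proof (intro monoI subsetI)
      fix v w :: nat and z assume "v \<le> w" "z \<in> B (Suc n) (a(n := v))"
      then show "z \<in> B (Suc n) (a(n := w))"
      proof -
        obtain \<sigma> where \<sigma>: "\<forall>i<Suc n. \<sigma> i \<le> (a(n := v)) i" "\<forall>m. z \<in> Q m \<sigma>"
          using \<open>z \<in> B (Suc n) (a(n := v))\<close> unfolding B_def by blast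
        then have "\<forall>i<Suc n. \<sigma> i \<le> (a(n := w)) i"
          using \<open>v \<le> w\<close> by (auto simp: less_Suc_eq)
        with \<sigma>(2) show ?thesis unfolding B_def by blast
      qed
    qed
    \<comment> \<open>Outer measure is continuous from below along increasing sets even when these
      are not measurable, so some finite bound \<open>v\<close> on entry \<open>n\<close> keeps it
      above \<open>c\<close>.\<close>
    ultimately have "outer_measure_of M (B n a) = (SUP v. outer_measure_of M (B (Suc n) (a(n := v))))"
      using SUP_outer_measure_of_incseq[of "\<lambda>v. B (Suc n) (a(n := v))" M] B_space by simp
    then show "\<exists>y. c < outer_measure_of M (B (Suc n) y) \<and> (\<exists>v. y = a(n := v))"
      using * by (auto simp: less_SUP_iff)
  qed
  then obtain a' where a': "\<And>n. c < outer_measure_of M (B n (a' n))"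
    "\<And>n. \<exists>v. a' (Suc n) = (a' n)(n := v)" by blast
  define a where "a i = a' (Suc i) i" for i
  have agree: "a' m i = a i" if "Suc i \<le> m" for m i
    using that
  proof (induction rule: dec_induct)
    case (step n)
    then show ?case using a'(2)[of n] by auto
  qed (simp add: a_def)
  have ca: "c < outer_measure_of M (B n a)" for n
    using a'(1)[of n] B_cong[of n "a' n" a] agree by auto
  \<comment> \<open>A measurable superset of \<open>B (Suc n) a\<close>: only depth \<open>n\<close>
    is tested. Restricting \<open>\<sigma>\<close> to \<open>{..n}\<close> makes the union finite,
    and by \<open>Q_dep\<close> nothing is lost.\<close>
  define T where "T n = (\<Union>\<sigma>\<in>PiE {..n} (\<lambda>i. {..a i}). Q n \<sigma>)" for n
  have T_iff: "z \<in> T n \<longleftrightarrow> (\<exists>\<sigma>. (\<forall>i\<le>n. \<sigma> i \<le> a i) \<and> z \<in> Q n \<sigma>)" for z n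
  proof
    assume "\<exists>\<sigma>. (\<forall>i\<le>n. \<sigma> i \<le> a i) \<and> z \<in> Q n \<sigma>"
    then obtain \<sigma> where \<sigma>: "\<forall>i\<le>n. \<sigma> i \<le> a i" "z \<in> Q n \<sigma>" by blast
    have "Q n \<sigma> = Q n (restrict \<sigma> {..n})" by (rule Q_dep) auto
    with \<sigma> show "z \<in> T n" unfolding T_def by (intro UN_I[of "restrict \<sigma> {..n}"]) auto
  qed (auto simp: T_def PiE_def Pi_def)
  have T_sets: "T n \<in> sets M" for n
    unfolding T_def using Q_sets by (intro sets.finite_UN finite_PiE) auto
  have T_dec: "decseq T"
  proof (intro decseq_SucI subsetI)
    fix n z assume "z \<in> T (Suc n)"
    then obtain \<sigma> where "\<forall>i\<le>Suc n. \<sigma> i \<le> a i" "z \<in> Q (Suc n) \<sigma>" by (auto simp: T_iff)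
    then have "\<forall>i\<le>n. \<sigma> i \<le> a i" "z \<in> Q n \<sigma>" using Q_anti by auto
    then show "z \<in> T n" by (auto simp: T_iff)
  qed
  have "B (Suc n) a \<subseteq> T n" for n
  proof
    fix z assume "z \<in> B (Suc n) a"
    then obtain \<sigma> where "\<forall>i<Suc n. \<sigma> i \<le> a i" "\<forall>m. z \<in> Q m \<sigma>"
      unfolding B_def by blast
    then show "z \<in> T n" unfolding T_iff by (intro exI[of _ \<sigma>]) (auto simp: less_Suc_eq_le)
  qed
  then have cT: "c \<le> emeasure M (T n)" for n
    using ca[of "Suc n"] outer_measure_of_mono[of "B (Suc n) a" "T n" M] T_sets[of n] by simp
  have "emeasure M (\<Inter>n. T n) = (INF n. emeasure M (T n))"
    using T_sets T_dec by (intro INF_emeasure_decseq[symmetric]) auto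
  then have "c \<le> emeasure M (\<Inter>n. T n)" using cT by (simp add: le_INF_iff)
  moreover have "(\<Inter>n. T n) \<subseteq> S"
  proof
    fix z assume z: "z \<in> (\<Inter>n. T n)"
    have "\<exists>\<sigma>. \<forall>n. z \<in> Q n \<sigma>"
    proof (rule bounded_branch[of "\<lambda>n \<sigma>. z \<in> Q n \<sigma>" a])
      show "z \<in> Q n \<sigma> \<longleftrightarrow> z \<in> Q n \<tau>" if "\<And>i. i \<le> n \<Longrightarrow> \<sigma> i = \<tau> i" for n \<sigma> \<tau>
        using Q_dep[OF that] by simp
      show "z \<in> Q n \<sigma>" if "z \<in> Q (Suc n) \<sigma>" for n \<sigma> using that Q_anti by auto
      show "\<exists>\<sigma>. (\<forall>i\<le>n. \<sigma> i \<le> a i) \<and> z \<in> Q n \<sigma>" for n using z T_iff[of z n] by simp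
    qed
    then show "z \<in> S" by (simp add: S_eq)
  qed
  moreover have "(\<Inter>n. T n) \<in> sets M" using T_sets by auto
  ultimately show ?thesis by blast
qed

text \<open>\<open>S\<close> is squeezed between a measurable hull \<open>E\<close> and a countable
  union of measurable subsets whose measures exhaust the supremum. The inner approximation forces
  this supremum up to the outer measure of \<open>S\<close>, so the two bounds differ by a null
  set.\<close>

theorem (in finite_measure) souslin_sets_completion:
  assumes S: "S \<in> souslin (sets M)"
  shows "S \<in> sets (completion M)"
proof -
  obtain Q where Q: "souslin_scheme (sets M) Q" "S = souslin_operation Q"
    using S by (auto simp: souslin_def)
  have "S \<subseteq> space M"
  proof
    fix z assume "z \<in> S"
    then obtain \<sigma> where "\<forall>m. z \<in> Q m \<sigma>" unfolding Q(2) souslin_operation_iff by (elim exE)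
    then have "z \<in> Q 0 \<sigma>" by simp
    then show "z \<in> space M" using sets.sets_into_space[OF souslin_scheme_in[OF Q(1)]] by blast
  qed
  from outer_measure_of_attain[OF this]
  obtain E where E: "E \<in> sets M" "S \<subseteq> E" "outer_measure_of M S = emeasure M E"
    by (elim bexE conjE)
  define \<T> where "\<T> = {T \<in> sets M. T \<subseteq> S}"
  have "{} \<in> \<T>" by (simp add: \<T>_def)
  then have "emeasure M ` \<T> \<noteq> {}" by auto
  from ennreal_Sup_countable_SUP[OF this]
  obtain f :: "nat \<Rightarrow> ennreal" where f: "range f \<subseteq> emeasure M ` \<T>"
      "Sup (emeasure M ` \<T>) = (SUP n. f n)"
    by auto
  then have "\<forall>n. \<exists>T. T \<in> \<T> \<and> f n = emeasure M T" by blast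
  then obtain T where T: "\<And>n. T n \<in> \<T>" "\<And>n. f n = emeasure M (T n)" by metis
  let ?T = "\<Union>n. T n"
  have T_sets: "?T \<in> sets M" "?T \<subseteq> S" using T by (auto simp: \<T>_def)
  have "emeasure M E \<le> emeasure M ?T"
  proof (rule ccontr)
    assume "\<not> emeasure M E \<le> emeasure M ?T"
    then have "emeasure M ?T < outer_measure_of M S" using E by simp
    then obtain c where c: "emeasure M ?T < c" "c < outer_measure_of M S"
      using dense by blast
    obtain T' where T': "T' \<in> \<T>" "c \<le> emeasure M T'"
      using souslin_inner_approx[OF S c(2)] by (auto simp: \<T>_def)
    have "emeasure M T' \<le> (SUP n. emeasure M (T n))"
      using SUP_upper[OF T'(1), of "emeasure M"] f(2) T(2) by simp
    also have "\<dots> \<le> emeasure M ?T"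
      using T_sets T by (intro SUP_least emeasure_mono) auto
    finally show False using c T' by simp
  qed
  moreover have "emeasure M ?T \<le> emeasure M E"
    using T_sets E by (intro emeasure_mono) (auto intro: order_trans)
  ultimately have "emeasure (completion M) ?T = emeasure (completion M) E"
    using T_sets E by simp
  then show ?thesis
    using T_sets E
    by (intro completion.complete_sets_sandwich[of ?T M E S]) (auto simp: less_top[symmetric])
qed

text \<open>Closed second factors are what a later compactness-like argument in a complete metric
  needs. Their rectangles still have Souslin complements, because in a metrizable space an open set
  is a countable union of closed sets.\<close>

lemma sets_pair_measure_subset_souslin:
  assumes T: "metrizable_space T" "space N = topspace T"
    and N: "sets N = sigma_sets (topspace T) {U. openin T U}"
  shows "sets (M \<Otimes>\<^sub>M N) \<subseteq> souslin {E \<times> F |E F. E \<in> sets M \<and> closedin T F}" (is "_ \<subseteq> souslin ?P")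
proof -
  let ?\<Omega> = "space M \<times> topspace T"
  have P: "?P \<subseteq> Pow ?\<Omega>" using sets.sets_into_space closedin_subset by fast
  then have P': "sets (sigma ?\<Omega> ?P) = sigma_sets ?\<Omega> ?P" "space (sigma ?\<Omega> ?P) = ?\<Omega>"
    by (auto intro: space_measure_of)
  have rect: "space M \<times> b \<in> sigma_sets ?\<Omega> ?P" if "b \<in> sigma_sets (topspace T) {U. openin T U}" for b
    using that
  proof induction
    case (Basic U)
    have "?\<Omega> - space M \<times> (topspace T - U) \<in> sigma_sets ?\<Omega> ?P"
      using Basic by (intro sigma_sets.Compl sigma_sets.Basic) auto
    moreover have "?\<Omega> - space M \<times> (topspace T - U) = space M \<times> U"
      using Basic openin_subset[of T U] by auto
    ultimately show ?case by simp
  next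
    case (Compl b)
    have "?\<Omega> - space M \<times> b = space M \<times> (topspace T - b)" by auto
    with sigma_sets.Compl[OF Compl(2)] show ?case by simp
  next
    case (Union b)
    have "space M \<times> (\<Union>i. b i) = (\<Union>i. space M \<times> b i)" by auto
    with sigma_sets.Union[of "\<lambda>i. space M \<times> b i" ?\<Omega> ?P] Union show ?case by simp
  qed (simp add: sigma_sets.Empty)
  have "a \<times> b \<in> sigma_sets ?\<Omega> ?P" if "a \<in> sets M" "b \<in> sets N" for a b
  proof -
    have "a \<times> topspace T \<in> sets (sigma ?\<Omega> ?P)" "space M \<times> b \<in> sets (sigma ?\<Omega> ?P)"
      using that rect N unfolding P' by (auto intro!: sigma_sets.Basic)
    then have "(a \<times> topspace T) \<inter> (space M \<times> b) \<in> sets (sigma ?\<Omega> ?P)" by (rule sets.Int)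
    moreover have "(a \<times> topspace T) \<inter> (space M \<times> b) = a \<times> b"
      using sets.sets_into_space[OF that(1)] sets.sets_into_space[OF that(2)] T(2) by auto
    ultimately show ?thesis by (simp add: P')
  qed
  then have "sets (M \<Otimes>\<^sub>M N) \<subseteq> sigma_sets ?\<Omega> ?P"
    unfolding sets_pair_measure T(2) by (intro sigma_sets_mono) auto
  also have "\<dots> \<subseteq> souslin ?P"
  proof (rule sigma_sets_souslin[OF P])
    show "{} \<in> ?P" by force
    show "?\<Omega> \<in> ?P" by auto
    fix A assume "A \<in> ?P"
    then obtain E F where A: "A = E \<times> F" "E \<in> sets M" "closedin T F" by blast
    then have "fsigma_in T (topspace T - F)"
      using T(1) by (intro open_imp_fsigma_in) auto
    then obtain C :: "nat \<Rightarrow> _" where C: "\<And>n. closedin T (C n)" "(\<Union>n. C n) = topspace T - F"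
      by (auto simp: fsigma_in_ascending)
    define S where "S n = (case n of 0 \<Rightarrow> (space M - E) \<times> topspace T | Suc n \<Rightarrow> space M \<times> C n)" for n
    have "S n \<in> ?P" for n using A C by (cases n) (auto simp: S_def)
    then have "(\<Union>n. S n) \<in> souslin ?P" by (intro souslin_UN souslin_basic)
    moreover have "(\<Union>n. S n) = S 0 \<union> (\<Union>n. S (Suc n))"
      by (metis UNIV_nat_eq UN_insert image_image)
    moreover have "\<dots> = (space M - E) \<times> topspace T \<union> space M \<times> (\<Union>n. C n)"
      by (auto simp: S_def)
    moreover have "\<dots> = ?\<Omega> - A"
      using sets.sets_into_space[OF A(2)] unfolding A(1) C(2) by auto
    ultimately show "?\<Omega> - A \<in> souslin ?P" by simp
  qed
  finally show ?thesis .
qed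

text \<open>Refining a scheme of rectangles by shrinking balls in the second factor makes nonempty finite
  intersections witness a point.\<close>

theorem (in finite_measure) measurable_projection:
  assumes N: "standard_borel N" and A: "A \<in> sets (M \<Otimes>\<^sub>M N)"
  shows "fst ` A \<in> sets (completion M)"
proof -
  obtain T where T: "topspace T = space N" "completely_metrizable_space T" "second_countable T"
    "sets N = sigma_sets (topspace T) {U. openin T U}"
    using N by (auto simp: standard_borel_def)
  let ?P = "{E \<times> F |E F. E \<in> sets M \<and> closedin T F}"
  have "A \<in> souslin ?P"
    using sets_pair_measure_subset_souslin[of T N M] T A completely_metrizable_imp_metrizable_space by auto
  then obtain Q where Q: "souslin_scheme ?P Q" "A = souslin_operation Q"
    by (auto simp: souslin_def)
  \<comment> \<open>The factors are recovered as projections, so they inherit the dependence on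
    initial segments. For the empty rectangle both projections are empty, hence still measurable and
    closed.\<close>
  have ef: "B = fst ` B \<times> snd ` B \<and> fst ` B \<in> sets M \<and> closedin T (snd ` B)" if B: "B \<in> ?P" for B
  proof -
    obtain E F where B: "B = E \<times> F" "E \<in> sets M" "closedin T F" using B by auto
    show ?thesis
    proof (cases "E = {} \<or> F = {}")
      case True
      then have "B = {}" using B(1) by auto
      then show ?thesis by simp
    qed (use B in simp)
  qed
  define E where "E m \<sigma> = fst ` Q m \<sigma>" for m \<sigma>
  define F where "F m \<sigma> = snd ` Q m \<sigma>" for m \<sigma>
  have EF: "Q m \<sigma> = E m \<sigma> \<times> F m \<sigma>" "E m \<sigma> \<in> sets M" "closedin T (F m \<sigma>)" for m \<sigma>
    using ef[OF souslin_scheme_in[OF Q(1), of m \<sigma>]] by (simp_all only: E_def F_def)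
  have EF_cong: "E m \<sigma> = E m \<tau>" "F m \<sigma> = F m \<tau>" if "\<And>i. i \<le> m \<Longrightarrow> \<sigma> i = \<tau> i" for m \<sigma> \<tau>
    using souslin_scheme_cong[OF Q(1), of m \<sigma> \<tau>] that by (simp_all add: E_def F_def)
  show ?thesis
  proof (cases "topspace T = {}")
    case True
    then have "space (M \<Otimes>\<^sub>M N) = {}" using T(1) by (simp add: space_pair_measure)
    with sets.sets_into_space[OF A] show ?thesis by simp
  next
    case False
    obtain Y d where "Metric_space Y d" and cm: "Metric_space.mcomplete Y d"
      and T_eq: "T = Metric_space.mtopology Y d"
      using T(2) by (auto simp: completely_metrizable_space_def)
    interpret d: Metric_space Y d by fact
    have Y: "topspace T = Y" by (simp add: T_eq)
    obtain C where C: "countable C" "C \<subseteq> Y" "T closure_of C = Y"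
      using second_countable_imp_separable_space[OF T(3)] Y by (auto simp: separable_space_def)
    with False Y have "C \<noteq> {}" by auto
    then obtain q :: "nat \<Rightarrow> _" where q: "range q = C"
      using C(1) uncountable_def by blast
    have dense: "\<exists>k. y \<in> d.mcball (q k) r" if "y \<in> Y" "r > 0" for y r
    proof -
      have "y \<in> T closure_of C" using that C by simp
      then have "\<exists>z\<in>C. z \<in> d.mball y r"
        using that(2) unfolding T_eq d.metric_closure_of by simp
      then obtain k where "q k \<in> d.mball y r" using q by auto
      then show ?thesis by (intro exI[of _ k]) (auto simp: d.commute)
    qed
    \<comment> \<open>Each entry of the new branch codes a pair: an entry of the old branch and the
      index of a centre. At depth \<open>m\<close> the second factor is cut to a ball of radius
      \<open>1 / Suc m\<close>.\<close>
    define F' where "F' m \<sigma> = F m (fst \<circ> prod_decode \<circ> \<sigma>) \<inter> d.mcball (q (snd (prod_decode (\<sigma> m)))) (1 / Suc m)"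
      for m \<sigma>
    \<comment> \<open>The second coordinate is eliminated by keeping only the information whether
      the second factors up to depth \<open>m\<close> have a common point; this depends on finitely
      many entries.\<close>
    define E' where "E' m \<sigma> = (if (\<Inter>j\<le>m. F' j \<sigma>) = {} then {} else E m (fst \<circ> prod_decode \<circ> \<sigma>))"
      for m \<sigma>
    have F'_cong: "F' m \<sigma> = F' m \<tau>" if "\<And>i. i \<le> m \<Longrightarrow> \<sigma> i = \<tau> i" for m \<sigma> \<tau>
      using EF_cong(2)[of m "fst \<circ> prod_decode \<circ> \<sigma>" "fst \<circ> prod_decode \<circ> \<tau>"] that by (simp add: F'_def)
    have "souslin_scheme (sets M) E'"
    proof (rule souslin_schemeI)
      fix m and \<sigma> \<tau> :: "nat \<Rightarrow> nat" assume eq: "\<And>i. i \<le> m \<Longrightarrow> \<sigma> i = \<tau> i"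
      have "(\<Inter>j\<le>m. F' j \<sigma>) = (\<Inter>j\<le>m. F' j \<tau>)"
        using eq by (intro INF_cong F'_cong) auto
      moreover have "E m (fst \<circ> prod_decode \<circ> \<sigma>) = E m (fst \<circ> prod_decode \<circ> \<tau>)"
        using eq by (intro EF_cong) simp
      ultimately show "E' m \<sigma> = E' m \<tau>" by (simp add: E'_def)
    qed (simp add: E'_def EF)
    moreover have "fst ` A = souslin_operation E'"
    proof (intro equalityI subsetI)
      fix x assume "x \<in> fst ` A"
      then obtain y where "(x, y) \<in> A" by auto
      then have "\<exists>\<sigma>. \<forall>m. (x, y) \<in> Q m \<sigma>" by (simp only: Q(2) souslin_operation_iff)
      then obtain \<sigma> where xy: "\<forall>m. (x, y) \<in> Q m \<sigma>" by (elim exE)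
      then have y: "y \<in> F m \<sigma>" "x \<in> E m \<sigma>" for m using xy[rule_format, of m] unfolding EF(1) by auto
      then have "y \<in> Y" using closedin_subset[OF EF(3)] Y by blast
      then have "\<forall>m. \<exists>k. y \<in> d.mcball (q k) (1 / Suc m)" by (intro allI dense) auto
      then obtain \<tau> where \<tau>: "\<And>m. y \<in> d.mcball (q (\<tau> m)) (1 / Suc m)" by metis
      define \<rho> where "\<rho> m = prod_encode (\<sigma> m, \<tau> m)" for m
      have \<rho>: "fst \<circ> prod_decode \<circ> \<rho> = \<sigma>" by (auto simp: \<rho>_def)
      have "y \<in> F' m \<rho>" for m using y \<tau> unfolding F'_def \<rho> by (simp add: \<rho>_def)
      then have "y \<in> (\<Inter>j\<le>m. F' j \<rho>)" for m by simp
      then have "(\<Inter>j\<le>m. F' j \<rho>) \<noteq> {}" for m by (metis empty_iff)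
      then have "x \<in> E' m \<rho>" for m using y(2)[of m] unfolding E'_def \<rho> by simp
      then show "x \<in> souslin_operation E'" by (auto simp: souslin_operation_iff)
    next
      fix x assume "x \<in> souslin_operation E'"
      then obtain \<rho> where \<rho>: "\<And>m. x \<in> E' m \<rho>" by (auto simp: souslin_operation_iff)
      let ?\<sigma> = "fst \<circ> prod_decode \<circ> \<rho>"
      have x: "x \<in> E m ?\<sigma>" "(\<Inter>j\<le>m. F' j \<rho>) \<noteq> {}" for m
        using \<rho>[of m] by (auto simp: E'_def split: if_splits)
      define K where "K n = (\<Inter>j\<le>n. F' j \<rho>)" for n
      have "\<Inter> (range K) \<noteq> {}"
      \<comment> \<open>Cantor's intersection theorem: nested nonempty closed sets inside balls of
        vanishing radius meet in a complete space. The point found serves for \<open>x\<close>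
        because every set of the scheme is a rectangle.\<close>
      proof (rule cm[unfolded d.mcomplete_nest, rule_format], intro conjI allI impI)
        show "closedin d.mtopology (K n)" for n
          unfolding K_def F'_def using EF(3) T_eq by (intro closedin_INT closedin_Int) auto
        show "K n \<noteq> {}" for n using x(2) by (simp add: K_def)
        show "decseq K" by (auto simp: K_def decseq_def)
        fix r :: real assume "r > 0"
        then obtain n where n: "1 / Suc n < r" using nat_approx_posE by blast
        have "K n \<subseteq> F' n \<rho>" by (auto simp: K_def)
        also have "\<dots> \<subseteq> d.mcball (q (snd (prod_decode (\<rho> n)))) r"
          using n by (auto simp: F'_def)
        finally show "\<exists>n a. K n \<subseteq> d.mcball a r" by blast
      qed
      then obtain y where "\<And>n. y \<in> K n" by auto
      then have "(x, y) \<in> Q m ?\<sigma>" for m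
        unfolding EF(1) using x(1) by (auto simp: K_def F'_def)
      then have "(x, y) \<in> A" unfolding Q(2) souslin_operation_iff by (intro exI[of _ ?\<sigma>] allI)
      then show "x \<in> fst ` A" by force
    qed
    ultimately show ?thesis using souslinI souslin_sets_completion by metis
  qed
qed

section \<open>Countable separation of points and the cardinality of sections\<close>

lemma standard_borel_separating:
  assumes "standard_borel N"
  obtains B :: "nat \<Rightarrow> 'a set" where "\<And>i. B i \<in> sets N"
    "\<And>x y. x \<in> space N \<Longrightarrow> y \<in> space N \<Longrightarrow> x \<noteq> y \<Longrightarrow> \<exists>i. (x \<in> B i) \<noteq> (y \<in> B i)"
proof -
  obtain T where T: "topspace T = space N" "completely_metrizable_space T" "second_countable T"
    "sets N = sigma_sets (topspace T) {U. openin T U}"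
    using assms by (auto simp: standard_borel_def)
  obtain \<B> where \<B>: "countable \<B>" "\<And>V. V \<in> \<B> \<Longrightarrow> openin T V"
    "\<And>U x. openin T U \<Longrightarrow> x \<in> U \<Longrightarrow> \<exists>V\<in>\<B>. x \<in> V \<and> V \<subseteq> U"
    using T(3) unfolding second_countable_def by metis
  define B where "B = from_nat_into (insert {} \<B>)"
  \<comment> \<open>The empty set is added so that the family to be enumerated is nonempty even when
    the base is.\<close>
  have B: "range B = insert {} \<B>" unfolding B_def using \<B>(1) by (intro range_from_nat_into) auto
  show thesis
  proof (rule that[of B])
    have "B i \<in> insert {} \<B>" for i using B by blast
    then have "openin T (B i)" for i using \<B>(2) by (cases "B i = {}") auto
    then show "B i \<in> sets N" for i unfolding T(4) by (auto intro: sigma_sets.Basic)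
    fix x y assume xy: "x \<in> space N" "y \<in> space N" "x \<noteq> y"
    have "Hausdorff_space T"
      using T(2) completely_metrizable_imp_metrizable_space metrizable_imp_Hausdorff_space by blast
    then obtain U V where "openin T U" "x \<in> U" "y \<in> V" "disjnt U V"
      unfolding Hausdorff_space_def using xy T(1) by metis
    then obtain W where "W \<in> \<B>" "x \<in> W" "y \<notin> W" using \<B>(3)[of U x] by (auto simp: disjnt_iff)
    then show "\<exists>i. (x \<in> B i) \<noteq> (y \<in> B i)" using B by (metis UNIV_I image_iff insert_iff)
  qed
qed

text \<open>Two points are equal exactly when no member of the separating sequence distinguishes
  them, a countable conjunction of measurable conditions.\<close>

lemma standard_borel_diagonal:
  assumes "standard_borel N"
  shows "{p \<in> space (N \<Otimes>\<^sub>M N). fst p = snd p} \<in> sets (N \<Otimes>\<^sub>M N)"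
proof -
  obtain B :: "nat \<Rightarrow> 'a set" where B[measurable]: "\<And>i. B i \<in> sets N"
    and sep: "\<And>x y. x \<in> space N \<Longrightarrow> y \<in> space N \<Longrightarrow> x \<noteq> y \<Longrightarrow> \<exists>i. (x \<in> B i) \<noteq> (y \<in> B i)"
    using standard_borel_separating[OF assms] by metis
  have "{p \<in> space (N \<Otimes>\<^sub>M N). \<forall>i. fst p \<in> B i \<longleftrightarrow> snd p \<in> B i} \<in> sets (N \<Otimes>\<^sub>M N)" by measurable
  moreover have "{p \<in> space (N \<Otimes>\<^sub>M N). \<forall>i. fst p \<in> B i \<longleftrightarrow> snd p \<in> B i} =
      {p \<in> space (N \<Otimes>\<^sub>M N). fst p = snd p}"
    using sep by (fastforce simp: space_pair_measure)
  ultimately show ?thesis by simp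
qed

text \<open>The cardinality is approximated from below by the number of membership patterns with
  respect to \<open>B 0, ..., B (n - 1)\<close> that occur in the section. That a given pattern
  \<open>I\<close> occurs over \<open>x\<close> means that \<open>x\<close> lies in the projection
  \<open>H n I\<close> of a measurable set.\<close>

lemma (in finite_measure) measurable_card_section:
  assumes N: "standard_borel N" and A: "A \<in> sets (M \<Otimes>\<^sub>M N)"
  shows "(\<lambda>x. emeasure (count_space UNIV) (A `` {x})) \<in> borel_measurable (completion M)"
proof -
  obtain B :: "nat \<Rightarrow> _ set" where B[measurable]: "\<And>i. B i \<in> sets N"
    and sep: "\<And>x y. x \<in> space N \<Longrightarrow> y \<in> space N \<Longrightarrow> x \<noteq> y \<Longrightarrow> \<exists>i. (x \<in> B i) \<noteq> (y \<in> B i)"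
    using standard_borel_separating[OF N] by metis
  note [measurable] = A
  define g where "g n y = {i. i < n \<and> y \<in> B i}" for n :: nat and y
  define H where "H n I = fst ` {p \<in> space (M \<Otimes>\<^sub>M N). p \<in> A \<and> (\<forall>i<n. snd p \<in> B i \<longleftrightarrow> i \<in> I)}" for n I
  have AN: "A `` {x} \<subseteq> space N" for x
    using sets.sets_into_space[OF A] by (auto simp: space_pair_measure)
  have H_meas: "H n I \<in> sets (completion M)" for n I
    unfolding H_def by (intro measurable_projection[OF N]) measurable
  have H_iff: "x \<in> H n I \<longleftrightarrow> I \<in> g n ` (A `` {x})" if "I \<subseteq> {..<n}" for x n I
    using that sets.sets_into_space[OF A] by (force simp: H_def g_def image_iff)
  have count_n: "(\<Sum>I\<in>Pow {..<n}. indicator (H n I) x) = emeasure (count_space UNIV) (g n ` (A `` {x}))"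
    for n x
  proof -
    have sub: "g n ` (A `` {x}) \<subseteq> Pow {..<n}" by (auto simp: g_def)
    have "(\<Sum>I\<in>Pow {..<n}. indicator (H n I) x) = (\<Sum>I\<in>Pow {..<n}. indicator (g n ` (A `` {x})) I :: ennreal)"
      by (intro sum.cong refl) (auto simp: indicator_def H_iff)
    also have "\<dots> = (\<Sum>I\<in>g n ` (A `` {x}). 1)"
      using sub by (intro sum.mono_neutral_cong_right) auto
    also have "\<dots> = of_nat (card (g n ` (A `` {x})))" by simp
    also have "\<dots> = emeasure (count_space UNIV) (g n ` (A `` {x}))"
      using finite_subset[OF sub] by simp
    finally show ?thesis .
  qed
  have "emeasure (count_space UNIV) (A `` {x}) =
      (SUP n. \<Sum>I\<in>Pow {..<n}. indicator (H n I) x)" for x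
    unfolding count_n
  proof (rule antisym)
    show "(SUP n. emeasure (count_space UNIV) (g n ` (A `` {x}))) \<le> emeasure (count_space UNIV) (A `` {x})"
      by (intro SUP_least) (auto simp: emeasure_count_space card_image_le split: if_splits)
    have fin: "of_nat (card S) \<le> (SUP n. emeasure (count_space UNIV) (g n ` (A `` {x})))"
      if S: "finite S" "S \<subseteq> A `` {x}" for S
    proof -
      have "\<forall>p\<in>S \<times> S. \<exists>i. fst p \<noteq> snd p \<longrightarrow> (fst p \<in> B i) \<noteq> (snd p \<in> B i)"
        using sep AN S(2) by (metis mem_Times_iff subset_iff)
      then obtain k where k: "\<forall>p\<in>S \<times> S. fst p \<noteq> snd p \<longrightarrow> (fst p \<in> B (k p)) \<noteq> (snd p \<in> B (k p))"
        by metis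
      \<comment> \<open>Beyond the separating indices of all pairs in \<open>S\<close>, so that the
        points of \<open>S\<close> show pairwise different patterns.\<close>
      define n where "n = Suc (Max (k ` (S \<times> S)))"
      have kn: "k p < n" if "p \<in> S \<times> S" for p
        using that S(1) by (simp add: n_def less_Suc_eq_le)
      have "inj_on (g n) S"
      proof (rule inj_onI, rule ccontr)
        fix y z assume yz: "y \<in> S" "z \<in> S" "g n y = g n z" "y \<noteq> z"
        then have "k (y, z) \<in> g n y \<longleftrightarrow> k (y, z) \<notin> g n z"
          using k kn[of "(y, z)"] by (auto simp: g_def)
        with yz show False by simp
      qed
      then have "of_nat (card S) = emeasure (count_space UNIV) (g n ` S)"
        using S(1) by (simp add: card_image)
      also have "\<dots> \<le> emeasure (count_space UNIV) (g n ` (A `` {x}))"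
        using S(2) by (intro emeasure_mono) auto
      also have "\<dots> \<le> (SUP n. emeasure (count_space UNIV) (g n ` (A `` {x})))"
        by (rule SUP_upper) simp
      finally show ?thesis .
    qed
    show "emeasure (count_space UNIV) (A `` {x}) \<le> (SUP n. emeasure (count_space UNIV) (g n ` (A `` {x})))"
    proof (cases "finite (A `` {x})")
      case True
      then show ?thesis using fin[of "A `` {x}"] by simp
    next
      case False
      have "of_nat k \<le> (SUP n. emeasure (count_space UNIV) (g n ` (A `` {x})))" for k
        using infinite_arbitrarily_large[OF False, of k] fin by blast
      then have "(SUP n. emeasure (count_space UNIV) (g n ` (A `` {x}))) = \<top>"
        using ennreal_SUP_of_nat_eq_top by (metis SUP_least top_unique)
      then show ?thesis by (simp only: top_greatest)
    qed
  qed
  then show ?thesis using H_meas by simp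
qed

subsection \<open>The group of finite measure subsets\<close>

lemma (in normal)
  assumes "c \<in> carrier (G Mod H)"
  shows rep_mem_coset: "rep c \<in> c"
    and rep_in_carrier: "rep c \<in> carrier G"
    and coset_of_rep: "H #> rep c = c"
proof -
  obtain a where a: "a \<in> carrier G" "c = H #> a" using assms by (auto simp: carrier_FactGroup)
  then have "a \<in> c" using rcos_self is_subgroup by blast
  then show *: "rep c \<in> c" unfolding rep_def by (rule someI)
  show "rep c \<in> carrier G" using * a by (auto simp: r_coset_def)
  show "H #> rep c = c" using repr_independence[of "rep c" H a] * a is_subgroup by simp
qed

text \<open>The choice made by \<open>rep\<close> costs a factor from the normal subgroup. In both
  quotients below that subgroup is trivial almost everywhere, so identities between representatives
  survive up to a null set.\<close>

lemma (in normal) rep_coset: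
  assumes "a \<in> carrier G"
  shows "\<exists>h\<in>H. rep (H #> a) = h \<otimes> a"
proof -
  have "H #> a \<in> carrier (G Mod H)" using assms by (auto simp: carrier_FactGroup)
  from rep_mem_coset[OF this] show ?thesis by (auto simp: r_coset_def)
qed

lemma (in normal) rep_mult_coset:
  assumes "c \<in> carrier (G Mod H)" "c' \<in> carrier (G Mod H)"
  shows "\<exists>h\<in>H. rep (c \<otimes>\<^bsub>G Mod H\<^esub> c') = h \<otimes> (rep c \<otimes> rep c')"
proof -
  have "c \<otimes>\<^bsub>G Mod H\<^esub> c' = H #> (rep c \<otimes> rep c')"
    using rcos_sum[of "rep c" "rep c'"] rep_in_carrier coset_of_rep assms by simp
  then show ?thesis using rep_coset[of "rep c \<otimes> rep c'"] rep_in_carrier assms by simp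
qed

lemma (in normal) coset_eqI_rep:
  assumes "c \<in> carrier (G Mod H)" "c' \<in> carrier (G Mod H)" "h \<in> H" "rep c = h \<otimes> rep c'"
  shows "c = c'"
proof -
  have "rep c \<in> H #> rep c'" using assms by (auto simp: r_coset_def)
  then have "H #> rep c' = H #> rep c"
    using repr_independence[of "rep c" H "rep c'"] rep_in_carrier assms is_subgroup by blast
  then show ?thesis using coset_of_rep assms by metis
qed

locale borel_relation =
  fixes M :: "'a measure" and R :: "('a \<times> 'a) set"
  assumes std: "standard_measure_space M" and cber: "countable_borel_equiv M R"
begin

sublocale prob_space M
  using std by (simp add: standard_measure_space_def)

lemma sb: "standard_borel M"
  using std by (simp add: standard_measure_space_def)

lemma R_sets [measurable]: "R \<in> sets (M \<Otimes>\<^sub>M M)"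
  using cber by (simp add: countable_borel_equiv_def)

lemma R_equiv: "equiv (space M) R"
  using cber by (simp add: countable_borel_equiv_def)

lemma R_refl: "x \<in> space M \<Longrightarrow> (x, x) \<in> R"
  using R_equiv by (auto simp: equiv_def refl_on_def)

lemma R_sym: "(x, y) \<in> R \<Longrightarrow> (y, x) \<in> R"
  using R_equiv by (auto simp: equiv_def sym_def)

lemma R_trans: "(x, y) \<in> R \<Longrightarrow> (y, z) \<in> R \<Longrightarrow> (x, z) \<in> R"
  using R_equiv by (auto simp: equiv_def trans_def)

lemma R_space: "(x, y) \<in> R \<Longrightarrow> x \<in> space M" "(x, y) \<in> R \<Longrightarrow> y \<in> space M"
  using sets.sets_into_space[OF R_sets] by (auto simp: space_pair_measure)

text \<open>Passing to the completion leaves the integral unchanged and makes the integrand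
  measurable, so additivity and the criterion for a vanishing integral become available.\<close>

lemma mu_rel_completion:
  "mu_rel M A = (\<integral>\<^sup>+ x. emeasure (count_space UNIV) (A `` {x}) \<partial>completion M)"
  by (simp add: mu_rel_def nn_integral_completion)

lemma mu_rel_eq_0_iff:
  assumes "A \<in> sets (M \<Otimes>\<^sub>M M)"
  shows "mu_rel M A = 0 \<longleftrightarrow> (AE x in M. A `` {x} = {})"
proof -
  have "mu_rel M A = 0 \<longleftrightarrow> (AE x in completion M. emeasure (count_space UNIV) (A `` {x}) = 0)"
    unfolding mu_rel_completion
    by (rule nn_integral_0_iff_AE) (rule measurable_card_section[OF sb assms])
  then show ?thesis by (simp add: AE_completion_iff emeasure_count_space_eq_0)
qed

lemma mu_rel_Un:
  assumes "A \<in> sets (M \<Otimes>\<^sub>M M)" "B \<in> sets (M \<Otimes>\<^sub>M M)"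
  shows "mu_rel M (A \<union> B) \<le> mu_rel M A + mu_rel M B"
proof -
  have "mu_rel M (A \<union> B) \<le> (\<integral>\<^sup>+ x. emeasure (count_space UNIV) (A `` {x}) +
      emeasure (count_space UNIV) (B `` {x}) \<partial>completion M)"
    unfolding mu_rel_completion Un_Image
    by (intro nn_integral_mono emeasure_subadditive) auto
  also have "\<dots> = mu_rel M A + mu_rel M B"
    unfolding mu_rel_completion using assms
    by (intro nn_integral_add measurable_card_section[OF sb])
  finally show ?thesis .
qed

lemma mu_rel_mono: "A \<subseteq> B \<Longrightarrow> mu_rel M A \<le> mu_rel M B"
  unfolding mu_rel_def by (intro nn_integral_mono emeasure_mono) auto

lemma mu_rel_sym_diff:
  assumes "A \<in> sets (M \<Otimes>\<^sub>M M)" "B \<in> sets (M \<Otimes>\<^sub>M M)"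
  shows "mu_rel M (sym_diff A B) \<le> mu_rel M A + mu_rel M B"
  by (rule order_trans[OF mu_rel_mono mu_rel_Un[OF assms]]) auto

abbreviation "FS \<equiv> finite_subsets_group M R"
abbreviation "NS \<equiv> null_subsets M R"
abbreviation "CC \<equiv> C_group M R"

lemma FS_simps [simp]: "A \<otimes>\<^bsub>FS\<^esub> B = sym_diff A B" "\<one>\<^bsub>FS\<^esub> = {}"
  by (simp_all add: finite_subsets_group_def)

lemma FS_carrier: "A \<in> carrier FS \<longleftrightarrow> A \<in> sets (M \<Otimes>\<^sub>M M) \<and> A \<subseteq> R \<and> mu_rel M A < \<infinity>"
  by (auto simp: finite_subsets_group_def)

lemma NS_iff: "A \<in> NS \<longleftrightarrow> A \<in> sets (M \<Otimes>\<^sub>M M) \<and> A \<subseteq> R \<and> (AE x in M. A `` {x} = {})"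
  by (auto simp: null_subsets_def FS_carrier mu_rel_eq_0_iff dest: mu_rel_eq_0_iff[THEN iffD2])

lemma sym_diff_FS: "A \<in> carrier FS \<Longrightarrow> B \<in> carrier FS \<Longrightarrow> sym_diff A B \<in> carrier FS"
  using mu_rel_sym_diff[of A B] by (auto simp: FS_carrier ennreal_add_less_top intro: le_less_trans)

lemma FS_comm_group: "comm_group FS"
proof (rule comm_groupI)
  show "\<one>\<^bsub>FS\<^esub> \<in> carrier FS" by (simp add: FS_carrier mu_rel_def)
  show "\<exists>B\<in>carrier FS. B \<otimes>\<^bsub>FS\<^esub> A = \<one>\<^bsub>FS\<^esub>" if "A \<in> carrier FS" for A
    using that by (intro bexI[of _ A]) auto
qed (use sym_diff_FS in auto)

sublocale FS: comm_group FS by (rule FS_comm_group)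

lemma FS_inv: "A \<in> carrier FS \<Longrightarrow> inv\<^bsub>FS\<^esub> A = A"
  by (rule FS.inv_equality) auto

lemma NS_subgroup: "subgroup NS FS"
proof (rule subgroup.intro)
  show "NS \<subseteq> carrier FS" by (auto simp: null_subsets_def)
  show "A \<otimes>\<^bsub>FS\<^esub> B \<in> NS" if "A \<in> NS" "B \<in> NS" for A B
  proof -
    have "AE x in M. A `` {x} = {}" "AE x in M. B `` {x} = {}" using that by (auto simp: NS_iff)
    then have "AE x in M. sym_diff A B `` {x} = {}" by eventually_elim auto
    then show ?thesis using that by (auto simp: NS_iff)
  qed
  show "\<one>\<^bsub>FS\<^esub> \<in> NS" by (simp add: NS_iff)
  show "inv\<^bsub>FS\<^esub> A \<in> NS" if "A \<in> NS" for A
    using that FS_inv[of A] by (simp add: null_subsets_def)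
qed

lemma NS_normal: "NS \<lhd> FS"
  using FS.subgroup_imp_normal NS_subgroup by blast

lemma CC_comm_group: "comm_group CC"
  unfolding C_group_def by (rule FS.abelian_FactGroup[OF NS_subgroup])

sublocale CC: comm_group CC by (rule CC_comm_group)

text \<open>Elements of the group are handled through the sections of their representatives, which are
  well defined up to a null set.\<close>

definition represents :: "('a \<times> 'a) set set \<Rightarrow> ('a \<Rightarrow> 'a set) \<Rightarrow> bool" where
  "represents c S \<longleftrightarrow> c \<in> carrier CC \<and> (AE x in M. rep c `` {x} = S x)"

lemma representsD: "represents c S \<Longrightarrow> c \<in> carrier CC"
  by (simp add: represents_def)

lemma represents_rep: "c \<in> carrier CC \<Longrightarrow> represents c (\<lambda>x. rep c `` {x})"
  by (simp add: represents_def)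

lemma represents_cong:
  assumes "represents c S" "AE x in M. S x = S' x"
  shows "represents c S'"
  using assms(2) assms(1)[unfolded represents_def, THEN conjunct2] representsD[OF assms(1)]
  unfolding represents_def by (auto elim: AE_mp)

lemma rep_FS: "c \<in> carrier CC \<Longrightarrow> rep c \<in> carrier FS"
  unfolding C_group_def by (rule normal.rep_in_carrier[OF NS_normal])

lemma sym_diff_Image: "sym_diff A B `` {x} = sym_diff (A `` {x}) (B `` {x})"
  by auto

lemma C_class_carrier: "A \<in> carrier FS \<Longrightarrow> C_class M R A \<in> carrier CC"
  by (auto simp: C_class_def C_group_def carrier_FactGroup)

lemma represents_C_class:
  assumes "A \<in> carrier FS"
  shows "represents (C_class M R A) (\<lambda>x. A `` {x})"
proof -
  obtain N where "N \<in> NS" "rep (C_class M R A) = sym_diff N A"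
    using normal.rep_coset[OF NS_normal assms] by (auto simp: C_class_def)
  moreover from this(1) have "AE x in M. N `` {x} = {}" by (simp add: NS_iff)
  ultimately have "AE x in M. rep (C_class M R A) `` {x} = A `` {x}"
    by (auto elim: AE_mp)
  then show ?thesis using C_class_carrier[OF assms] by (simp add: represents_def)
qed

text \<open>Sections that are empty almost everywhere characterize null elements, so an element is
  determined by its sections up to a null set. Equations in the group are proved below by exhibiting
  a common family of sections.\<close>

lemma represents_unique:
  assumes "represents c S" "represents c' S"
  shows "c = c'"
proof -
  have c: "c \<in> carrier CC" "c' \<in> carrier CC" using assms by (auto dest: representsD)
  have "AE x in M. rep c `` {x} = S x" "AE x in M. rep c' `` {x} = S x"
    using assms by (auto simp: represents_def)
  then have "AE x in M. sym_diff (rep c) (rep c') `` {x} = {}"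
    by eventually_elim (simp add: sym_diff_Image)
  then have "sym_diff (rep c) (rep c') \<in> NS"
    using rep_FS[OF c(1)] rep_FS[OF c(2)] by (auto simp: NS_iff FS_carrier)
  moreover have "rep c = sym_diff (rep c) (rep c') \<otimes>\<^bsub>FS\<^esub> rep c'" by auto
  ultimately show ?thesis
    using normal.coset_eqI_rep[OF NS_normal, of c c'] c by (simp add: C_group_def)
qed

lemma represents_mult:
  assumes "represents c S" "represents c' S'"
  shows "represents (c \<otimes>\<^bsub>CC\<^esub> c') (\<lambda>x. sym_diff (S x) (S' x))"
proof -
  have c: "c \<in> carrier CC" "c' \<in> carrier CC" using assms by (auto dest: representsD)
  obtain N where N: "N \<in> NS" "rep (c \<otimes>\<^bsub>CC\<^esub> c') = sym_diff N (sym_diff (rep c) (rep c'))"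
    using normal.rep_mult_coset[OF NS_normal, of c c'] c by (auto simp: C_group_def)
  have "AE x in M. rep c `` {x} = S x" "AE x in M. rep c' `` {x} = S' x" "AE x in M. N `` {x} = {}"
    using assms N(1) by (auto simp: represents_def NS_iff)
  then have "AE x in M. rep (c \<otimes>\<^bsub>CC\<^esub> c') `` {x} = sym_diff (S x) (S' x)"
    by eventually_elim (simp add: N(2) sym_diff_Image)
  then show ?thesis using c by (simp add: represents_def)
qed

lemma represents_one: "represents \<one>\<^bsub>CC\<^esub> (\<lambda>x. {})"
proof -
  have "C_class M R {} = \<one>\<^bsub>CC\<^esub>"
    using FS.coset_mult_one[OF subgroup.subset[OF NS_subgroup]] by (simp add: C_class_def C_group_def)
  then show ?thesis using represents_C_class[OF FS.one_closed] by simp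
qed

lemma CC_square: "c \<in> carrier CC \<Longrightarrow> c \<otimes>\<^bsub>CC\<^esub> c = \<one>\<^bsub>CC\<^esub>"
  using represents_unique[OF represents_mult[OF represents_rep represents_rep], of c c]
    represents_one by simp

lemma CC_inv: "c \<in> carrier CC \<Longrightarrow> inv\<^bsub>CC\<^esub> c = c"
  by (rule CC.inv_equality) (auto simp: CC_square)

lemma represents_finite: "c \<in> carrier CC \<Longrightarrow> mu_rel M (rep c) < \<infinity>"
  using rep_FS by (simp add: FS_carrier)

lemma L1_dist_one:
  assumes "represents c S"
  shows "L1_dist M c \<one>\<^bsub>CC\<^esub> = enn2real (\<integral>\<^sup>+ x. emeasure (count_space UNIV) (S x) \<partial>M)"
proof -
  have "AE x in M. rep c `` {x} = S x" "AE x in M. rep \<one>\<^bsub>CC\<^esub> `` {x} = {}"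
    using assms represents_one by (auto simp: represents_def)
  then have "AE x in M. emeasure (count_space UNIV) (sym_diff (rep c) (rep \<one>\<^bsub>CC\<^esub>) `` {x}) =
      emeasure (count_space UNIV) (S x)"
    by eventually_elim (simp add: sym_diff_Image)
  then show ?thesis unfolding L1_dist_def mu_rel_def by (simp cong: nn_integral_cong_AE)
qed

text \<open>\<open>enn2real\<close> maps infinity to 0; finiteness guarantees that the real-valued
  distance carries the full information of the integral.\<close>

lemma L1_dist_one_finite:
  assumes "represents c S"
  shows "(\<integral>\<^sup>+ x. emeasure (count_space UNIV) (S x) \<partial>M) < \<infinity>"
proof -
  have "mu_rel M (rep c) = (\<integral>\<^sup>+ x. emeasure (count_space UNIV) (S x) \<partial>M)"
    unfolding mu_rel_def using assms by (intro nn_integral_cong_AE) (auto simp: represents_def)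
  then show ?thesis using represents_finite[OF representsD[OF assms]] by simp
qed

lemma L1_Metric_space: "Metric_space (carrier CC) (L1_dist M)"
proof
  show "0 \<le> L1_dist M c c'" for c c' by (simp add: L1_dist_def)
  show "L1_dist M c c' = L1_dist M c' c" for c c' by (simp add: L1_dist_def Un_commute)
next
  fix c c' assume c: "c \<in> carrier CC" "c' \<in> carrier CC"
  have D: "sym_diff (rep c) (rep c') \<in> carrier FS" by (intro sym_diff_FS rep_FS c)
  have "L1_dist M c c' = 0 \<longleftrightarrow> mu_rel M (sym_diff (rep c) (rep c')) = 0"
    using D by (auto simp: L1_dist_def enn2real_eq_0_iff FS_carrier)
  also have "\<dots> \<longleftrightarrow> (AE x in M. rep c `` {x} = rep c' `` {x})"
  proof -
    have *: "sym_diff (rep c) (rep c') `` {x} = {} \<longleftrightarrow> rep c `` {x} = rep c' `` {x}" for x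
      unfolding sym_diff_Image by auto
    show ?thesis using mu_rel_eq_0_iff[of "sym_diff (rep c) (rep c')"] D
      by (simp only: FS_carrier * simp_thms)
  qed
  also have "\<dots> \<longleftrightarrow> c = c'"
    using represents_unique[OF _ represents_rep, of c c'] c by (auto simp: represents_def)
  finally show "L1_dist M c c' = 0 \<longleftrightarrow> c = c'" .
next
  fix a b c assume abc: "a \<in> carrier CC" "b \<in> carrier CC" "c \<in> carrier CC"
  let ?D = "\<lambda>a b. sym_diff (rep a) (rep b)"
  have D: "?D a b \<in> carrier FS" "?D b c \<in> carrier FS" by (intro sym_diff_FS rep_FS abc)+
  have "mu_rel M (?D a c) \<le> mu_rel M (?D a b \<union> ?D b c)" by (rule mu_rel_mono) auto
  also have "\<dots> \<le> mu_rel M (?D a b) + mu_rel M (?D b c)"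
    using D by (intro mu_rel_Un) (auto simp: FS_carrier)
  finally have "enn2real (mu_rel M (?D a c)) \<le> enn2real (mu_rel M (?D a b) + mu_rel M (?D b c))"
    using D by (intro enn2real_mono) (auto simp: FS_carrier ennreal_add_less_top)
  also have "\<dots> = enn2real (mu_rel M (?D a b)) + enn2real (mu_rel M (?D b c))"
    using D by (intro enn2real_plus) (auto simp: FS_carrier)
  finally show "L1_dist M a c \<le> L1_dist M a b + L1_dist M b c" by (simp add: L1_dist_def)
qed

subsection \<open>The full group\<close>

abbreviation "PG \<equiv> full_group_pre M R"
abbreviation "FG \<equiv> full_group M R"

definition null_subgroup :: "('a \<Rightarrow> 'a) set" where
  "null_subgroup = {g \<in> carrier PG. AE x in M. g x = x}"

lemma PG_carrier:
  "g \<in> carrier PG \<longleftrightarrow> g \<in> Bij (space M) \<and> g \<in> measurable M M \<and>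
     inv_into (space M) g \<in> measurable M M \<and>
     (\<forall>A\<in>sets M. g -` A \<inter> space M \<in> null_sets M \<longleftrightarrow> A \<in> null_sets M) \<and> (AE x in M. (x, g x) \<in> R)"
proof -
  have "preserves_measure_class M g \<longleftrightarrow>
      (\<forall>A\<in>sets M. g -` A \<inter> space M \<in> null_sets M \<longleftrightarrow> A \<in> null_sets M)" if "g \<in> measurable M M"
    unfolding preserves_measure_class_def set_eq_iff null_sets_distr_iff[OF that] by auto
  then show ?thesis by (auto simp: full_group_pre_def borel_automorphisms_def)
qed

lemma PG_Bij: "g \<in> carrier PG \<Longrightarrow> g \<in> Bij (space M)"
  by (simp add: PG_carrier)

lemma PG_bij_betw: "g \<in> carrier PG \<Longrightarrow> bij_betw g (space M) (space M)"
  by (simp add: PG_carrier Bij_def)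

lemma PG_inj: "g \<in> carrier PG \<Longrightarrow> inj_on g (space M)"
  using PG_bij_betw bij_betw_def by blast

lemma PG_space: "g \<in> carrier PG \<Longrightarrow> x \<in> space M \<Longrightarrow> g x \<in> space M"
  using PG_bij_betw bij_betwE by blast

lemma PG_measurable: "g \<in> carrier PG \<Longrightarrow> g \<in> measurable M M"
  by (simp add: PG_carrier)

lemma PG_inv_measurable: "g \<in> carrier PG \<Longrightarrow> inv_into (space M) g \<in> measurable M M"
  by (simp add: PG_carrier)

lemma PG_inv_into_f: "g \<in> carrier PG \<Longrightarrow> x \<in> space M \<Longrightarrow> inv_into (space M) g (g x) = x"
  using PG_inj by simp

lemma PG_f_inv_into: "g \<in> carrier PG \<Longrightarrow> x \<in> space M \<Longrightarrow> g (inv_into (space M) g x) = x"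
  by (rule bij_betw_inv_into_right[OF PG_bij_betw])

lemma PG_inv_into_space: "g \<in> carrier PG \<Longrightarrow> x \<in> space M \<Longrightarrow> inv_into (space M) g x \<in> space M"
  by (rule Bij_inv_into_mem[OF PG_Bij])

lemma PG_null: "g \<in> carrier PG \<Longrightarrow> A \<in> sets M \<Longrightarrow> g -` A \<inter> space M \<in> null_sets M \<longleftrightarrow> A \<in> null_sets M"
  by (simp add: PG_carrier)

lemma PG_R: "g \<in> carrier PG \<Longrightarrow> AE x in M. (x, g x) \<in> R"
  by (simp add: PG_carrier)

lemma AE_PG:
  assumes g: "g \<in> carrier PG" and "AE x in M. Q x"
  shows "AE x in M. Q (g x)"
proof -
  obtain N where N: "{x \<in> space M. \<not> Q x} \<subseteq> N" "N \<in> null_sets M"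
    using assms(2) by (auto simp: eventually_ae_filter)
  then have "g -` N \<inter> space M \<in> null_sets M" using PG_null[OF g] by auto
  then show ?thesis
    using N(1) PG_space[OF g] by (intro AE_I'[of "g -` N \<inter> space M"]) auto
qed

lemma null_sets_PG_inv:
  assumes g: "g \<in> carrier PG" and A: "A \<in> sets M"
  shows "inv_into (space M) g -` A \<inter> space M \<in> null_sets M \<longleftrightarrow> A \<in> null_sets M"
proof -
  have "inv_into (space M) g -` A \<inter> space M \<in> sets M"
    using PG_inv_measurable[OF g] A by (rule measurable_sets)
  moreover have "g -` (inv_into (space M) g -` A \<inter> space M) \<inter> space M = A"
    using sets.sets_into_space[OF A] PG_space[OF g] PG_inv_into_f[OF g] by auto
  ultimately show ?thesis using PG_null[OF g] by metis
qed

lemma AE_PG_inv: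
  assumes g: "g \<in> carrier PG" and "AE x in M. Q x"
  shows "AE x in M. Q (inv_into (space M) g x)"
proof -
  obtain N where N: "{x \<in> space M. \<not> Q x} \<subseteq> N" "N \<in> null_sets M"
    using assms(2) by (auto simp: eventually_ae_filter)
  then have "inv_into (space M) g -` N \<inter> space M \<in> null_sets M" using null_sets_PG_inv[OF g] by auto
  then show ?thesis
    using N(1) PG_inv_into_space[OF g] by (intro AE_I'[of "inv_into (space M) g -` N \<inter> space M"]) auto
qed

lemma PG_subgroup: "subgroup (carrier PG) (BijGroup (space M))"
proof (rule subgroup.intro)
  show "carrier PG \<subseteq> carrier (BijGroup (space M))" using PG_Bij by (auto simp: BijGroup_def)
next
  fix g f assume gf: "g \<in> carrier PG" "f \<in> carrier PG"
  have eq: "g \<otimes>\<^bsub>BijGroup (space M)\<^esub> f = compose (space M) g f"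
    using gf PG_Bij by (simp add: BijGroup_def)
  have B: "compose (space M) g f \<in> Bij (space M)" using gf PG_Bij compose_Bij by blast
  have 1: "compose (space M) g f \<in> measurable M M"
    using measurable_compose[OF PG_measurable[OF gf(2)] PG_measurable[OF gf(1)]]
    by (subst measurable_cong[of _ _ "\<lambda>x. g (f x)"]) (auto simp: compose_def)
  have 2: "inv_into (space M) (compose (space M) g f) \<in> measurable M M"
  proof (subst measurable_cong)
    fix x assume x: "x \<in> space M"
    let ?y = "inv_into (space M) f (inv_into (space M) g x)"
    have "?y \<in> space M" "compose (space M) g f ?y = x"
      using x gf by (auto simp: compose_def PG_inv_into_space PG_f_inv_into)
    then show "inv_into (space M) (compose (space M) g f) x = ?y"
      using B by (metis Bij_def IntD2 bij_betw_def inv_into_f_f mem_Collect_eq)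
  qed (rule measurable_compose[OF PG_inv_measurable[OF gf(1)] PG_inv_measurable[OF gf(2)]])
  have 3: "compose (space M) g f -` A \<inter> space M \<in> null_sets M \<longleftrightarrow> A \<in> null_sets M" if A: "A \<in> sets M" for A
  proof -
    have "compose (space M) g f -` A \<inter> space M = f -` (g -` A \<inter> space M) \<inter> space M"
      using PG_space[OF gf(2)] by (auto simp: compose_def)
    then show ?thesis
      using PG_null[OF gf(1) A] PG_null[OF gf(2), of "g -` A \<inter> space M"]
        measurable_sets[OF PG_measurable[OF gf(1)] A] by simp
  qed
  have 4: "AE x in M. (x, compose (space M) g f x) \<in> R"
    using PG_R[OF gf(2)] AE_PG[OF gf(2) PG_R[OF gf(1)]] AE_space
    by eventually_elim (auto simp: compose_def intro: R_trans)
  show "g \<otimes>\<^bsub>BijGroup (space M)\<^esub> f \<in> carrier PG"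
    unfolding eq PG_carrier using B 1 2 3 4 by blast
next
  show "\<one>\<^bsub>BijGroup (space M)\<^esub> \<in> carrier PG"
  proof -
    let ?i = "\<lambda>x\<in>space M. x"
    have "inv_into (space M) ?i x = x" if "x \<in> space M" for x
      using that by (intro inv_into_f_eq) (auto simp: inj_on_def)
    then have "inv_into (space M) ?i \<in> measurable M M"
      by (subst measurable_cong[of _ _ "\<lambda>x. x"]) auto
    moreover have "?i \<in> measurable M M" by (subst measurable_cong[of _ _ "\<lambda>x. x"]) auto
    moreover have "?i -` A \<inter> space M = A" if "A \<in> sets M" for A
      using sets.sets_into_space[OF that] by auto
    moreover have "AE x in M. (x, ?i x) \<in> R"
      using AE_space by eventually_elim (simp add: R_refl)
    ultimately show ?thesis
      unfolding PG_carrier using id_Bij[of "space M"] by (simp add: BijGroup_def)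
  qed
next
  fix g assume g: "g \<in> carrier PG"
  let ?h = "\<lambda>x\<in>space M. inv_into (space M) g x"
  have eq: "inv\<^bsub>BijGroup (space M)\<^esub> g = ?h" using inv_BijGroup[OF PG_Bij[OF g]] .
  have B: "?h \<in> Bij (space M)" using restrict_inv_into_Bij[OF PG_Bij[OF g]] .
  have 1: "?h \<in> measurable M M"
    using PG_inv_measurable[OF g] by (subst measurable_cong[of _ _ "inv_into (space M) g"]) auto
  have 2: "inv_into (space M) ?h \<in> measurable M M"
  proof (subst measurable_cong)
    fix x assume x: "x \<in> space M"
    have "?h (g x) = x" "g x \<in> space M" using x PG_space[OF g] PG_inv_into_f[OF g] by auto
    then show "inv_into (space M) ?h x = g x"
      using B by (metis Bij_def IntD2 bij_betw_def inv_into_f_f mem_Collect_eq)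
  qed (rule PG_measurable[OF g])
  have 3: "?h -` A \<inter> space M \<in> null_sets M \<longleftrightarrow> A \<in> null_sets M" if A: "A \<in> sets M" for A
  proof -
    have "?h -` A \<inter> space M = inv_into (space M) g -` A \<inter> space M" by auto
    then show ?thesis using null_sets_PG_inv[OF g A] by simp
  qed
  have 4: "AE x in M. (x, ?h x) \<in> R"
    using AE_PG_inv[OF g PG_R[OF g]] AE_space
    by eventually_elim (auto simp: PG_f_inv_into[OF g] intro: R_sym)
  show "inv\<^bsub>BijGroup (space M)\<^esub> g \<in> carrier PG"
    unfolding eq PG_carrier using B 1 2 3 4 by blast
qed

lemma PG_eq: "PG = (BijGroup (space M))\<lparr>carrier := carrier PG\<rparr>"
  by (simp add: full_group_pre_def)

lemma PG_group: "group PG"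
  by (subst PG_eq) (intro subgroup.subgroup_is_group[OF PG_subgroup] group_BijGroup)

sublocale PG: group PG by (rule PG_group)

lemma PG_mult: "g \<in> carrier PG \<Longrightarrow> f \<in> carrier PG \<Longrightarrow> x \<in> space M \<Longrightarrow> (g \<otimes>\<^bsub>PG\<^esub> f) x = g (f x)"
  using PG_Bij by (subst PG_eq) (simp add: BijGroup_def compose_def)

lemma PG_one: "x \<in> space M \<Longrightarrow> \<one>\<^bsub>PG\<^esub> x = x"
  by (subst PG_eq) (simp add: BijGroup_def)

lemma PG_inv: "g \<in> carrier PG \<Longrightarrow> x \<in> space M \<Longrightarrow> (inv\<^bsub>PG\<^esub> g) x = inv_into (space M) g x"
  using group.m_inv_consistent[OF group_BijGroup PG_subgroup, of g] PG_eq
    inv_BijGroup[OF PG_Bij, of g] by simp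

lemma null_subgroup_normal: "null_subgroup \<lhd> PG"
  unfolding PG.normal_inv_iff
proof (intro conjI ballI subgroup.intro)
  show "null_subgroup \<subseteq> carrier PG" by (auto simp: null_subgroup_def)
  show "\<one>\<^bsub>PG\<^esub> \<in> null_subgroup"
    using AE_space by (auto simp: null_subgroup_def PG_one elim: AE_mp)
next
  fix g f assume "g \<in> null_subgroup" "f \<in> null_subgroup"
  then have gf: "g \<in> carrier PG" "f \<in> carrier PG" "AE x in M. g x = x" "AE x in M. f x = x"
    by (auto simp: null_subgroup_def)
  have "AE x in M. (g \<otimes>\<^bsub>PG\<^esub> f) x = x"
    using gf(3,4) AE_space by eventually_elim (simp add: PG_mult gf)
  then show "g \<otimes>\<^bsub>PG\<^esub> f \<in> null_subgroup" using gf by (simp add: null_subgroup_def)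
next
  fix g assume "g \<in> null_subgroup"
  then have g: "g \<in> carrier PG" "AE x in M. g x = x" by (auto simp: null_subgroup_def)
  have "AE x in M. (inv\<^bsub>PG\<^esub> g) x = x"
    using g(2) AE_space
  proof eventually_elim
    case (elim x)
    then show ?case using PG_inv[OF g(1), of x] PG_inv_into_f[OF g(1), of x] by simp
  qed
  then show "inv\<^bsub>PG\<^esub> g \<in> null_subgroup" using g by (simp add: null_subgroup_def)
next
  fix g h assume g: "g \<in> carrier PG" and "h \<in> null_subgroup"
  then have h: "h \<in> carrier PG" "AE x in M. h x = x" by (auto simp: null_subgroup_def)
  have "AE x in M. (g \<otimes>\<^bsub>PG\<^esub> h \<otimes>\<^bsub>PG\<^esub> inv\<^bsub>PG\<^esub> g) x = x"
    using AE_PG_inv[OF g h(2)] AE_space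
    by eventually_elim (simp add: PG_mult g h PG_inv PG_inv_into_space PG_f_inv_into)
  then show "g \<otimes>\<^bsub>PG\<^esub> h \<otimes>\<^bsub>PG\<^esub> inv\<^bsub>PG\<^esub> g \<in> null_subgroup" using g h by (simp add: null_subgroup_def)
qed

lemma FG_eq: "FG = PG Mod null_subgroup"
  unfolding full_group_def null_subgroup_def ..

lemma FG_group: "group FG"
  unfolding FG_eq by (rule normal.factorgroup_is_group[OF null_subgroup_normal])

sublocale FG: group FG by (rule FG_group)

lemma rep_PG: "g \<in> carrier FG \<Longrightarrow> rep g \<in> carrier PG"
  unfolding FG_eq by (rule normal.rep_in_carrier[OF null_subgroup_normal])

lemma rep_null_mult:
  assumes "h \<in> null_subgroup" "f \<in> carrier PG"
  shows "AE x in M. (h \<otimes>\<^bsub>PG\<^esub> f) x = f x"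
proof -
  have h: "h \<in> carrier PG" "AE x in M. h x = x" using assms by (auto simp: null_subgroup_def)
  show ?thesis
    using AE_PG[OF assms(2) h(2)] AE_space by eventually_elim (simp add: PG_mult h assms)
qed

lemma rep_FG_mult:
  assumes "g \<in> carrier FG" "g' \<in> carrier FG"
  shows "AE x in M. rep (g \<otimes>\<^bsub>FG\<^esub> g') x = rep g (rep g' x)"
proof -
  obtain h where h: "h \<in> null_subgroup" "rep (g \<otimes>\<^bsub>FG\<^esub> g') = h \<otimes>\<^bsub>PG\<^esub> (rep g \<otimes>\<^bsub>PG\<^esub> rep g')"
    using normal.rep_mult_coset[OF null_subgroup_normal, of g g'] assms by (auto simp: FG_eq)
  have "AE x in M. rep (g \<otimes>\<^bsub>FG\<^esub> g') x = (rep g \<otimes>\<^bsub>PG\<^esub> rep g') x"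
    unfolding h(2) using h(1) assms rep_PG by (intro rep_null_mult) auto
  then show ?thesis
    using AE_space by eventually_elim (simp add: PG_mult rep_PG assms)
qed

lemma rep_FG_one: "AE x in M. rep \<one>\<^bsub>FG\<^esub> x = x"
proof -
  have one: "\<one>\<^bsub>FG\<^esub> = null_subgroup" unfolding FG_eq by (rule one_FactGroup)
  have "null_subgroup \<in> carrier (PG Mod null_subgroup)"
    using FG.one_closed unfolding one unfolding FG_eq .
  then have "rep null_subgroup \<in> null_subgroup" by (rule normal.rep_mem_coset[OF null_subgroup_normal])
  then show ?thesis unfolding one by (simp only: null_subgroup_def mem_Collect_eq)
qed

lemma FG_eqI_AE:
  assumes g: "g \<in> carrier FG" "g' \<in> carrier FG" and "AE x in M. rep g x = rep g' x"
  shows "g = g'"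
proof -
  let ?h = "rep g \<otimes>\<^bsub>PG\<^esub> inv\<^bsub>PG\<^esub> (rep g')"
  have r: "rep g \<in> carrier PG" "rep g' \<in> carrier PG" using g rep_PG by auto
  have "AE x in M. ?h x = x"
    using AE_PG_inv[OF r(2) assms(3)] AE_space
    by eventually_elim (simp add: PG_mult r PG_inv PG_inv_into_space PG_f_inv_into)
  then have "?h \<in> null_subgroup" using r by (simp add: null_subgroup_def)
  moreover have "rep g = ?h \<otimes>\<^bsub>PG\<^esub> rep g'" using r by (simp add: PG.m_assoc)
  ultimately show ?thesis using normal.coset_eqI_rep[OF null_subgroup_normal, of g g'] g by (simp add: FG_eq)
qed

lemma rep_neq_sets:
  assumes "g \<in> carrier FG" "g' \<in> carrier FG"
  shows "{x \<in> space M. rep g x \<noteq> rep g' x} \<in> sets M"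
proof -
  have [measurable]: "rep g \<in> measurable M M" "rep g' \<in> measurable M M"
    using assms rep_PG PG_measurable by auto
  have "(\<lambda>x. (rep g x, rep g' x)) -` {p \<in> space (M \<Otimes>\<^sub>M M). fst p = snd p} \<inter> space M \<in> sets M"
    by (rule measurable_sets[OF _ standard_borel_diagonal[OF sb]]) measurable
  moreover have "{x \<in> space M. rep g x \<noteq> rep g' x} = space M -
      ((\<lambda>x. (rep g x, rep g' x)) -` {p \<in> space (M \<Otimes>\<^sub>M M). fst p = snd p} \<inter> space M)"
    using assms by (auto simp: space_pair_measure PG_space rep_PG)
  ultimately show ?thesis by simp
qed

lemma uniform_Metric_space: "Metric_space (carrier FG) (uniform_dist M)"
proof
  show "0 \<le> uniform_dist M g g'" for g g' by (simp add: uniform_dist_def)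
  show "uniform_dist M g g' = uniform_dist M g' g" for g g' by (simp add: uniform_dist_def eq_commute)
next
  fix g g' assume g: "g \<in> carrier FG" "g' \<in> carrier FG"
  have "uniform_dist M g g' = 0 \<longleftrightarrow> (AE x in M. rep g x = rep g' x)"
    using AE_iff_measurable[OF rep_neq_sets[OF g], of "\<lambda>x. rep g x = rep g' x"]
    by (simp add: uniform_dist_def emeasure_eq_measure)
  then show "uniform_dist M g g' = 0 \<longleftrightarrow> g = g'" using FG_eqI_AE[OF g] by auto
next
  fix a b c assume "a \<in> carrier FG" "b \<in> carrier FG" "c \<in> carrier FG"
  note s = rep_neq_sets[OF this(1,2)] rep_neq_sets[OF this(2,3)] rep_neq_sets[OF this(1,3)]
  have "uniform_dist M a c \<le> measure M ({x \<in> space M. rep a x \<noteq> rep b x} \<union> {x \<in> space M. rep b x \<noteq> rep c x})"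
    unfolding uniform_dist_def using s by (intro finite_measure_mono) auto
  also have "\<dots> \<le> uniform_dist M a b + uniform_dist M b c"
    unfolding uniform_dist_def using s by (intro measure_Un_le)
  finally show "uniform_dist M a c \<le> uniform_dist M a b + uniform_dist M b c" .
qed

end

subsection \<open>The action and the semidirect product\<close>

lemma inj_on_image_sym_diff:
  assumes "inj_on f S" "A \<subseteq> S" "B \<subseteq> S"
  shows "f ` sym_diff A B = sym_diff (f ` A) (f ` B)"
proof -
  have "A - B \<subseteq> S" "B - A \<subseteq> S" using assms by auto
  then show ?thesis
    using inj_on_image_set_diff[of f S A B] inj_on_image_set_diff[of f S B A] assms
    by (simp only: image_Un)
qed

context borel_relation
begin

lemma aut_image_sets:
  assumes f: "f \<in> carrier PG" and A: "A \<in> sets (M \<Otimes>\<^sub>M M)"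
  shows "(\<lambda>(x, y). (x, f y)) ` A \<in> sets (M \<Otimes>\<^sub>M M)"
proof -
  have [measurable]: "inv_into (space M) f \<in> measurable M M" using PG_inv_measurable[OF f] .
  have "(\<lambda>p. (fst p, inv_into (space M) f (snd p))) -` A \<inter> space (M \<Otimes>\<^sub>M M) \<in> sets (M \<Otimes>\<^sub>M M)"
    by (rule measurable_sets[OF _ A]) measurable
  moreover have "(\<lambda>p. (fst p, inv_into (space M) f (snd p))) -` A \<inter> space (M \<Otimes>\<^sub>M M) =
      (\<lambda>(x, y). (x, f y)) ` A" (is "?L = ?R")
  proof (intro equalityI subsetI)
    fix p assume p: "p \<in> ?L"
    obtain x y where xy: "p = (x, y)" by force
    then have "(x, inv_into (space M) f y) \<in> A" "y \<in> space M" using p by (auto simp: space_pair_measure)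
    then show "p \<in> ?R"
      using PG_f_inv_into[OF f, of y] xy by (intro image_eqI[of _ _ "(x, inv_into (space M) f y)"]) auto
  next
    fix p assume "p \<in> ?R"
    then obtain x y where xy: "p = (x, f y)" "(x, y) \<in> A" by auto
    then have "x \<in> space M" "y \<in> space M"
      using sets.sets_into_space[OF A] by (auto simp: space_pair_measure)
    then show "p \<in> ?L" using xy PG_space[OF f] PG_inv_into_f[OF f] by (simp add: space_pair_measure)
  qed
  ultimately show ?thesis by simp
qed

lemma aut_image_section: "((\<lambda>(x, y). (x, f y)) ` A) `` {x} = f ` (A `` {x})"
  by force

lemma aut_image_FS:
  assumes f: "f \<in> carrier PG" and A: "A \<in> carrier FS"
  shows "(\<lambda>(x, y). (x, f y)) ` A \<inter> R \<in> carrier FS"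
    and "mu_rel M ((\<lambda>(x, y). (x, f y)) ` A \<inter> R) \<le> mu_rel M A"
proof -
  show *: "mu_rel M ((\<lambda>(x, y). (x, f y)) ` A \<inter> R) \<le> mu_rel M A"
    unfolding mu_rel_def
  proof (intro nn_integral_mono)
    fix x
    have "emeasure (count_space UNIV) (((\<lambda>(x, y). (x, f y)) ` A \<inter> R) `` {x}) \<le>
        emeasure (count_space UNIV) (f ` (A `` {x}))"
      unfolding aut_image_section[symmetric] by (intro emeasure_mono) auto
    also have "\<dots> \<le> emeasure (count_space UNIV) (A `` {x})"
      by (auto simp: emeasure_count_space card_image_le)
    finally show "emeasure (count_space UNIV) (((\<lambda>(x, y). (x, f y)) ` A \<inter> R) `` {x}) \<le>
        emeasure (count_space UNIV) (A `` {x})" .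
  qed
  have "(\<lambda>(x, y). (x, f y)) ` A \<inter> R \<in> sets (M \<Otimes>\<^sub>M M)"
    using aut_image_sets[OF f] A R_sets by (auto simp: FS_carrier)
  then show "(\<lambda>(x, y). (x, f y)) ` A \<inter> R \<in> carrier FS"
    using * A by (auto simp: FS_carrier intro: le_less_trans)
qed

abbreviation "act \<equiv> C_act M R"

lemma act_carrier: "g \<in> carrier FG \<Longrightarrow> c \<in> carrier CC \<Longrightarrow> act g c \<in> carrier CC"
  unfolding C_act_def by (intro C_class_carrier aut_image_FS rep_PG rep_FS)

lemma represents_act_Int:
  assumes "g \<in> carrier FG" "c \<in> carrier CC"
  shows "represents (act g c) (\<lambda>x. rep g ` (rep c `` {x}) \<inter> R `` {x})"
proof -
  have "represents (act g c) (\<lambda>x. ((\<lambda>(x, y). (x, rep g y)) ` rep c \<inter> R) `` {x})"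
    unfolding C_act_def by (intro represents_C_class aut_image_FS rep_PG rep_FS assms)
  moreover have "((\<lambda>(x, y). (x, rep g y)) ` rep c \<inter> R) `` {x} = rep g ` (rep c `` {x}) \<inter> R `` {x}" for x
    unfolding aut_image_section[symmetric] by auto
  ultimately show ?thesis by simp
qed

text \<open>Taking images and cutting down to \<open>R\<close> can only shrink the cardinality of
  sections. The bound covers all of \<open>carrier CC\<close>, since the neighbourhoods used for the
  Kesten property of \<open>CR\<close> contain elements outside \<open>C_subgroup\<close>.\<close>

lemma L1_dist_act_one_le:
  assumes "g \<in> carrier FG" "c \<in> carrier CC"
  shows "L1_dist M (act g c) \<one>\<^bsub>CC\<^esub> \<le> L1_dist M c \<one>\<^bsub>CC\<^esub>"
proof -
  have r: "rep c \<in> carrier FS" using rep_FS assms by blast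
  have "L1_dist M (act g c) \<one>\<^bsub>CC\<^esub> = enn2real (mu_rel M ((\<lambda>(x, y). (x, rep g y)) ` rep c \<inter> R))"
    unfolding mu_rel_def C_act_def
    by (intro L1_dist_one represents_C_class aut_image_FS rep_PG rep_FS assms)
  also have "\<dots> \<le> enn2real (mu_rel M (rep c))"
    using aut_image_FS(2)[OF rep_PG r] assms r by (intro enn2real_mono) (auto simp: FS_carrier)
  also have "\<dots> = L1_dist M c \<one>\<^bsub>CC\<^esub>"
    unfolding mu_rel_def by (intro L1_dist_one[symmetric] represents_rep assms)
  finally show ?thesis .
qed

lemma L1_dist_mult_one_le:
  assumes "c \<in> carrier CC" "c' \<in> carrier CC"
  shows "L1_dist M (c \<otimes>\<^bsub>CC\<^esub> c') \<one>\<^bsub>CC\<^esub> \<le> L1_dist M c \<one>\<^bsub>CC\<^esub> + L1_dist M c' \<one>\<^bsub>CC\<^esub>"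
proof -
  have r: "rep c \<in> carrier FS" "rep c' \<in> carrier FS" using rep_FS assms by blast+
  have "L1_dist M (c \<otimes>\<^bsub>CC\<^esub> c') \<one>\<^bsub>CC\<^esub> = enn2real (mu_rel M (sym_diff (rep c) (rep c')))"
    using L1_dist_one[OF represents_mult[OF represents_rep represents_rep]] assms
    unfolding mu_rel_def sym_diff_Image by blast
  also have "\<dots> \<le> enn2real (mu_rel M (rep c) + mu_rel M (rep c'))"
    using mu_rel_sym_diff[of "rep c" "rep c'"] r
    by (intro enn2real_mono) (auto simp: FS_carrier ennreal_add_less_top)
  also have "\<dots> = enn2real (mu_rel M (rep c)) + enn2real (mu_rel M (rep c'))"
    using r by (intro enn2real_plus) (auto simp: FS_carrier)
  also have "\<dots> = L1_dist M c \<one>\<^bsub>CC\<^esub> + L1_dist M c' \<one>\<^bsub>CC\<^esub>"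
    unfolding mu_rel_def using assms L1_dist_one[OF represents_rep] by metis
  finally show ?thesis .
qed

text \<open>Without Feldman--Moore the saturation of a null set is not known to be null, so the laws of
  the action are established for those elements whose sections avoid every null set.  All graphs,
  hence everything generated by graphs, have this property.\<close>

definition avoids_null :: "('a \<times> 'a) set set \<Rightarrow> bool" where
  "avoids_null c \<longleftrightarrow> c \<in> carrier CC \<and> (\<forall>B\<in>null_sets M. AE x in M. rep c `` {x} \<inter> B = {})"

lemma avoids_null_carrier: "avoids_null c \<Longrightarrow> c \<in> carrier CC"
  by (simp add: avoids_null_def)

lemma avoids_null_represents:
  assumes "represents c S"
  shows "avoids_null c \<longleftrightarrow> (\<forall>B\<in>null_sets M. AE x in M. S x \<inter> B = {})"
proof -
  have *: "AE x in M. rep c `` {x} = S x" using assms by (simp add: represents_def)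
  have "(AE x in M. rep c `` {x} \<inter> B = {}) \<longleftrightarrow> (AE x in M. S x \<inter> B = {})" for B
    by (rule eventually_subst) (use * in eventually_elim, simp)
  then show ?thesis using representsD[OF assms] by (simp add: avoids_null_def)
qed

text \<open>The form in which avoidance is used: a property of almost every point holds, for almost
  every \<open>x\<close>, simultaneously at all points of the section over \<open>x\<close>.
  Sections lie in \<open>space M\<close> because representatives lie in \<open>R\<close>.\<close>

lemma avoids_null_AE:
  assumes "avoids_null c" "represents c S" "AE y in M. Q y"
  shows "AE x in M. \<forall>y\<in>S x. y \<in> space M \<and> Q y"
proof -
  obtain B where B: "{y \<in> space M. \<not> Q y} \<subseteq> B" "B \<in> null_sets M"
    using assms(3) by (auto simp: eventually_ae_filter)
  have 1: "AE x in M. S x \<inter> B = {}" using B(2) assms(1) avoids_null_represents[OF assms(2)] by blast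
  have 2: "AE x in M. rep c `` {x} = S x" using assms(2) by (simp add: represents_def)
  have "rep c \<subseteq> R" using rep_FS[OF representsD[OF assms(2)]] by (simp add: FS_carrier)
  then have sub: "y \<in> space M" if "y \<in> rep c `` {x}" for x y using that R_space by blast
  show ?thesis using 1 2 by eventually_elim (use B(1) sub in blast)
qed

text \<open>The cut with \<open>R\<close> in the definition of the action is invisible here: for
  \<open>y\<close> in the section both \<open>(x, y)\<close> and \<open>(y, rep g y)\<close> lie in
  \<open>R\<close>, the latter by avoidance of the null set where \<open>rep g\<close> leaves the
  relation.\<close>

lemma represents_act:
  assumes "g \<in> carrier FG" "avoids_null c" "represents c S"
  shows "represents (act g c) (\<lambda>x. rep g ` S x)"
proof -
  have c: "c \<in> carrier CC" using assms avoids_null_carrier by blast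
  have 1: "AE x in M. \<forall>y\<in>S x. y \<in> space M \<and> (y, rep g y) \<in> R"
    using avoids_null_AE[OF assms(2,3) PG_R[OF rep_PG[OF assms(1)]]] .
  have 2: "AE x in M. rep c `` {x} = S x" using assms(3) by (simp add: represents_def)
  have "rep c \<subseteq> R" using rep_FS[OF c] by (simp add: FS_carrier)
  then have sub: "(x, y) \<in> R" if "y \<in> rep c `` {x}" for x y using that by auto
  show ?thesis
  proof (rule represents_cong[OF represents_act_Int[OF assms(1) c]])
    show "AE x in M. rep g ` (rep c `` {x}) \<inter> R `` {x} = rep g ` S x"
      using 1 2
    proof eventually_elim
      case (elim x)
      then have "rep g ` S x \<subseteq> R `` {x}" using sub[of _ x] by (auto intro: R_trans)
      then show ?case using elim by auto
    qed
  qed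
qed

lemma avoids_null_act:
  assumes g: "g \<in> carrier FG" and c: "avoids_null c"
  shows "avoids_null (act g c)"
proof -
  note r = represents_rep[OF avoids_null_carrier[OF c]]
  show ?thesis
    unfolding avoids_null_represents[OF represents_act[OF g c r]]
  proof
    fix B assume "B \<in> null_sets M"
    then have "AE y in M. y \<notin> B" by (rule AE_not_in)
    then have "AE y in M. rep g y \<notin> B" by (rule AE_PG[OF rep_PG[OF g]])
    from avoids_null_AE[OF c r this] show "AE x in M. rep g ` (rep c `` {x}) \<inter> B = {}"
      by eventually_elim auto
  qed
qed

lemma avoids_null_mult:
  assumes "avoids_null c" "avoids_null c'"
  shows "avoids_null (c \<otimes>\<^bsub>CC\<^esub> c')"
proof -
  note r = represents_rep[OF avoids_null_carrier]
  show ?thesis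
    unfolding avoids_null_represents[OF represents_mult[OF r[OF assms(1)] r[OF assms(2)]]]
  proof
    fix B assume "B \<in> null_sets M"
    then have "AE x in M. rep c `` {x} \<inter> B = {}" "AE x in M. rep c' `` {x} \<inter> B = {}"
      using assms by (auto simp: avoids_null_def)
    then show "AE x in M. sym_diff (rep c `` {x}) (rep c' `` {x}) \<inter> B = {}"
      by eventually_elim auto
  qed
qed

lemma avoids_null_one: "avoids_null \<one>\<^bsub>CC\<^esub>"
  unfolding avoids_null_represents[OF represents_one] by simp

lemma graph_sets:
  assumes "f \<in> carrier PG"
  shows "(\<lambda>x. (x, f x)) ` space M \<in> sets (M \<Otimes>\<^sub>M M)"
proof -
  have "{p \<in> space (M \<Otimes>\<^sub>M M). fst p = snd p} = (\<lambda>x. (x, x)) ` space M"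
    by (auto simp: space_pair_measure)
  then have "(\<lambda>x. (x, x)) ` space M \<in> sets (M \<Otimes>\<^sub>M M)" using standard_borel_diagonal[OF sb] by simp
  from aut_image_sets[OF assms this] show ?thesis by (simp add: image_image)
qed

lemma represents_graph_class:
  assumes g: "g \<in> carrier FG"
  shows "represents (graph_class M R g) (\<lambda>x. {rep g x})"
proof -
  let ?A = "(\<lambda>x. (x, rep g x)) ` space M \<inter> R"
  have "mu_rel M ?A \<le> (\<integral>\<^sup>+ x. 1 \<partial>M)"
    unfolding mu_rel_def
  proof (intro nn_integral_mono)
    fix x
    have "emeasure (count_space UNIV) (?A `` {x}) \<le> emeasure (count_space UNIV) {rep g x}"
      by (intro emeasure_mono) auto
    then show "emeasure (count_space UNIV) (?A `` {x}) \<le> 1" by simp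
  qed
  then have "mu_rel M ?A < \<infinity>" by (auto simp: emeasure_space_1 intro: le_less_trans)
  then have "?A \<in> carrier FS"
    using graph_sets[OF rep_PG[OF g]] R_sets by (auto simp: FS_carrier)
  then have "represents (graph_class M R g) (\<lambda>x. ?A `` {x})"
    unfolding graph_class_def by (rule represents_C_class)
  then show ?thesis
  proof (rule represents_cong)
    show "AE x in M. ?A `` {x} = {rep g x}"
      using PG_R[OF rep_PG[OF g]] AE_space by eventually_elim auto
  qed
qed

lemma graph_class_carrier: "g \<in> carrier FG \<Longrightarrow> graph_class M R g \<in> carrier CC"
  by (rule representsD[OF represents_graph_class])

lemma avoids_null_graph_class:
  assumes g: "g \<in> carrier FG"
  shows "avoids_null (graph_class M R g)"
  unfolding avoids_null_represents[OF represents_graph_class[OF g]]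
proof
  fix B assume "B \<in> null_sets M"
  then have "AE y in M. y \<notin> B" by (rule AE_not_in)
  then have "AE y in M. rep g y \<notin> B" by (rule AE_PG[OF rep_PG[OF g]])
  then show "AE x in M. {rep g x} \<inter> B = {}" by eventually_elim auto
qed

text \<open>The representative of a product is the composite of the representatives only almost
  everywhere; avoidance makes this identity hold on the sections.\<close>

lemma act_mult:
  assumes "g \<in> carrier FG" "g' \<in> carrier FG" "avoids_null c"
  shows "act (g \<otimes>\<^bsub>FG\<^esub> g') c = act g (act g' c)"
proof (rule represents_unique)
  note r = represents_rep[OF avoids_null_carrier[OF assms(3)]]
  show "represents (act g (act g' c)) (\<lambda>x. rep g ` rep g' ` (rep c `` {x}))"
    by (intro represents_act avoids_null_act assms r)
  show "represents (act (g \<otimes>\<^bsub>FG\<^esub> g') c) (\<lambda>x. rep g ` rep g' ` (rep c `` {x}))"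
  proof (rule represents_cong)
    show "represents (act (g \<otimes>\<^bsub>FG\<^esub> g') c) (\<lambda>x. rep (g \<otimes>\<^bsub>FG\<^esub> g') ` (rep c `` {x}))"
      by (intro represents_act assms r FG.m_closed)
    show "AE x in M. rep (g \<otimes>\<^bsub>FG\<^esub> g') ` (rep c `` {x}) = rep g ` rep g' ` (rep c `` {x})"
      using avoids_null_AE[OF assms(3) r rep_FG_mult[OF assms(1,2)]]
    proof eventually_elim
      case (elim x)
      then show ?case unfolding image_image by (intro image_cong) auto
    qed
  qed
qed

lemma act_one:
  assumes "avoids_null c"
  shows "act \<one>\<^bsub>FG\<^esub> c = c"
proof (rule represents_unique)
  note r = represents_rep[OF avoids_null_carrier[OF assms]]
  show "represents c (\<lambda>x. rep c `` {x})" by (rule r)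
  show "represents (act \<one>\<^bsub>FG\<^esub> c) (\<lambda>x. rep c `` {x})"
  proof (rule represents_cong)
    show "represents (act \<one>\<^bsub>FG\<^esub> c) (\<lambda>x. rep \<one>\<^bsub>FG\<^esub> ` (rep c `` {x}))"
      by (intro represents_act assms r FG.one_closed)
    show "AE x in M. rep \<one>\<^bsub>FG\<^esub> ` (rep c `` {x}) = rep c `` {x}"
      using avoids_null_AE[OF assms r rep_FG_one]
    proof eventually_elim
      case (elim x)
      then have "rep \<one>\<^bsub>FG\<^esub> ` (rep c `` {x}) = id ` (rep c `` {x})" by (intro image_cong) auto
      then show ?case by simp
    qed
  qed
qed

text \<open>Images commute with symmetric differences because the representative of \<open>g\<close>
  is injective on \<open>space M\<close>.\<close>

lemma act_additive:
  assumes g: "g \<in> carrier FG" and "avoids_null c" "avoids_null c'"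
  shows "act g (c \<otimes>\<^bsub>CC\<^esub> c') = act g c \<otimes>\<^bsub>CC\<^esub> act g c'"
proof (rule represents_unique)
  have c: "c \<in> carrier CC" "c' \<in> carrier CC" using assms avoids_null_carrier by blast+
  note r = represents_rep[OF c(1)] represents_rep[OF c(2)]
  show "represents (act g c \<otimes>\<^bsub>CC\<^esub> act g c')
      (\<lambda>x. sym_diff (rep g ` (rep c `` {x})) (rep g ` (rep c' `` {x})))"
    by (intro represents_mult represents_act r assms)
  show "represents (act g (c \<otimes>\<^bsub>CC\<^esub> c'))
      (\<lambda>x. sym_diff (rep g ` (rep c `` {x})) (rep g ` (rep c' `` {x})))"
  proof (rule represents_cong)
    show "represents (act g (c \<otimes>\<^bsub>CC\<^esub> c')) (\<lambda>x. rep g ` sym_diff (rep c `` {x}) (rep c' `` {x}))"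
      by (intro represents_act represents_mult avoids_null_mult r assms)
    have "rep c \<subseteq> R" "rep c' \<subseteq> R" using rep_FS c by (auto simp: FS_carrier)
    then have sub: "rep c `` {x} \<subseteq> space M" "rep c' `` {x} \<subseteq> space M" for x using R_space by blast+
    have "rep g ` sym_diff (rep c `` {x}) (rep c' `` {x}) =
        sym_diff (rep g ` (rep c `` {x})) (rep g ` (rep c' `` {x}))" for x
      by (rule inj_on_image_sym_diff[OF PG_inj[OF rep_PG[OF g]] sub])
    then show "AE x in M. rep g ` sym_diff (rep c `` {x}) (rep c' `` {x}) =
        sym_diff (rep g ` (rep c `` {x})) (rep g ` (rep c' `` {x}))" by simp
  qed
qed

lemma act_zero:
  assumes g: "g \<in> carrier FG"
  shows "act g \<one>\<^bsub>CC\<^esub> = \<one>\<^bsub>CC\<^esub>"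
  using represents_unique[OF represents_act[OF g avoids_null_one represents_one]] represents_one by simp

lemma act_graph_class:
  assumes "g \<in> carrier FG" "g' \<in> carrier FG"
  shows "act g (graph_class M R g') = graph_class M R (g \<otimes>\<^bsub>FG\<^esub> g')"
proof (rule represents_unique)
  show "represents (act g (graph_class M R g')) (\<lambda>x. {rep g (rep g' x)})"
    using represents_act[OF assms(1) avoids_null_graph_class represents_graph_class] assms by simp
  show "represents (graph_class M R (g \<otimes>\<^bsub>FG\<^esub> g')) (\<lambda>x. {rep g (rep g' x)})"
    using represents_cong[OF represents_graph_class[OF FG.m_closed[OF assms]]]
      rep_FG_mult[OF assms] by simp
qed

end

section \<open>Laws of random walks as iterated binds\<close>

lemma left_walk_Suc:
  "left_walk H p (Suc n) = bind_pmf (left_walk H p n) (\<lambda>w. map_pmf (\<lambda>h. h \<otimes>\<^bsub>H\<^esub> w) p)"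
proof -
  have "replicate_pmf (Suc n) p = bind_pmf (replicate_pmf n p) (\<lambda>xs. map_pmf (\<lambda>h. xs @ [h]) p)"
    using replicate_pmf_distrib[of n 1 p]
    by (simp only: replicate_pmf_1 map_pmf_def bind_assoc_pmf bind_return_pmf Suc_eq_plus1)
  then show ?thesis
    by (simp add: left_walk_def map_bind_pmf bind_map_pmf pmf.map_comp o_def del: replicate_pmf.simps)
qed

text \<open>Independent identically distributed increments may be read backwards; this permits
  listing them latest first.\<close>

lemma map_rev_replicate_pmf: "map_pmf rev (replicate_pmf n p) = replicate_pmf n p"
proof (induction n)
  case (Suc n)
  have "map_pmf rev (replicate_pmf (Suc n) p) =
      bind_pmf p (\<lambda>x. bind_pmf (map_pmf rev (replicate_pmf n p)) (\<lambda>xs. return_pmf (xs @ [x])))"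
    by (simp add: map_bind_pmf bind_map_pmf)
  also have "\<dots> = bind_pmf (replicate_pmf n p) (\<lambda>xs. bind_pmf p (\<lambda>x. return_pmf (xs @ [x])))"
    unfolding Suc.IH by (rule bind_commute_pmf)
  also have "\<dots> = replicate_pmf (n + 1) p"
    unfolding replicate_pmf_distrib replicate_pmf_1 bind_map_pmf ..
  finally show ?case by simp
qed simp

lemma convolution_bind:
  "convolution H p q = bind_pmf p (\<lambda>g. bind_pmf q (\<lambda>h. return_pmf (g \<otimes>\<^bsub>H\<^esub> h)))"
  by (simp add: convolution_def pair_pmf_def map_bind_pmf)

lemma (in monoid) set_convolution_power:
  assumes "set_pmf p \<subseteq> carrier G"
  shows "set_pmf (convolution_power G p n) \<subseteq> carrier G"
  by (induction n) (use assms in \<open>auto simp: convolution_bind\<close>)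

text \<open>Convolution powers append factors on the right, the walk on the left. By associativity a
  power can also be peeled on the left (\<open>shift\<close>), and the two recursions agree.\<close>

lemma (in monoid) convolution_power_eq_left_walk:
  assumes p: "set_pmf p \<subseteq> carrier G"
  shows "convolution_power G p n = left_walk G p n"
proof -
  have shift: "convolution_power G p (Suc n) =
      bind_pmf p (\<lambda>h. map_pmf (\<lambda>w. h \<otimes> w) (convolution_power G p n))" for n
  proof (induction n)
    case 0
    have "bind_pmf p (\<lambda>h. return_pmf (\<one> \<otimes> h)) = bind_pmf p (\<lambda>h. return_pmf (h \<otimes> \<one>))"
      using p by (intro bind_pmf_cong refl) (auto dest: subsetD)
    then show ?case by (simp add: convolution_bind bind_return_pmf)
  next
    case (Suc n)
    have "convolution_power G p (Suc (Suc n)) = bind_pmf p (\<lambda>h. bind_pmf (convolution_power G p n)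
        (\<lambda>w. bind_pmf p (\<lambda>k. return_pmf (h \<otimes> w \<otimes> k))))"
      by (subst convolution_power.simps, subst Suc.IH)
        (simp add: convolution_bind bind_map_pmf bind_assoc_pmf)
    also have "\<dots> = bind_pmf p (\<lambda>h. bind_pmf (convolution_power G p n)
        (\<lambda>w. bind_pmf p (\<lambda>k. return_pmf (h \<otimes> (w \<otimes> k)))))"
    proof (intro bind_pmf_cong refl)
      fix h w k assume "h \<in> set_pmf p" "w \<in> set_pmf (convolution_power G p n)" "k \<in> set_pmf p"
      then have "h \<in> carrier G" "w \<in> carrier G" "k \<in> carrier G"
        using p set_convolution_power[OF p] by (auto dest: subsetD)
      then show "return_pmf (h \<otimes> w \<otimes> k) = return_pmf (h \<otimes> (w \<otimes> k))" by (simp add: m_assoc)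
    qed
    also have "\<dots> = bind_pmf p (\<lambda>h. map_pmf (\<lambda>w. h \<otimes> w) (convolution_power G p (Suc n)))"
      by (simp add: convolution_bind map_bind_pmf)
    finally show ?case .
  qed
  show ?thesis
  proof (induction n)
    case 0
    then show ?case by (simp add: left_walk_def)
  next
    case (Suc n)
    have "convolution_power G p (Suc n) =
        bind_pmf p (\<lambda>h. bind_pmf (left_walk G p n) (\<lambda>w. return_pmf (h \<otimes> w)))"
      unfolding shift Suc.IH by (simp add: map_pmf_def)
    then show ?case by (simp add: left_walk_Suc map_pmf_def bind_commute_pmf[of p])
  qed
qed

section \<open>The semidirect product over a subgroup of the full group\<close>

locale borel_relation_subgroup = borel_relation +
  fixes G :: "('a \<Rightarrow> 'a) set set"
  assumes G: "subgroup G FG"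
begin

abbreviation "CG \<equiv> CG_group M R G"
abbreviation "CR \<equiv> CR_group M R"
abbreviation "CS \<equiv> C_subgroup M R G"

lemma G_FG: "g \<in> G \<Longrightarrow> g \<in> carrier FG"
  using subgroup.mem_carrier[OF G] .

lemma CR_simps:
  "carrier CR = carrier CC \<times> carrier FG" "\<one>\<^bsub>CR\<^esub> = (\<one>\<^bsub>CC\<^esub>, \<one>\<^bsub>FG\<^esub>)"
  "(c, g) \<otimes>\<^bsub>CR\<^esub> (c', g') = (c \<otimes>\<^bsub>CC\<^esub> act g c', g \<otimes>\<^bsub>FG\<^esub> g')"
  by (simp_all add: CR_group_def semidirect_product_def)

lemma CG_simps:
  "carrier CG = CS \<times> G" "\<one>\<^bsub>CG\<^esub> = \<one>\<^bsub>CR\<^esub>" "x \<otimes>\<^bsub>CG\<^esub> y = x \<otimes>\<^bsub>CR\<^esub> y"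
  by (simp_all add: CG_group_def)

lemma CS_subgroup: "subgroup CS CC"
  unfolding C_subgroup_def using graph_class_carrier G_FG by (intro CC.generate_is_subgroup) auto

lemma CS_CC: "c \<in> CS \<Longrightarrow> c \<in> carrier CC"
  using subgroup.mem_carrier[OF CS_subgroup] .

lemma CS_graph_class: "g \<in> G \<Longrightarrow> graph_class M R g \<in> CS"
  unfolding C_subgroup_def by (intro generate.incl) auto

text \<open>The inverse clause of \<open>generate\<close> disappears, since every element of
  \<open>CC\<close> is its own inverse.\<close>

lemma CS_induct [consumes 1, case_names one graph mult]:
  assumes "c \<in> CS" "Q \<one>\<^bsub>CC\<^esub>" "\<And>g. g \<in> G \<Longrightarrow> Q (graph_class M R g)"
    "\<And>c c'. c \<in> CS \<Longrightarrow> c' \<in> CS \<Longrightarrow> Q c \<Longrightarrow> Q c' \<Longrightarrow> Q (c \<otimes>\<^bsub>CC\<^esub> c')"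
  shows "Q c"
  using assms(1) unfolding C_subgroup_def
proof (induction rule: generate.induct)
  case (inv h)
  then obtain g where g: "g \<in> G" "h = graph_class M R g" by auto
  then have "inv\<^bsub>CC\<^esub> h = h" using CC_inv graph_class_carrier G_FG by simp
  then show ?case using assms(3) g by simp
qed (use assms(2-4) in \<open>auto simp: C_subgroup_def\<close>)

lemma CS_avoids_null: "c \<in> CS \<Longrightarrow> avoids_null c"
  by (induction rule: CS_induct)
    (auto intro: avoids_null_one avoids_null_graph_class avoids_null_mult G_FG)

lemma act_CS:
  assumes "g \<in> G" "c \<in> CS"
  shows "act g c \<in> CS"
  using assms(2)
proof (induction rule: CS_induct)
  case one
  then show ?case using act_zero[OF G_FG[OF assms(1)]] subgroup.one_closed[OF CS_subgroup] by simp
next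
  case (graph g')
  then show ?case
    using act_graph_class[OF G_FG[OF assms(1)] G_FG[OF graph]] CS_graph_class
      subgroup.m_closed[OF G assms(1) graph] by simp
next
  case (mult c c')
  then show ?case
    using act_additive[OF G_FG[OF assms(1)] CS_avoids_null CS_avoids_null]
      subgroup.m_closed[OF CS_subgroup] by simp
qed

text \<open>The usual inverse in a semidirect product, without the inversion of \<open>c\<close>,
  because \<open>c\<close> has order at most two.\<close>

lemma CG_inverse:
  assumes "c \<in> CS" "g \<in> G"
  shows "(act (inv\<^bsub>FG\<^esub> g) c, inv\<^bsub>FG\<^esub> g) \<otimes>\<^bsub>CG\<^esub> (c, g) = \<one>\<^bsub>CG\<^esub>"
    and "(c, g) \<otimes>\<^bsub>CG\<^esub> (act (inv\<^bsub>FG\<^esub> g) c, inv\<^bsub>FG\<^esub> g) = \<one>\<^bsub>CG\<^esub>"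
proof -
  note g = G_FG[OF assms(2)]
  have "act g (act (inv\<^bsub>FG\<^esub> g) c) = c"
    using act_mult[of g "inv\<^bsub>FG\<^esub> g" c] act_one[of c] CS_avoids_null[OF assms(1)] g by simp
  then show "(c, g) \<otimes>\<^bsub>CG\<^esub> (act (inv\<^bsub>FG\<^esub> g) c, inv\<^bsub>FG\<^esub> g) = \<one>\<^bsub>CG\<^esub>"
    using CS_CC[OF assms(1)] g by (simp add: CG_simps CR_simps CC_square)
  show "(act (inv\<^bsub>FG\<^esub> g) c, inv\<^bsub>FG\<^esub> g) \<otimes>\<^bsub>CG\<^esub> (c, g) = \<one>\<^bsub>CG\<^esub>"
    using CS_CC[OF assms(1)] g by (simp add: CG_simps CR_simps CC_square act_carrier)
qed

lemma CG_group: "group CG"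
proof (rule groupI)
  show "\<one>\<^bsub>CG\<^esub> \<in> carrier CG"
    using subgroup.one_closed[OF CS_subgroup] subgroup.one_closed[OF G]
    by (simp add: CG_simps CR_simps)
next
  fix x y assume "x \<in> carrier CG" "y \<in> carrier CG"
  then obtain c g c' g' where x: "x = (c, g)" "c \<in> CS" "g \<in> G" and y: "y = (c', g')" "c' \<in> CS" "g' \<in> G"
    by (auto simp: CG_simps)
  then show "x \<otimes>\<^bsub>CG\<^esub> y \<in> carrier CG"
    using subgroup.m_closed[OF CS_subgroup] subgroup.m_closed[OF G] act_CS
    by (simp add: CG_simps CR_simps)
  fix z assume "z \<in> carrier CG"
  then obtain c'' g'' where z: "z = (c'', g'')" "c'' \<in> CS" "g'' \<in> G" by (auto simp: CG_simps)
  show "x \<otimes>\<^bsub>CG\<^esub> y \<otimes>\<^bsub>CG\<^esub> z = x \<otimes>\<^bsub>CG\<^esub> (y \<otimes>\<^bsub>CG\<^esub> z)"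
    using x y z act_CS[of g' c''] act_CS[of g c'] act_CS[of g "act g' c''"]
    by (simp add: CG_simps CR_simps act_additive act_mult CS_avoids_null G_FG CS_CC CC.m_assoc FG.m_assoc)
next
  fix x assume "x \<in> carrier CG"
  then obtain c g where x: "x = (c, g)" "c \<in> CS" "g \<in> G" by (auto simp: CG_simps)
  then show "\<one>\<^bsub>CG\<^esub> \<otimes>\<^bsub>CG\<^esub> x = x"
    by (simp add: CG_simps CR_simps act_one CS_avoids_null CS_CC G_FG)
  show "\<exists>y\<in>carrier CG. y \<otimes>\<^bsub>CG\<^esub> x = \<one>\<^bsub>CG\<^esub>"
  proof
    show "(act (inv\<^bsub>FG\<^esub> g) c, inv\<^bsub>FG\<^esub> g) \<otimes>\<^bsub>CG\<^esub> x = \<one>\<^bsub>CG\<^esub>" using CG_inverse x by simp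
    show "(act (inv\<^bsub>FG\<^esub> g) c, inv\<^bsub>FG\<^esub> g) \<in> carrier CG"
      using x act_CS subgroup.m_inv_closed[OF G] by (simp add: CG_simps)
  qed
qed

sublocale CG: group CG by (rule CG_group)

lemma CG_inv: "c \<in> CS \<Longrightarrow> g \<in> G \<Longrightarrow> inv\<^bsub>CG\<^esub> (c, g) = (act (inv\<^bsub>FG\<^esub> g) c, inv\<^bsub>FG\<^esub> g)"
  using CG_inverse act_CS subgroup.m_inv_closed[OF G] by (intro CG.inv_equality) (auto simp: CG_simps)

lemma CG_carrier_CR: "x \<in> carrier CG \<Longrightarrow> x \<in> carrier CR"
  by (auto simp: CG_simps CR_simps CS_CC G_FG)

text \<open>Associativity in the whole semidirect product is not available, but
  \<open>(c', g') (c, g) = \<one>\<close> already determines \<open>c' = g' c\<close>.\<close>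

lemma CR_inv_eq_CG_inv:
  assumes "x \<in> carrier CG"
  shows "inv\<^bsub>CR\<^esub> x = inv\<^bsub>CG\<^esub> x"
proof -
  obtain c g where x: "x = (c, g)" "c \<in> CS" "g \<in> G" using assms by (auto simp: CG_simps)
  show ?thesis
    unfolding m_inv_def[of CR]
  proof (rule the_equality)
    show "inv\<^bsub>CG\<^esub> x \<in> carrier CR \<and> x \<otimes>\<^bsub>CR\<^esub> inv\<^bsub>CG\<^esub> x = \<one>\<^bsub>CR\<^esub> \<and> inv\<^bsub>CG\<^esub> x \<otimes>\<^bsub>CR\<^esub> x = \<one>\<^bsub>CR\<^esub>"
      using CG.r_inv[OF assms] CG.l_inv[OF assms] CG_carrier_CR[OF CG.inv_closed[OF assms]]
      by (simp add: CG_simps)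
  next
    fix y assume y: "y \<in> carrier CR \<and> x \<otimes>\<^bsub>CR\<^esub> y = \<one>\<^bsub>CR\<^esub> \<and> y \<otimes>\<^bsub>CR\<^esub> x = \<one>\<^bsub>CR\<^esub>"
    obtain c' g' where y_eq: "y = (c', g')" by force
    have c': "c' \<in> carrier CC" "g' \<in> carrier FG" using y by (auto simp: y_eq CR_simps)
    have eq: "g' \<otimes>\<^bsub>FG\<^esub> g = \<one>\<^bsub>FG\<^esub>" "c' \<otimes>\<^bsub>CC\<^esub> act g' c = \<one>\<^bsub>CC\<^esub>"
      using y by (auto simp: y_eq x CR_simps)
    have g': "g' = inv\<^bsub>FG\<^esub> g" using FG.inv_equality[OF eq(1)] c' G_FG[OF x(3)] by simp
    have a: "act g' c \<in> carrier CC" using act_carrier[OF c'(2) CS_CC[OF x(2)]] .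
    have "inv\<^bsub>CC\<^esub> (act g' c) = c'" using CC.inv_equality[OF eq(2) a c'(1)] .
    then have "c' = act g' c" using CC_inv[OF a] by simp
    then show "y = inv\<^bsub>CG\<^esub> x" by (simp add: y_eq x CG_inv g')
  qed
qed

definition lamp :: "bool \<Rightarrow> 'a CR" where
  "lamp b = (if b then graph_class M R \<one>\<^bsub>FG\<^esub> else \<one>\<^bsub>CC\<^esub>, \<one>\<^bsub>FG\<^esub>)"

definition move :: "('a \<Rightarrow> 'a) set \<Rightarrow> 'a CR" where
  "move g = (\<one>\<^bsub>CC\<^esub>, g)"

lemma lamp_carrier [simp]: "lamp b \<in> carrier CG"
  using subgroup.one_closed[OF CS_subgroup] subgroup.one_closed[OF G] CS_graph_class
  by (simp add: lamp_def CG_simps)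

lemma move_carrier [simp]: "g \<in> G \<Longrightarrow> move g \<in> carrier CG"
  using subgroup.one_closed[OF CS_subgroup] by (simp add: move_def CG_simps)

lemma represents_lamp: "represents (fst (lamp b)) (\<lambda>x. if b then {x} else {})"
proof -
  have "represents (graph_class M R \<one>\<^bsub>FG\<^esub>) (\<lambda>x. {x})"
    by (rule represents_cong[OF represents_graph_class]) (use rep_FG_one in auto)
  then show ?thesis using represents_one by (simp add: lamp_def)
qed

lemma lamp_mult: "lamp b \<otimes>\<^bsub>CG\<^esub> lamp b' = lamp (b \<noteq> b')"
proof -
  have "graph_class M R \<one>\<^bsub>FG\<^esub> \<in> CS" using CS_graph_class subgroup.one_closed[OF G] by simp
  then show ?thesis
    by (auto simp: lamp_def CG_simps CR_simps act_one act_zero avoids_null_one CS_avoids_null CS_CC CC_square)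
qed

lemma lamp_inv: "inv\<^bsub>CG\<^esub> (lamp b) = lamp b"
proof (rule CG.inv_equality)
  show "lamp b \<otimes>\<^bsub>CG\<^esub> lamp b = \<one>\<^bsub>CG\<^esub>" unfolding lamp_mult by (simp add: lamp_def CG_simps CR_simps)
qed auto

lemma move_inv: "g \<in> G \<Longrightarrow> inv\<^bsub>CG\<^esub> (move g) = move (inv\<^bsub>FG\<^esub> g)"
  using subgroup.one_closed[OF CS_subgroup] subgroup.m_inv_closed[OF G]
  by (simp add: move_def CG_inv act_zero G_FG)

definition increment :: "bool \<Rightarrow> ('a \<Rightarrow> 'a) set \<Rightarrow> bool \<Rightarrow> 'a CR" where
  "increment b g b' = lamp b \<otimes>\<^bsub>CG\<^esub> move g \<otimes>\<^bsub>CG\<^esub> lamp b'"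

lemma increment_carrier: "g \<in> G \<Longrightarrow> increment b g b' \<in> carrier CG"
  by (simp add: increment_def)

lemma increment_inv: "g \<in> G \<Longrightarrow> inv\<^bsub>CG\<^esub> (increment b g b') = increment b' (inv\<^bsub>FG\<^esub> g) b"
  using subgroup.m_inv_closed[OF G]
  by (simp add: increment_def CG.inv_mult_group lamp_inv move_inv CG.m_assoc)

text \<open>Normal form of the position: lamps and moves alternate, beginning and ending with a
  lamp. Increments stand latest first, and \<open>bs\<close> is meant to have one entry more than
  the list of increments.\<close>

fun walk_position :: "('a \<Rightarrow> 'a) set list \<Rightarrow> bool list \<Rightarrow> 'a CR" where
  "walk_position [] bs = lamp (hd bs)"
| "walk_position (h # rs) bs = lamp (hd bs) \<otimes>\<^bsub>CG\<^esub> (move h \<otimes>\<^bsub>CG\<^esub> walk_position rs (tl bs))"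

lemma walk_position_carrier: "set rs \<subseteq> G \<Longrightarrow> walk_position rs bs \<in> carrier CG"
  by (induction rs arbitrary: bs) auto

lemma lamp_walk_position:
  assumes "set rs \<subseteq> G"
  shows "lamp b \<otimes>\<^bsub>CG\<^esub> walk_position rs (t # bs) = walk_position rs ((b \<noteq> t) # bs)"
proof (cases rs)
  case (Cons h rs')
  then have "move h \<otimes>\<^bsub>CG\<^esub> walk_position rs' bs \<in> carrier CG"
    using assms walk_position_carrier by simp
  then show ?thesis using Cons by (simp add: CG.m_assoc[symmetric] lamp_mult)
qed (simp add: lamp_mult)

text \<open>A step prepends \<open>g\<close> and the coin \<open>b\<close>; the right coin
  \<open>b'\<close> is absorbed by the old top lamp, since lamps multiply by xor.\<close>

lemma increment_walk_position:
  assumes "g \<in> G" "set rs \<subseteq> G"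
  shows "increment b g b' \<otimes>\<^bsub>CG\<^esub> walk_position rs (t # bs) = walk_position (g # rs) (b # (b' \<noteq> t) # bs)"
  using assms walk_position_carrier[of rs]
  by (simp add: increment_def CG.m_assoc lamp_walk_position)

end

subsection \<open>The law of the switch-walk-switch random walk\<close>

abbreviation coin :: "bool pmf" where
  "coin \<equiv> bernoulli_pmf (1/2)"

lemma coin_eq_pmf_of_set: "coin = pmf_of_set UNIV"
  by (rule pmf_eqI) (simp add: pmf_bernoulli_half UNIV_bool)

lemma map_coin_xor: "map_pmf (\<lambda>t. b \<noteq> t) coin = coin"
proof -
  have "map_pmf (\<lambda>t. b \<noteq> t) (pmf_of_set UNIV) = pmf_of_set UNIV"
    by (rule map_pmf_of_set_bij_betw) (auto intro!: bij_betwI[of _ _ _ "\<lambda>t. b \<noteq> t"])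
  then show ?thesis by (simp add: coin_eq_pmf_of_set)
qed

fun orbit_points :: "('a \<Rightarrow> 'a) set list \<Rightarrow> 'a \<Rightarrow> 'a set" where
  "orbit_points [] x = {x}"
| "orbit_points (h # rs) x = insert x (rep h ` orbit_points rs x)"

text \<open>The section over \<open>x\<close> of the lamp configuration, computed at every point
  from the chosen representatives. Lamps put at the same orbit point cancel modulo 2.\<close>

fun lit_points :: "('a \<Rightarrow> 'a) set list \<Rightarrow> bool list \<Rightarrow> 'a \<Rightarrow> 'a set" where
  "lit_points [] bs x = (if hd bs then {x} else {})"
| "lit_points (h # rs) bs x =
     sym_diff (if hd bs then {x} else {}) (rep h ` lit_points rs (tl bs) x)"

lemma finite_orbit_points [simp]: "finite (orbit_points rs x)"
  by (induction rs) auto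

lemma lit_points_subset: "lit_points rs bs x \<subseteq> orbit_points rs x"
  by (induction rs arbitrary: bs) (auto split: if_splits)

text \<open>The last increment acts on all points except the one with
  \<open>k = Suc (length hs)\<close>, where nothing is applied and \<open>x\<close> itself
  remains.\<close>

lemma inverted_orbit_eq: "inverted_orbit hs x = orbit_points (rev hs) x"
proof (induction hs rule: rev_induct)
  case (snoc h hs)
  have "inverted_orbit (hs @ [h]) x =
      (\<lambda>k. fold rep (drop k (hs @ [h])) x) ` {..Suc (length hs)}"
    by (auto simp: inverted_orbit_def)
  also have "{..Suc (length hs)} = insert (Suc (length hs)) {..length hs}" by auto
  also have "(\<lambda>k. fold rep (drop k (hs @ [h])) x) ` insert (Suc (length hs)) {..length hs} =
      insert x ((\<lambda>k. rep h (fold rep (drop k hs) x)) ` {..length hs})"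
    by auto
  also have "(\<lambda>k. rep h (fold rep (drop k hs) x)) ` {..length hs} = rep h ` inverted_orbit hs x"
    by (auto simp: inverted_orbit_def)
  finally show ?case by (simp add: snoc)
qed (simp add: inverted_orbit_def)

lemma random_inverted_orbit_eq:
  "random_inverted_orbit \<nu> n x = map_pmf (\<lambda>rs. orbit_points rs x) (replicate_pmf n \<nu>)"
proof -
  have "random_inverted_orbit \<nu> n x =
      map_pmf (\<lambda>rs. orbit_points rs x) (map_pmf rev (replicate_pmf n \<nu>))"
    by (simp add: random_inverted_orbit_def inverted_orbit_eq pmf.map_comp o_def)
  then show ?thesis by (simp only: map_rev_replicate_pmf)
qed

section \<open>Uniformly distributed random subsets\<close>

lemma pair_pmf_of_set_Times:
  assumes "finite A" "A \<noteq> {}" "finite B" "B \<noteq> {}"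
  shows "pair_pmf (pmf_of_set A) (pmf_of_set B) = pmf_of_set (A \<times> B)"
proof (rule pmf_eqI)
  fix p :: "'a \<times> 'b"
  obtain a b where p: "p = (a, b)" by force
  show "pmf (pair_pmf (pmf_of_set A) (pmf_of_set B)) p = pmf (pmf_of_set (A \<times> B)) p"
    using assms unfolding p by (simp add: pmf_pair card_cartesian_product indicator_def)
qed

text \<open>If \<open>x \<in> S\<close>, toggling is a bijection of \<open>Pow S\<close> for each
  value of the coin. Otherwise the coin decides membership of the new point, and pairs of a coin
  value and a subset of \<open>S\<close> correspond to subsets of \<open>insert x S\<close>.\<close>

lemma uniform_subset_toggle:
  assumes S: "finite S"
  shows "bind_pmf coin (\<lambda>b. map_pmf (\<lambda>V. sym_diff (if b then {x} else {}) V) (pmf_of_set (Pow S))) =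
    pmf_of_set (Pow (insert x S))"
proof (cases "x \<in> S")
  case True
  have "map_pmf (\<lambda>V. sym_diff (if b then {x} else {}) V) (pmf_of_set (Pow S)) = pmf_of_set (Pow S)" for b
    using S True by (intro map_pmf_of_set_bij_betw
      bij_betwI[of _ _ _ "\<lambda>V. sym_diff (if b then {x} else {}) V"]) auto
  then show ?thesis using True by (simp add: insert_absorb)
next
  case False
  have "bind_pmf coin (\<lambda>b. map_pmf (\<lambda>V. sym_diff (if b then {x} else {}) V) (pmf_of_set (Pow S))) =
      map_pmf (\<lambda>(b, V). sym_diff (if b then {x} else {}) V) (pair_pmf coin (pmf_of_set (Pow S)))"
    by (simp add: pair_pmf_def map_bind_pmf map_pmf_def bind_assoc_pmf bind_return_pmf)
  also have "pair_pmf coin (pmf_of_set (Pow S)) = pmf_of_set (UNIV \<times> Pow S)"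
    using S unfolding coin_eq_pmf_of_set by (intro pair_pmf_of_set_Times) auto
  also have "map_pmf (\<lambda>(b, V). sym_diff (if b then {x} else {}) V) \<dots> = pmf_of_set (Pow (insert x S))"
  proof (intro map_pmf_of_set_bij_betw)
    show "bij_betw (\<lambda>(b, V). sym_diff (if b then {x} else {}) V) (UNIV \<times> Pow S) (Pow (insert x S))"
      using False by (intro bij_betwI[of _ _ _ "\<lambda>V. (x \<in> V, V - {x})"]) (auto split: if_splits)
  qed (use S in auto)
  finally show ?thesis .
qed

lemma uniform_subset_image:
  assumes "inj_on f S" "finite S"
  shows "map_pmf ((`) f) (pmf_of_set (Pow S)) = pmf_of_set (Pow (f ` S))"
  using assms by (intro map_pmf_of_set_bij_betw bij_betw_Pow) (auto simp: bij_betw_def)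

context borel_relation
begin

lemma orbit_points_space:
  "set rs \<subseteq> carrier FG \<Longrightarrow> x \<in> space M \<Longrightarrow> orbit_points rs x \<subseteq> space M"
  by (induction rs) (auto intro: PG_space[OF rep_PG])

text \<open>Uniformity survives a step of the walk: the injective map \<open>rep h\<close>
  transports a uniform subset to a uniform subset of the image, and the new coin toggles
  \<open>x\<close>, whether or not \<open>x\<close> was already in the orbit.\<close>

lemma lit_points_uniform:
  assumes "set rs \<subseteq> carrier FG" "x \<in> space M"
  shows "map_pmf (\<lambda>bs. lit_points rs bs x) (replicate_pmf (Suc (length rs)) coin) =
    pmf_of_set (Pow (orbit_points rs x))"
  using assms(1)
proof (induction rs)
  case Nil
  have "map_pmf (\<lambda>bs. lit_points [] bs x) (replicate_pmf (Suc 0) coin) =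
      bind_pmf coin (\<lambda>b. map_pmf (\<lambda>V. sym_diff (if b then {x} else {}) V) (pmf_of_set (Pow {})))"
    by (simp add: pmf_of_set_singleton map_bind_pmf bind_return_pmf)
  also have "\<dots> = pmf_of_set (Pow {x})" by (rule uniform_subset_toggle) simp
  finally show ?case by simp
next
  case (Cons h rs)
  have h: "inj_on (rep h) (orbit_points rs x)"
    using Cons.prems inj_on_subset[OF PG_inj[OF rep_PG] orbit_points_space] assms(2) by simp
  have "map_pmf (\<lambda>bs. lit_points (h # rs) bs x) (replicate_pmf (Suc (length (h # rs))) coin) =
      bind_pmf coin (\<lambda>b. map_pmf (\<lambda>V. sym_diff (if b then {x} else {}) V)
        (map_pmf ((`) (rep h)) (map_pmf (\<lambda>bs. lit_points rs bs x) (replicate_pmf (Suc (length rs)) coin))))"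
    unfolding length_Cons replicate_pmf.simps(2)[of "Suc (length rs)"]
    by (simp add: map_bind_pmf pmf.map_comp o_def map_pmf_def bind_assoc_pmf bind_return_pmf
        del: replicate_pmf.simps)
  also have "\<dots> = pmf_of_set (Pow (insert x (rep h ` orbit_points rs x)))"
    using Cons h by (simp add: uniform_subset_image uniform_subset_toggle del: replicate_pmf.simps)
  finally show ?case by simp
qed

end

context borel_relation_subgroup
begin

lemma switch_eq: "switch M R = map_pmf lamp coin"
  unfolding switch_def lamp_def[abs_def] ..

lemma switch_walk_switch_eq:
  "switch_walk_switch M R \<nu> =
     bind_pmf coin (\<lambda>b. bind_pmf \<nu> (\<lambda>g. bind_pmf coin (\<lambda>b'. return_pmf (increment b g b'))))"
  by (simp add: switch_walk_switch_def switch_eq convolution_bind bind_map_pmf bind_assoc_pmf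
      bind_return_pmf increment_def CG_simps move_def)

lemma switch_walk_switch_carrier:
  assumes "set_pmf \<nu> \<subseteq> G"
  shows "set_pmf (switch_walk_switch M R \<nu>) \<subseteq> carrier CG"
  using assms increment_carrier by (auto simp: switch_walk_switch_eq)

text \<open>Inversion exchanges the two outer coins and inverts the middle increment; the coins are
  independent with equal law, and \<open>\<nu>\<close> is symmetric.\<close>

lemma switch_walk_switch_symmetric:
  assumes "set_pmf \<nu> \<subseteq> G" "map_pmf (\<lambda>g. inv\<^bsub>FG\<^esub> g) \<nu> = \<nu>"
  shows "map_pmf (\<lambda>x. inv\<^bsub>CG\<^esub> x) (switch_walk_switch M R \<nu>) = switch_walk_switch M R \<nu>"
proof -
  have "map_pmf (\<lambda>x. inv\<^bsub>CG\<^esub> x) (switch_walk_switch M R \<nu>) =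
      bind_pmf coin (\<lambda>b. bind_pmf \<nu> (\<lambda>g. bind_pmf coin (\<lambda>b'. return_pmf (increment b' (inv\<^bsub>FG\<^esub> g) b))))"
    unfolding switch_walk_switch_eq map_bind_pmf map_return_pmf
    using assms(1) by (intro bind_pmf_cong refl) (auto simp: increment_inv)
  also have "\<dots> = bind_pmf coin (\<lambda>b. bind_pmf (map_pmf (\<lambda>g. inv\<^bsub>FG\<^esub> g) \<nu>)
      (\<lambda>g. bind_pmf coin (\<lambda>b'. return_pmf (increment b' g b))))"
    by (simp add: bind_map_pmf)
  also have "\<dots> = bind_pmf \<nu> (\<lambda>g. bind_pmf coin (\<lambda>b. bind_pmf coin (\<lambda>b'. return_pmf (increment b' g b))))"
    unfolding assms(2) by (rule bind_commute_pmf)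
  also have "\<dots> = bind_pmf \<nu> (\<lambda>g. bind_pmf coin (\<lambda>b'. bind_pmf coin (\<lambda>b. return_pmf (increment b' g b))))"
    by (subst bind_commute_pmf) simp
  also have "\<dots> = switch_walk_switch M R \<nu>"
    unfolding switch_walk_switch_eq by (rule bind_commute_pmf)
  finally show ?thesis .
qed

text \<open>Apart from the merging of two coins, the proof only reorders independent choices. It
  starts at one step: after none the position is the identity, whereas the formula would already
  throw a coin.\<close>

lemma left_walk_switch_walk_switch:
  assumes \<nu>: "set_pmf \<nu> \<subseteq> G"
  shows "left_walk CG (switch_walk_switch M R \<nu>) (Suc n) =
    bind_pmf (replicate_pmf (Suc n) \<nu>)
      (\<lambda>rs. map_pmf (walk_position rs) (replicate_pmf (Suc (Suc n)) coin))"
proof (induction n)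
  case 0
  \<comment> \<open>The identity is read as a single unlit lamp, so that the first increment merges
    with it like all later ones.\<close>
  have one: "\<one>\<^bsub>CG\<^esub> = walk_position [] [False]"
    by (simp add: lamp_def CG_simps CR_simps)
  have "left_walk CG (switch_walk_switch M R \<nu>) (Suc 0) =
      map_pmf (\<lambda>h. h \<otimes>\<^bsub>CG\<^esub> \<one>\<^bsub>CG\<^esub>) (switch_walk_switch M R \<nu>)"
    unfolding left_walk_Suc by (simp add: left_walk_def bind_return_pmf)
  also have "\<dots> = bind_pmf coin (\<lambda>b. bind_pmf \<nu> (\<lambda>g. bind_pmf coin
      (\<lambda>b'. return_pmf (walk_position [g] [b, b']))))"
    unfolding switch_walk_switch_eq map_bind_pmf map_return_pmf one
    using \<nu> by (intro bind_pmf_cong refl) (auto simp: increment_walk_position simp del: walk_position.simps)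
  also have "\<dots> = bind_pmf \<nu> (\<lambda>g. bind_pmf coin (\<lambda>b. bind_pmf coin
      (\<lambda>b'. return_pmf (walk_position [g] [b, b']))))"
    by (rule bind_commute_pmf)
  finally show ?case
    by (simp add: map_bind_pmf bind_assoc_pmf bind_return_pmf del: walk_position.simps)
next
  case (Suc n)
  let ?q = "replicate_pmf (Suc n) coin" and ?r = "replicate_pmf (Suc n) \<nu>"
  let ?F = "\<lambda>g rs b t bs. return_pmf (walk_position (g # rs) (b # t # bs))"
  \<comment> \<open>The law of the new position once the merged coin equals
    \<open>t\<close>.\<close>
  define K where "K rs t = bind_pmf ?q (\<lambda>bs. bind_pmf coin (\<lambda>b. bind_pmf \<nu> (\<lambda>g. ?F g rs b t bs)))"
    for rs t
  have rs: "set rs \<subseteq> G" if "rs \<in> set_pmf ?r" for rs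
    using that \<nu> by (auto simp: set_replicate_pmf simp del: replicate_pmf.simps)
  have "left_walk CG (switch_walk_switch M R \<nu>) (Suc (Suc n)) =
      bind_pmf ?r (\<lambda>rs. bind_pmf coin (\<lambda>t. bind_pmf ?q (\<lambda>bs. bind_pmf coin (\<lambda>b. bind_pmf \<nu>
        (\<lambda>g. bind_pmf coin (\<lambda>b'. return_pmf (increment b g b' \<otimes>\<^bsub>CG\<^esub> walk_position rs (t # bs))))))))"
    unfolding left_walk_Suc[of _ _ "Suc n"] Suc.IH
    unfolding switch_walk_switch_eq replicate_pmf.simps(2)[of "Suc n" coin]
    by (simp add: map_bind_pmf bind_map_pmf bind_assoc_pmf bind_return_pmf
        del: replicate_pmf.simps walk_position.simps)
  also have "\<dots> = bind_pmf ?r (\<lambda>rs. bind_pmf coin (\<lambda>t. bind_pmf ?q (\<lambda>bs. bind_pmf coin (\<lambda>b. bind_pmf \<nu>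
        (\<lambda>g. bind_pmf coin (\<lambda>b'. ?F g rs b (b' \<noteq> t) bs))))))"
    by (intro bind_pmf_cong refl arg_cong[where f = return_pmf] increment_walk_position subsetD[OF \<nu>] rs)
  also have "\<dots> = bind_pmf ?r (\<lambda>rs. bind_pmf coin (\<lambda>t. bind_pmf coin (\<lambda>b'. K rs (b' \<noteq> t))))"
  proof (rule bind_pmf_cong[OF refl], rule bind_pmf_cong[OF refl])
    fix rs t
    have "bind_pmf ?q (\<lambda>bs. bind_pmf coin (\<lambda>b. bind_pmf \<nu> (\<lambda>g. bind_pmf coin (\<lambda>b'. ?F g rs b (b' \<noteq> t) bs)))) =
        bind_pmf ?q (\<lambda>bs. bind_pmf coin (\<lambda>b. bind_pmf coin (\<lambda>b'. bind_pmf \<nu> (\<lambda>g. ?F g rs b (b' \<noteq> t) bs))))"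
      by (intro bind_pmf_cong refl bind_commute_pmf)
    also have "\<dots> =
        bind_pmf ?q (\<lambda>bs. bind_pmf coin (\<lambda>b'. bind_pmf coin (\<lambda>b. bind_pmf \<nu> (\<lambda>g. ?F g rs b (b' \<noteq> t) bs))))"
      by (intro bind_pmf_cong refl bind_commute_pmf)
    also have "\<dots> = bind_pmf coin (\<lambda>b'. K rs (b' \<noteq> t))"
      unfolding K_def by (rule bind_commute_pmf)
    finally show "bind_pmf ?q (\<lambda>bs. bind_pmf coin (\<lambda>b. bind_pmf \<nu>
        (\<lambda>g. bind_pmf coin (\<lambda>b'. ?F g rs b (b' \<noteq> t) bs)))) = bind_pmf coin (\<lambda>b'. K rs (b' \<noteq> t))" .
  qed
  also have "\<dots> = bind_pmf ?r (\<lambda>rs. bind_pmf coin (K rs))"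
  proof (rule bind_pmf_cong[OF refl])
    fix rs
    \<comment> \<open>For fixed \<open>b'\<close> the merged bit is again fair, so averaging over
      \<open>b'\<close> has no further effect.\<close>
    have "bind_pmf coin (\<lambda>t. bind_pmf coin (\<lambda>b'. K rs (b' \<noteq> t))) =
        bind_pmf coin (\<lambda>b'. bind_pmf (map_pmf (\<lambda>t. b' \<noteq> t) coin) (K rs))"
      unfolding bind_map_pmf by (rule bind_commute_pmf)
    then show "bind_pmf coin (\<lambda>t. bind_pmf coin (\<lambda>b'. K rs (b' \<noteq> t))) = bind_pmf coin (K rs)"
      by (simp only: map_coin_xor bind_pmf_const)
  qed
  also have "\<dots> = bind_pmf ?r (\<lambda>rs. bind_pmf \<nu> (\<lambda>g. bind_pmf coin (\<lambda>b. bind_pmf coin (\<lambda>t. bind_pmf ?q (\<lambda>bs. ?F g rs b t bs)))))"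
  proof (rule bind_pmf_cong[OF refl])
    fix rs
    have "bind_pmf coin (K rs) =
        bind_pmf coin (\<lambda>t. bind_pmf ?q (\<lambda>bs. bind_pmf \<nu> (\<lambda>g. bind_pmf coin (\<lambda>b. ?F g rs b t bs))))"
      unfolding K_def by (intro bind_pmf_cong refl bind_commute_pmf)
    also have "\<dots> = bind_pmf coin (\<lambda>t. bind_pmf \<nu> (\<lambda>g. bind_pmf ?q (\<lambda>bs. bind_pmf coin (\<lambda>b. ?F g rs b t bs))))"
      by (intro bind_pmf_cong refl bind_commute_pmf)
    also have "\<dots> = bind_pmf coin (\<lambda>t. bind_pmf \<nu> (\<lambda>g. bind_pmf coin (\<lambda>b. bind_pmf ?q (\<lambda>bs. ?F g rs b t bs))))"
      by (intro bind_pmf_cong refl bind_commute_pmf)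
    also have "\<dots> = bind_pmf \<nu> (\<lambda>g. bind_pmf coin (\<lambda>t. bind_pmf coin (\<lambda>b. bind_pmf ?q (\<lambda>bs. ?F g rs b t bs))))"
      by (rule bind_commute_pmf)
    also have "\<dots> = bind_pmf \<nu> (\<lambda>g. bind_pmf coin (\<lambda>b. bind_pmf coin (\<lambda>t. bind_pmf ?q (\<lambda>bs. ?F g rs b t bs))))"
      by (intro bind_pmf_cong refl bind_commute_pmf)
    finally show "bind_pmf coin (K rs) =
        bind_pmf \<nu> (\<lambda>g. bind_pmf coin (\<lambda>b. bind_pmf coin (\<lambda>t. bind_pmf ?q (\<lambda>bs. ?F g rs b t bs))))" .
  qed
  also have "\<dots> = bind_pmf \<nu> (\<lambda>g. bind_pmf ?r (\<lambda>rs. bind_pmf coin (\<lambda>b. bind_pmf coin (\<lambda>t. bind_pmf ?q (\<lambda>bs. ?F g rs b t bs)))))"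
    by (rule bind_commute_pmf)
  also have "\<dots> = bind_pmf (replicate_pmf (Suc (Suc n)) \<nu>)
      (\<lambda>rs. map_pmf (walk_position rs) (replicate_pmf (Suc (Suc (Suc n))) coin))"
    unfolding replicate_pmf.simps(2)[of "Suc n" \<nu>] replicate_pmf.simps(2)[of "Suc (Suc n)" coin]
      replicate_pmf.simps(2)[of "Suc n" coin]
    by (simp add: map_bind_pmf bind_assoc_pmf bind_return_pmf del: replicate_pmf.simps walk_position.simps)
  finally show ?case .
qed

text \<open>The bridge from algebra to points: a lamp contributes a toggle of \<open>x\<close>, a
  move acts by \<open>rep h\<close>. The latter is legitimate because lamp parts of positions lie in
  \<open>CS\<close> and hence avoid null sets.\<close>

lemma represents_walk_position:
  assumes "set rs \<subseteq> G"
  shows "represents (fst (walk_position rs bs)) (lit_points rs bs)"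
  using assms
proof (induction rs arbitrary: bs)
  case Nil
  show ?case using represents_lamp by (simp add: fun_eq_iff[symmetric])
next
  case (Cons h rs)
  obtain c g where w: "walk_position rs (tl bs) = (c, g)" by force
  have h: "h \<in> G" "set rs \<subseteq> G" using Cons.prems by auto
  have c: "c \<in> CS" using walk_position_carrier[OF h(2), of "tl bs"] by (simp add: w CG_simps)
  have "fst (walk_position (h # rs) bs) = fst (lamp (hd bs)) \<otimes>\<^bsub>CC\<^esub> act h c"
    using h c act_CS[of h c] by (simp add: w move_def CG_simps CR_simps lamp_def act_one CS_avoids_null CS_CC)
  moreover have "represents (act h c) (\<lambda>x. rep h ` lit_points rs (tl bs) x)"
    using represents_act[OF G_FG[OF h(1)] CS_avoids_null[OF c]] Cons.IH[OF h(2), of "tl bs"] w by simp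
  ultimately show ?case using represents_mult[OF represents_lamp] by simp
qed

end

subsection \<open>Comparison with the inverted orbit\<close>

lemma measure_bind_pmf_expectation:
  "measure_pmf.prob (bind_pmf p f) A = measure_pmf.expectation p (\<lambda>x. measure_pmf.prob (f x) A)"
  unfolding measure_pmf_bind
  by (rule measure_pmf.measure_bind[where N = "count_space UNIV"])
    (auto simp: measure_subprob)

lemma card_uniform_subset:
  assumes S: "finite S"
  shows "map_pmf card (pmf_of_set (Pow S)) = binomial_pmf (card S) (1/2)"
proof (rule pmf_eqI)
  fix k
  have "pmf (map_pmf card (pmf_of_set (Pow S))) k = real (card (Pow S \<inter> card -` {k})) / 2 ^ card S"
    using S measure_pmf_of_set[OF Pow_not_empty, of S "card -` {k}"] by (simp add: pmf_map card_Pow)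
  also have "Pow S \<inter> card -` {k} = {V. V \<subseteq> S \<and> card V = k}" by auto
  also have "real (card \<dots>) / 2 ^ card S = real (card S choose k) / 2 ^ card S"
    using n_subsets[OF S] by simp
  also have "\<dots> = pmf (binomial_pmf (card S) (1/2)) k"
  proof (cases "k \<le> card S")
    case True
    then have "(1/2::real) ^ k * (1/2) ^ (card S - k) = 1 / 2 ^ card S"
      by (simp add: power_add[symmetric] power_divide)
    then show ?thesis using True by (simp add: mult.assoc)
  qed (simp add: binomial_eq_0)
  finally show "pmf (map_pmf card (pmf_of_set (Pow S))) k = pmf (binomial_pmf (card S) (1/2)) k" .
qed

text \<open>Hoeffding with deviation 1/4 from the mean proportion 1/2: \<open>t < N / 4\<close>, and
  the bound \<open>exp (- N / 8)\<close> is at most \<open>exp (- t / 2)\<close> since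
  \<open>N > 4 * t\<close>.\<close>

lemma binomial_half_lower_tail:
  assumes "real N > 4 * t" "t \<ge> 0"
  shows "measure_pmf.prob (binomial_pmf N (1/2)) {k. real k < t} \<le> exp (- t / 2)"
proof -
  have N: "N > 0" using assms by (cases N) auto
  interpret binomial_distribution N "1/2" by standard auto
  have "measure_pmf.prob (binomial_pmf N (1/2)) {k. real k < t} \<le>
      measure_pmf.prob (binomial_pmf N (1/2)) {k. real k / real N \<le> 1/2 - 1/4}"
    using assms N by (intro measure_pmf.finite_measure_mono) (auto simp: field_simps)
  also have "\<dots> \<le> exp (-2 * real N * (1/4)\<^sup>2)"
    using prob_le'[OF N, of "1/4"] by simp
  also have "\<dots> \<le> exp (- t / 2)" using assms by (simp add: power2_eq_square)
  finally show ?thesis .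
qed

lemma binomial_half_zero: "measure_pmf.prob (binomial_pmf N (1/2)) {k. k = 0} = 2 powr - real N"
  by (simp add: measure_pmf_single powr_minus powr_realpow power_divide divide_simps)

text \<open>Each value is counted at its least index. This turns the cardinality of a set of orbit
  points into a finite sum of indicators of conditions on equalities between measurable
  maps.\<close>

lemma card_image_first_occurrence:
  fixes f :: "nat \<Rightarrow> 'b"
  shows "card (f ` {k. k \<le> n \<and> Q (f k)}) = card {k. k \<le> n \<and> Q (f k) \<and> (\<forall>j<k. f j \<noteq> f k)}"
proof -
  let ?K = "{k. k \<le> n \<and> Q (f k) \<and> (\<forall>j<k. f j \<noteq> f k)}"
  have "inj_on f ?K" by (rule inj_onI) (auto, metis linorder_neqE_nat)
  moreover have "f ` {k. k \<le> n \<and> Q (f k)} \<subseteq> f ` ?K"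
  proof
    fix y assume "y \<in> f ` {k. k \<le> n \<and> Q (f k)}"
    then obtain k where k: "k \<le> n" "Q (f k)" "y = f k" by auto
    obtain l where l: "f l = y" "\<And>j. j < l \<Longrightarrow> f j \<noteq> y"
      using exists_least_iff[of "\<lambda>j. f j = y"] k by metis
    then have "l \<le> k" using k by (metis not_le)
    then have "l \<in> ?K" using k l by simp
    then have "f l \<in> f ` ?K" by (rule imageI)
    then show "y \<in> f ` ?K" by (simp only: l(1))
  qed
  then have "f ` {k. k \<le> n \<and> Q (f k)} = f ` ?K" by auto
  ultimately show ?thesis by (simp add: card_image)
qed

section \<open>Measurability of the numbers of orbit points and lit points\<close>

context borel_relation
begin

lemma orbit_points_maps:
  assumes "set rs \<subseteq> carrier FG"
  shows "\<exists>F. (\<forall>k. F k \<in> measurable M M) \<and> (\<forall>x. orbit_points rs x = (\<lambda>k. F k x) ` {..length rs})"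
  using assms
proof (induction rs)
  case Nil
  then show ?case by (intro exI[of _ "\<lambda>k x. x"]) auto
next
  case (Cons h rs)
  then obtain F where F: "\<forall>k. F k \<in> measurable M M"
      "\<forall>x. orbit_points rs x = (\<lambda>k. F k x) ` {..length rs}" by auto
  define F' where "F' k = (case k of 0 \<Rightarrow> (\<lambda>x. x) | Suc k \<Rightarrow> (\<lambda>x. rep h (F k x)))" for k
  have "F' k \<in> measurable M M" for k
    using measurable_compose[OF F(1)[rule_format] PG_measurable[OF rep_PG]] Cons.prems
    by (cases k) (auto simp: F'_def)
  moreover have "orbit_points (h # rs) x = (\<lambda>k. F' k x) ` {..length (h # rs)}" for x
    using F(2) by (simp add: atMost_Suc_eq_insert_0 image_image F'_def)
  ultimately show ?case by blast
qed

lemma lit_points_sets: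
  assumes "set rs \<subseteq> carrier FG"
  shows "{(x, y). x \<in> space M \<and> y \<in> lit_points rs bs x} \<in> sets (M \<Otimes>\<^sub>M M)"
  using assms
proof (induction rs arbitrary: bs)
  case Nil
  have "{(x, y). x \<in> space M \<and> y \<in> lit_points [] bs x} =
      (if hd bs then {p \<in> space (M \<Otimes>\<^sub>M M). fst p = snd p} else {})"
    by (auto simp: space_pair_measure)
  then show ?case using standard_borel_diagonal[OF sb] by simp
next
  case (Cons h rs)
  let ?L = "{(x, y). x \<in> space M \<and> y \<in> lit_points rs (tl bs) x}"
  let ?D = "if hd bs then {p \<in> space (M \<Otimes>\<^sub>M M). fst p = snd p} else {}"
  have eq: "{(x, y). x \<in> space M \<and> y \<in> lit_points (h # rs) bs x} =
      sym_diff ?D ((\<lambda>(x, y). (x, rep h y)) ` ?L)"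
    by (auto simp: space_pair_measure)
  have "?L \<in> sets (M \<Otimes>\<^sub>M M)" using Cons by simp
  then have "(\<lambda>(x, y). (x, rep h y)) ` ?L \<in> sets (M \<Otimes>\<^sub>M M)"
    using Cons.prems by (intro aut_image_sets rep_PG) auto
  then show ?case unfolding eq using standard_borel_diagonal[OF sb] by auto
qed

text \<open>Sections enumerated by finitely many measurable maps have a cardinality measurable for
  \<open>M\<close> itself rather than its completion, as the Bochner integrals over \<open>M\<close>
  require. Equality of two maps is measurable by the diagonal.\<close>

lemma measurable_card_maps:
  assumes F[measurable]: "\<And>k::nat. F k \<in> measurable M M" and L: "L \<in> sets (M \<Otimes>\<^sub>M M)"
  shows "(\<lambda>x. card ((\<lambda>k. F k x) ` {k. k \<le> n \<and> (x, F k x) \<in> L})) \<in> measurable M (count_space UNIV)"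
proof -
  note [measurable] = L
  have D: "Measurable.pred M (\<lambda>x. F j x = F k x)" for j k
  proof -
    have "(\<lambda>x. (F j x, F k x)) -` {p \<in> space (M \<Otimes>\<^sub>M M). fst p = snd p} \<inter> space M \<in> sets M"
      by (rule measurable_sets[OF _ standard_borel_diagonal[OF sb]]) measurable
    moreover have "(\<lambda>x. (F j x, F k x)) -` {p \<in> space (M \<Otimes>\<^sub>M M). fst p = snd p} \<inter> space M =
        {x \<in> space M. F j x = F k x}"
      using measurable_space[OF F] by (auto simp: space_pair_measure)
    ultimately show ?thesis by (simp add: pred_def)
  qed
  note [measurable] = D
  have "card ((\<lambda>k. F k x) ` {k. k \<le> n \<and> (x, F k x) \<in> L}) =
      (\<Sum>k\<le>n. if (x, F k x) \<in> L \<and> (\<forall>j\<in>{..<k}. F j x \<noteq> F k x) then 1 else 0)" for x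
  proof -
    have "card ((\<lambda>k. F k x) ` {k. k \<le> n \<and> (x, F k x) \<in> L}) =
        card {k. k \<le> n \<and> (x, F k x) \<in> L \<and> (\<forall>j<k. F j x \<noteq> F k x)}"
      by (rule card_image_first_occurrence[of "\<lambda>k. F k x" n "\<lambda>y. (x, y) \<in> L"])
    also have "{k. k \<le> n \<and> (x, F k x) \<in> L \<and> (\<forall>j<k. F j x \<noteq> F k x)} =
        {..n} \<inter> {k. (x, F k x) \<in> L \<and> (\<forall>j\<in>{..<k}. F j x \<noteq> F k x)}" by auto
    finally show ?thesis by (simp add: sum.If_cases)
  qed
  then show ?thesis by simp
qed

lemma measurable_card_orbit_points:
  assumes "set rs \<subseteq> carrier FG"
  shows "(\<lambda>x. card (orbit_points rs x)) \<in> measurable M (count_space UNIV)"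
proof -
  obtain F where "\<forall>k. F k \<in> measurable M M" "\<forall>x. orbit_points rs x = (\<lambda>k. F k x) ` {..length rs}"
    using orbit_points_maps[OF assms] by (elim exE conjE)
  note F = this[rule_format]
  have "(\<lambda>x. card ((\<lambda>k. F k x) ` {k. k \<le> length rs \<and> (x, F k x) \<in> space (M \<Otimes>\<^sub>M M)})) \<in>
      measurable M (count_space UNIV)"
    by (rule measurable_card_maps[OF F(1)]) simp
  moreover have "card ((\<lambda>k. F k x) ` {k. k \<le> length rs \<and> (x, F k x) \<in> space (M \<Otimes>\<^sub>M M)}) =
      card (orbit_points rs x)" if "x \<in> space M" for x
    using that measurable_space[OF F(1)] by (auto simp: F(2) space_pair_measure atMost_def)
  ultimately show ?thesis by (subst measurable_cong) auto
qed

lemma measurable_card_lit_points: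
  assumes "set rs \<subseteq> carrier FG"
  shows "(\<lambda>x. card (lit_points rs bs x)) \<in> measurable M (count_space UNIV)"
proof -
  let ?L = "{(x, y). x \<in> space M \<and> y \<in> lit_points rs bs x}"
  obtain F where "\<forall>k. F k \<in> measurable M M" "\<forall>x. orbit_points rs x = (\<lambda>k. F k x) ` {..length rs}"
    using orbit_points_maps[OF assms] by (elim exE conjE)
  note F = this[rule_format]
  have "(\<lambda>x. card ((\<lambda>k. F k x) ` {k. k \<le> length rs \<and> (x, F k x) \<in> ?L})) \<in>
      measurable M (count_space UNIV)"
    by (rule measurable_card_maps[OF F(1) lit_points_sets[OF assms]])
  moreover have "(\<lambda>k. F k x) ` {k. k \<le> length rs \<and> (x, F k x) \<in> ?L} = lit_points rs bs x"
    if "x \<in> space M" for x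
    using that lit_points_subset[of rs bs x] by (auto simp: F(2))
  ultimately show ?thesis by (subst measurable_cong) auto
qed

end

context borel_relation_subgroup
begin

definition orbit_average :: "('a \<Rightarrow> 'a) set pmf \<Rightarrow> nat \<Rightarrow> (nat \<Rightarrow> real) \<Rightarrow> 'a \<Rightarrow> real" where
  "orbit_average \<nu> n \<phi> x = measure_pmf.expectation (replicate_pmf n \<nu>) (\<lambda>rs. \<phi> (card (orbit_points rs x)))"

lemma finite_replicate_pmf: "finite (set_pmf p) \<Longrightarrow> finite (set_pmf (replicate_pmf n p))"
  by (induction n) auto

lemma replicate_pmf_G: "set_pmf \<nu> \<subseteq> G \<Longrightarrow> rs \<in> set_pmf (replicate_pmf n \<nu>) \<Longrightarrow> set rs \<subseteq> G"
  by (auto simp: set_replicate_pmf)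

text \<open>Finite support turns the expectation into a finite sum, so measurability and
  integrability in \<open>x\<close> reduce to a fixed list of increments.\<close>

lemma orbit_average_sum:
  assumes "finite (set_pmf \<nu>)"
  shows "orbit_average \<nu> n \<phi> x =
    (\<Sum>rs\<in>set_pmf (replicate_pmf n \<nu>). \<phi> (card (orbit_points rs x)) * pmf (replicate_pmf n \<nu>) rs)"
  unfolding orbit_average_def
  by (rule integral_measure_pmf_real) (auto intro: finite_replicate_pmf assms)

lemma integrable_orbit_average:
  assumes "finite (set_pmf \<nu>)" "set_pmf \<nu> \<subseteq> G" "\<And>k. \<bar>\<phi> k\<bar> \<le> B"
  shows "integrable M (orbit_average \<nu> n \<phi>)"
proof -
  have "integrable M (\<lambda>x. \<phi> (card (orbit_points rs x)))" if "rs \<in> set_pmf (replicate_pmf n \<nu>)" for rs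
  proof (rule integrable_const_bound[where B = B])
    show "AE x in M. norm (\<phi> (card (orbit_points rs x))) \<le> B" using assms(3) by simp
    have [measurable]: "(\<lambda>x. card (orbit_points rs x)) \<in> measurable M (count_space UNIV)"
      using replicate_pmf_G[OF assms(2) that] G_FG by (intro measurable_card_orbit_points) auto
    show "(\<lambda>x. \<phi> (card (orbit_points rs x))) \<in> borel_measurable M" by measurable
  qed
  then show ?thesis unfolding orbit_average_sum[OF assms(1)] by auto
qed

lemma orbit_average_mono:
  assumes "finite (set_pmf \<nu>)" "\<And>k. \<phi> k \<le> \<psi> k"
  shows "orbit_average \<nu> n \<phi> x \<le> orbit_average \<nu> n \<psi> x"
  unfolding orbit_average_sum[OF assms(1)] by (intro sum_mono mult_right_mono assms) auto

lemma orbit_average_add_const: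
  assumes "finite (set_pmf \<nu>)"
  shows "orbit_average \<nu> n (\<lambda>k. \<phi> k + c) x = orbit_average \<nu> n \<phi> x + c"
  unfolding orbit_average_def
  by (subst Bochner_Integration.integral_add)
    (auto intro: integrable_measure_pmf_finite finite_replicate_pmf assms)

text \<open>The common core of both estimates. Each pair of increments and coins leading into
  \<open>E\<close> is weighed by the measure of the points whose section satisfies \<open>Q\<close>.
  Exchanging sum and integral, the coins at fixed \<open>x\<close> give a binomial number of lit
  points among the orbit points.\<close>

lemma walk_probability_le:
  assumes \<nu>: "finite (set_pmf \<nu>)" "set_pmf \<nu> \<subseteq> G"
    and E: "\<And>rs bs. set rs \<subseteq> G \<Longrightarrow> walk_position rs bs \<in> E \<Longrightarrow>
      \<kappa> \<le> measure M {x \<in> space M. Q (card (lit_points rs bs x))}"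
    and n: "n \<ge> 1"
  shows "\<kappa> * measure_pmf.prob (left_walk CG (switch_walk_switch M R \<nu>) n) E \<le>
    (LINT x|M. orbit_average \<nu> n (\<lambda>N. measure_pmf.prob (binomial_pmf N (1/2)) {k. Q k}) x)"
proof -
  let ?r = "replicate_pmf n \<nu>" and ?q = "replicate_pmf (Suc n) coin"
  let ?p = "pair_pmf ?r ?q"
  obtain m where m: "n = Suc m" using n by (cases n) auto
  have fin: "finite (set_pmf ?p)"
    using finite_replicate_pmf[OF \<nu>(1)] finite_replicate_pmf[of coin] by (simp del: replicate_pmf.simps)
  have rs: "set (fst z) \<subseteq> G" if "z \<in> set_pmf ?p" for z
  proof -
    have "fst z \<in> set_pmf ?r" using that by (auto simp del: replicate_pmf.simps)
    then show ?thesis by (rule replicate_pmf_G[OF \<nu>(2)])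
  qed
  define f where "f z x = (indicator {x. Q (card (lit_points (fst z) (snd z) x))} x :: real)"
    for z :: "('a \<Rightarrow> 'a) set list \<times> bool list" and x
  have f_meas: "integrable M (f z)" "(LINT x|M. f z x) = measure M {x \<in> space M. Q (card (lit_points (fst z) (snd z) x))}"
    if "z \<in> set_pmf ?p" for z
  proof -
    have [measurable]: "(\<lambda>x. card (lit_points (fst z) (snd z) x)) \<in> measurable M (count_space UNIV)"
      using rs[OF that] G_FG by (intro measurable_card_lit_points) auto
    have [measurable]: "{x \<in> space M. Q (card (lit_points (fst z) (snd z) x))} \<in> sets M" by measurable
    have eq: "f z x = indicator {x \<in> space M. Q (card (lit_points (fst z) (snd z) x))} x" if "x \<in> space M" for x
      using that by (simp add: f_def indicator_def)
    show "integrable M (f z)"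
      by (rule iffD2[OF Bochner_Integration.integrable_cong[OF refl eq]]) (auto simp: emeasure_eq_measure)
    show "(LINT x|M. f z x) = measure M {x \<in> space M. Q (card (lit_points (fst z) (snd z) x))}"
      by (rule trans[OF Bochner_Integration.integral_cong[OF refl eq]]) (auto intro!: arg_cong[where f = "measure M"])
  qed
  have law: "left_walk CG (switch_walk_switch M R \<nu>) n = map_pmf (\<lambda>z. walk_position (fst z) (snd z)) ?p"
    unfolding m left_walk_switch_walk_switch[OF \<nu>(2)]
    by (simp add: pair_pmf_def map_pmf_def bind_assoc_pmf bind_return_pmf del: replicate_pmf.simps)
  have "\<kappa> * measure_pmf.prob (left_walk CG (switch_walk_switch M R \<nu>) n) E =
      measure_pmf.expectation ?p (\<lambda>z. \<kappa> * indicator {z. walk_position (fst z) (snd z) \<in> E} z)"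
    unfolding law by (simp add: vimage_def)
  also have "\<dots> = (\<Sum>z\<in>set_pmf ?p. \<kappa> * indicator {z. walk_position (fst z) (snd z) \<in> E} z * pmf ?p z)"
    using fin by (intro integral_measure_pmf_real) auto
  also have "\<dots> \<le> (\<Sum>z\<in>set_pmf ?p. (LINT x|M. f z x) * pmf ?p z)"
  proof (intro sum_mono mult_right_mono)
    fix z assume z: "z \<in> set_pmf ?p"
    \<comment> \<open>On \<open>E\<close> this is the assumption; off \<open>E\<close> the left side
      is 0 and the right side a measure.\<close>
    show "\<kappa> * indicator {z. walk_position (fst z) (snd z) \<in> E} z \<le> (LINT x|M. f z x)"
      using E[OF rs[OF z], of "snd z"] by (auto simp: f_meas(2)[OF z] indicator_def)
  qed simp
  also have "\<dots> = (LINT x|M. (\<Sum>z\<in>set_pmf ?p. f z x * pmf ?p z))"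
    using f_meas(1) by (subst Bochner_Integration.integral_sum) auto
  also have "\<dots> = (LINT x|M. orbit_average \<nu> n (\<lambda>N. measure_pmf.prob (binomial_pmf N (1/2)) {k. Q k}) x)"
  proof (intro Bochner_Integration.integral_cong refl)
    fix x assume x: "x \<in> space M"
    have "(\<Sum>z\<in>set_pmf ?p. f z x * pmf ?p z) = measure_pmf.expectation ?p (\<lambda>z. f z x)"
      using fin by (intro integral_measure_pmf_real[symmetric]) auto
    also have "\<dots> = measure_pmf.prob ?p {z. Q (card (lit_points (fst z) (snd z) x))}"
    proof -
      have "f z x = indicator {z. Q (card (lit_points (fst z) (snd z) x))} z" for z
        by (simp add: f_def indicator_def)
      then show ?thesis by simp
    qed
    also have "\<dots> = measure_pmf.prob (map_pmf (\<lambda>z. card (lit_points (fst z) (snd z) x)) ?p) {k. Q k}"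
      by (simp add: vimage_def)
    also have "map_pmf (\<lambda>z. card (lit_points (fst z) (snd z) x)) ?p =
        bind_pmf ?r (\<lambda>rs. map_pmf card (map_pmf (\<lambda>bs. lit_points rs bs x) ?q))"
      by (simp add: pair_pmf_def map_pmf_def bind_assoc_pmf bind_return_pmf del: replicate_pmf.simps)
    also have "\<dots> = bind_pmf ?r (\<lambda>rs. binomial_pmf (card (orbit_points rs x)) (1/2))"
    proof (rule bind_pmf_cong[OF refl])
      fix rs assume "rs \<in> set_pmf ?r"
      then have "length rs = n" "set rs \<subseteq> carrier FG"
        using replicate_pmf_G[OF \<nu>(2)] G_FG by (auto simp: set_replicate_pmf)
      then show "map_pmf card (map_pmf (\<lambda>bs. lit_points rs bs x) ?q) = binomial_pmf (card (orbit_points rs x)) (1/2)"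
        using lit_points_uniform[OF _ x, of rs] card_uniform_subset[of "orbit_points rs x"] by simp
    qed
    also have "measure_pmf.prob \<dots> {k. Q k} =
        orbit_average \<nu> n (\<lambda>N. measure_pmf.prob (binomial_pmf N (1/2)) {k. Q k}) x"
      unfolding measure_bind_pmf_expectation orbit_average_def ..
    finally show "(\<Sum>z\<in>set_pmf ?p. f z x * pmf ?p z) =
        orbit_average \<nu> n (\<lambda>N. measure_pmf.prob (binomial_pmf N (1/2)) {k. Q k}) x" .
  qed
  finally show ?thesis .
qed

lemma dist_walk_position:
  assumes "set rs \<subseteq> G"
  shows "ennreal (L1_dist M (fst (walk_position rs bs)) \<one>\<^bsub>CC\<^esub>) = (\<integral>\<^sup>+ x. card (lit_points rs bs x) \<partial>M)"
proof -
  note r = represents_walk_position[OF assms, of bs]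
  have "finite (lit_points rs bs x)" for x
    using lit_points_subset finite_orbit_points finite_subset by metis
  then have "emeasure (count_space UNIV) (lit_points rs bs x) = of_nat (card (lit_points rs bs x))" for x
    by simp
  then show ?thesis
    using L1_dist_one[OF r] L1_dist_one_finite[OF r] by (simp add: ennreal_of_nat_eq_real_of_nat)
qed

lemma few_lit_points:
  assumes rs: "set rs \<subseteq> G" and d: "L1_dist M (fst (walk_position rs bs)) \<one>\<^bsub>CC\<^esub> < \<delta>" and t: "t > 0"
  shows "1 - \<delta> / t \<le> measure M {x \<in> space M. real (card (lit_points rs bs x)) < t}"
proof -
  have [measurable]: "(\<lambda>x. card (lit_points rs bs x)) \<in> measurable M (count_space UNIV)"
    using rs G_FG by (intro measurable_card_lit_points) auto
  let ?A = "{x \<in> space M. t \<le> real (card (lit_points rs bs x))}"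
  have [measurable]: "?A \<in> sets M" by measurable
  have "ennreal t * emeasure M ?A = (\<integral>\<^sup>+ x. ennreal t * indicator ?A x \<partial>M)"
    by (simp add: nn_integral_cmult_indicator)
  also have "\<dots> \<le> (\<integral>\<^sup>+ x. card (lit_points rs bs x) \<partial>M)"
    by (intro nn_integral_mono) (auto simp: indicator_def ennreal_leI)
  also have "\<dots> \<le> ennreal \<delta>"
    unfolding dist_walk_position[OF rs, symmetric] using d by (intro ennreal_leI) simp
  finally have "ennreal (t * measure M ?A) \<le> ennreal \<delta>"
    using t by (simp add: emeasure_eq_measure ennreal_mult)
  then have "t * measure M ?A \<le> \<delta>"
  proof -
    \<comment> \<open>\<open>ennreal\<close> truncates negative reals, so
      \<open>\<delta> \<ge> 0\<close> is needed to return to the reals.\<close>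
    have "0 \<le> L1_dist M (fst (walk_position rs bs)) \<one>\<^bsub>CC\<^esub>" by (simp add: L1_dist_def)
    with d have "0 \<le> \<delta>" by linarith
    with \<open>ennreal (t * measure M ?A) \<le> ennreal \<delta>\<close> show ?thesis by (simp only: ennreal_le_iff)
  qed
  then have "measure M ?A \<le> \<delta> / t" using t by (simp add: field_simps)
  moreover have "measure M {x \<in> space M. real (card (lit_points rs bs x)) < t} = 1 - measure M ?A"
    using prob_compl[of ?A] by (simp add: set_diff_eq not_le conj_commute cong: conj_cong)
  ultimately show ?thesis by simp
qed

lemma expectation_random_inverted_orbit:
  "measure_pmf.expectation (random_inverted_orbit \<nu> n x) (\<lambda>S. \<phi> (card S)) = orbit_average \<nu> n \<phi> x"
  by (simp add: random_inverted_orbit_eq orbit_average_def)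

lemma prob_random_inverted_orbit:
  "measure_pmf.prob (random_inverted_orbit \<nu> n x) {S. Q (card S)} =
    orbit_average \<nu> n (\<lambda>k. indicator {k. Q k} k) x"
proof -
  have "measure_pmf.prob (random_inverted_orbit \<nu> n x) {S. Q (card S)} =
      measure_pmf.expectation (random_inverted_orbit \<nu> n x) (indicator {S. Q (card S)})"
    by simp
  also have "\<dots> = measure_pmf.expectation (random_inverted_orbit \<nu> n x) (\<lambda>S. indicator {k. Q k} (card S))"
    by (intro Bochner_Integration.integral_cong) (auto simp: indicator_def)
  finally show ?thesis by (simp only: expectation_random_inverted_orbit)
qed

lemma prob_small_le_expectation_orbit:
  assumes \<nu>: "finite (set_pmf \<nu>)" "set_pmf \<nu> \<subseteq> G" and n: "n \<ge> 1"
  shows "(1 - \<epsilon>) * measure_pmf.prob (left_walk CG (switch_walk_switch M R \<nu>) n)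
      {(c, g). L1_dist M c \<one>\<^bsub>CC\<^esub> < \<epsilon>}
    \<le> (LINT x|M. measure_pmf.expectation (random_inverted_orbit \<nu> n x) (\<lambda>S. 2 powr - real (card S)))"
proof -
  have "1 - \<epsilon> \<le> measure M {x \<in> space M. card (lit_points rs bs x) = 0}"
    if "set rs \<subseteq> G" "walk_position rs bs \<in> {(c, g). L1_dist M c \<one>\<^bsub>CC\<^esub> < \<epsilon>}" for rs bs
    using few_lit_points[of rs bs \<epsilon> 1] that by (simp add: case_prod_beta)
  from walk_probability_le[where E = "{(c, g). L1_dist M c \<one>\<^bsub>CC\<^esub> < \<epsilon>}" and Q = "\<lambda>k. k = 0",
      OF \<nu> this n] show ?thesis
    unfolding binomial_half_zero expectation_random_inverted_orbit[of _ _ _ "\<lambda>k. 2 powr - real k"] by simp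
qed

lemma prob_sublinear_le_prob_small_orbit:
  assumes \<nu>: "finite (set_pmf \<nu>)" "set_pmf \<nu> \<subseteq> G" and \<epsilon>: "0 < \<epsilon>"
  shows "1/2 * measure_pmf.prob (left_walk CG (switch_walk_switch M R \<nu>) n)
      {(c, g). L1_dist M c \<one>\<^bsub>CC\<^esub> < \<epsilon> / 2 * real n} - exp (- \<epsilon> * real n / 2)
    \<le> (LINT x|M. measure_pmf.prob (random_inverted_orbit \<nu> n x) {S. real (card S) \<le> 4 * \<epsilon> * real n})"
proof (cases "n = 0")
  case True
  \<comment> \<open>At time 0 the strict condition on the distance is unsatisfiable, so the left
    side is not positive.\<close>
  have "{(c, g). L1_dist M c \<one>\<^bsub>CC\<^esub> < 0} = {}" by (auto simp: L1_dist_def not_less)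
  then have "1/2 * measure_pmf.prob (left_walk CG (switch_walk_switch M R \<nu>) n)
      {(c, g). L1_dist M c \<one>\<^bsub>CC\<^esub> < \<epsilon> / 2 * real n} - exp (- \<epsilon> * real n / 2) \<le> 0"
    using True by simp
  also have "0 \<le> (LINT x|M. measure_pmf.prob (random_inverted_orbit \<nu> n x) {S. real (card S) \<le> 4 * \<epsilon> * real n})"
    by (intro integral_nonneg_AE) auto
  finally show ?thesis .
next
  case False
  define t where "t = \<epsilon> * real n"
  have t: "t > 0" using False \<epsilon> by (simp add: t_def)
  let ?I = "\<lambda>k::nat. indicator {k. real k \<le> 4 * t} k :: real"
  have "1/2 \<le> measure M {x \<in> space M. real (card (lit_points rs bs x)) < t}"
    if "set rs \<subseteq> G" "walk_position rs bs \<in> {(c, g). L1_dist M c \<one>\<^bsub>CC\<^esub> < \<epsilon> / 2 * real n}" for rs bs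
  proof -
    have eq: "(\<epsilon> / 2 * real n) / t = 1/2" using False \<epsilon> by (simp add: t_def)
    have "1 - (\<epsilon> / 2 * real n) / t \<le> measure M {x \<in> space M. real (card (lit_points rs bs x)) < t}"
      using that t by (intro few_lit_points) (auto simp: case_prod_beta)
    then show ?thesis unfolding eq by simp
  qed
  from walk_probability_le[where E = "{(c, g). L1_dist M c \<one>\<^bsub>CC\<^esub> < \<epsilon> / 2 * real n}"
      and Q = "\<lambda>k. real k < t" and n = n, OF \<nu> this]
  have "1/2 * measure_pmf.prob (left_walk CG (switch_walk_switch M R \<nu>) n)
      {(c, g). L1_dist M c \<one>\<^bsub>CC\<^esub> < \<epsilon> / 2 * real n}
    \<le> (LINT x|M. orbit_average \<nu> n (\<lambda>N. measure_pmf.prob (binomial_pmf N (1/2)) {k. real k < t}) x)"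
    using False by simp
  also have "\<dots> \<le> (LINT x|M. orbit_average \<nu> n (\<lambda>k. ?I k + exp (- t / 2)) x)"
  proof (intro integral_mono integrable_orbit_average \<nu> orbit_average_mono)
    show "\<bar>measure_pmf.prob (binomial_pmf k (1/2)) {k. real k < t}\<bar> \<le> 1" for k by simp
    show "\<bar>?I k + exp (- t / 2)\<bar> \<le> 1 + exp (- t / 2)" for k by (auto simp: indicator_def)
    show "measure_pmf.prob (binomial_pmf k (1/2)) {k. real k < t} \<le> ?I k + exp (- t / 2)" for k
    proof (cases "real k \<le> 4 * t")
      case True
      have "measure_pmf.prob (binomial_pmf k (1/2)) {k. real k < t} \<le> 1" by simp
      also have "\<dots> \<le> ?I k + exp (- t / 2)" using True by simp
      finally show ?thesis .
    next
      case False
      then show ?thesis using binomial_half_lower_tail[of t k] t by simp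
    qed
  qed
  also have "\<dots> = (LINT x|M. orbit_average \<nu> n ?I x) + exp (- t / 2)"
  proof -
    have "integrable M (orbit_average \<nu> n ?I)"
      by (intro integrable_orbit_average[where B = 1] \<nu>) (simp add: indicator_def)
    then show ?thesis unfolding orbit_average_add_const[OF \<nu>(1)] by (simp add: prob_space)
  qed
  finally show ?thesis
    unfolding prob_random_inverted_orbit[of _ _ _ "\<lambda>k. real k \<le> 4 * \<epsilon> * real n"] by (simp add: t_def mult.assoc)
qed

end

subsection \<open>Kesten properties\<close>

lemma decays_subexponentially_lower_bound:
  fixes a p :: "nat \<Rightarrow> real"
  assumes a: "\<And>n. n \<ge> 1 \<Longrightarrow> a n \<in> {0..1}"
    and le: "\<And>n. n \<ge> 1 \<Longrightarrow> 1/2 * p n - exp (- \<delta> * real n) \<le> a n"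
    and \<delta>: "\<delta> > 0"
    and p: "limsup (\<lambda>n. ereal (root n (p n))) = 1"
  shows "decays_subexponentially a"
proof -
  have "limsup (\<lambda>n. ereal (root n (a n))) \<le> 1"
  proof (rule Limsup_bounded)
    show "\<forall>\<^sub>F n in sequentially. ereal (root n (a n)) \<le> 1"
      using eventually_ge_at_top[of 1] by eventually_elim (use a in auto)
  qed
  moreover have "\<not> limsup (\<lambda>n. ereal (root n (a n))) < 1"
  proof
    assume "limsup (\<lambda>n. ereal (root n (a n))) < 1"
    then have "max (limsup (\<lambda>n. ereal (root n (a n)))) (ereal (exp (- \<delta>))) < 1"
      using \<delta> by simp
    then obtain r where "max (limsup (\<lambda>n. ereal (root n (a n)))) (ereal (exp (- \<delta>))) < ereal r" "ereal r < 1"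
      using ereal_dense2 by blast
    then have r: "limsup (\<lambda>n. ereal (root n (a n))) < ereal r" "exp (- \<delta>) < r" "r < 1" by auto
    then have r0: "r > 0" by (meson exp_gt_zero less_trans)
    have "\<forall>\<^sub>F n in sequentially. ereal (root n (p n)) \<le> ereal (root n 4 * r)"
      using Limsup_lessD[OF r(1)] eventually_ge_at_top[of 1]
    proof eventually_elim
      case (elim n)
      have "a n = root n (a n) ^ n" using elim a[of n] by simp
      also have "\<dots> \<le> r ^ n" using elim a[of n] by (intro power_mono) auto
      finally have an: "a n \<le> r ^ n" .
      have "exp (- \<delta> * real n) = exp (- \<delta>) ^ n" by (simp add: exp_of_nat_mult[symmetric] mult.commute)
      also have "\<dots> \<le> r ^ n" using r by (intro power_mono) auto
      finally have "p n \<le> 4 * r ^ n" using an le[of n] elim by simp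
      then have "root n (p n) \<le> root n (4 * r ^ n)" using elim by simp
      also have "\<dots> = root n 4 * r" using elim r0 by (simp add: real_root_mult real_root_power_cancel)
      finally show ?case by simp
    qed
    then have "limsup (\<lambda>n. ereal (root n (p n))) \<le> limsup (\<lambda>n. ereal (root n 4 * r))"
      by (rule Limsup_mono)
    also have "limsup (\<lambda>n. ereal (root n 4 * r)) = ereal (1 * r)"
      by (intro lim_imp_Limsup tendsto_ereal tendsto_mult LIMSEQ_root_const tendsto_const) auto
    also have "\<dots> < 1" using r by simp
    finally show False using p by simp
  qed
  ultimately show ?thesis using a by (auto simp: decays_subexponentially_def)
qed

lemma convolution_power_cong:
  assumes "\<one>\<^bsub>H\<^esub> = \<one>\<^bsub>K\<^esub>" "\<And>x y. x \<otimes>\<^bsub>H\<^esub> y = x \<otimes>\<^bsub>K\<^esub> y"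
  shows "convolution_power H p n = convolution_power K p n"
  by (induction n) (simp_all add: convolution_def assms)

lemma set_power_cong:
  assumes "\<one>\<^bsub>H\<^esub> = \<one>\<^bsub>K\<^esub>" "\<And>x y. x \<otimes>\<^bsub>H\<^esub> y = x \<otimes>\<^bsub>K\<^esub> y"
  shows "set_power H U n = set_power K U n"
  by (induction n) (simp_all add: set_mult_def assms)

context borel_relation_subgroup
begin

definition dist_ball :: "real \<Rightarrow> 'a CR set" where
  "dist_ball r = {(c, g). c \<in> carrier CC \<and> g \<in> carrier FG \<and> L1_dist M c \<one>\<^bsub>CC\<^esub> < r}"

lemma L1_dist_one_one [simp]: "L1_dist M \<one>\<^bsub>CC\<^esub> \<one>\<^bsub>CC\<^esub> = 0"
  using Metric_space.zero[OF L1_Metric_space CC.one_closed CC.one_closed] by simp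

lemma openin_dist_ball: "openin (CR_topology M R) (dist_ball r)"
proof -
  interpret L: Metric_space "carrier CC" "L1_dist M" by (rule L1_Metric_space)
  interpret U: Metric_space "carrier FG" "uniform_dist M" by (rule uniform_Metric_space)
  have "dist_ball r = L.mball \<one>\<^bsub>CC\<^esub> r \<times> carrier FG"
    using CC.one_closed by (auto simp: dist_ball_def L.mball_def L.commute)
  moreover have "openin (L1_topology M R) (L.mball \<one>\<^bsub>CC\<^esub> r)"
    unfolding L1_topology_def by (rule L.openin_mball)
  moreover have "openin (uniform_topology M R) (carrier FG)"
    unfolding uniform_topology_def using openin_topspace[of U.mtopology] by simp
  ultimately show ?thesis by (simp add: CR_topology_def openin_prod_Times_iff)
qed

lemma one_in_dist_ball: "r > 0 \<Longrightarrow> \<one>\<^bsub>CR\<^esub> \<in> dist_ball r"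
  by (simp add: dist_ball_def CR_simps)

lemma set_power_dist_ball:
  assumes "U \<subseteq> dist_ball r" "r > 0"
  shows "set_power CR U n \<subseteq> {(c, g). c \<in> carrier CC \<and> g \<in> carrier FG \<and>
    L1_dist M c \<one>\<^bsub>CC\<^esub> \<le> r * real n \<and> (n > 0 \<longrightarrow> L1_dist M c \<one>\<^bsub>CC\<^esub> < r * real n)}"
proof (induction n)
  case 0
  then show ?case by (simp add: CR_simps)
next
  case (Suc n)
  show ?case
  proof
    fix z assume "z \<in> set_power CR U (Suc n)"
    then obtain x y where xy: "z = x \<otimes>\<^bsub>CR\<^esub> y" "x \<in> set_power CR U n" "y \<in> U"
      by (auto simp: set_mult_def)
    obtain c g c' g' where eq: "x = (c, g)" "y = (c', g')" by force
    have x: "c \<in> carrier CC" "g \<in> carrier FG" "L1_dist M c \<one>\<^bsub>CC\<^esub> \<le> r * real n"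
      using Suc xy(2) by (auto simp: eq)
    have y: "c' \<in> carrier CC" "g' \<in> carrier FG" "L1_dist M c' \<one>\<^bsub>CC\<^esub> < r"
      using assms(1) xy(3) by (auto simp: eq dist_ball_def)
    have "L1_dist M (c \<otimes>\<^bsub>CC\<^esub> act g c') \<one>\<^bsub>CC\<^esub> < r * real (Suc n)"
      using L1_dist_mult_one_le[OF x(1) act_carrier[OF x(2) y(1)]] L1_dist_act_one_le[OF x(2) y(1)] x(3) y(3)
      by (simp add: algebra_simps)
    then show "z \<in> {(c, g). c \<in> carrier CC \<and> g \<in> carrier FG \<and>
        L1_dist M c \<one>\<^bsub>CC\<^esub> \<le> r * real (Suc n) \<and> (Suc n > 0 \<longrightarrow> L1_dist M c \<one>\<^bsub>CC\<^esub> < r * real (Suc n))}"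
      using x y act_carrier by (simp add: xy(1) eq CR_simps)
  qed
qed

context
  fixes \<nu> :: "('a \<Rightarrow> 'a) set pmf"
  assumes fin: "finite (set_pmf \<nu>)" and sub: "set_pmf \<nu> \<subseteq> G"
    and sym: "map_pmf (\<lambda>g. inv\<^bsub>FG\<^esub> g) \<nu> = \<nu>"
begin

abbreviation "sws \<equiv> switch_walk_switch M R \<nu>"

lemma sws_symmetric: "symmetric_pmf_on CG sws" "symmetric_pmf_on CR sws"
proof -
  note s = switch_walk_switch_carrier[OF sub]
  show "symmetric_pmf_on CG sws"
    using s switch_walk_switch_symmetric[OF sub sym] by (simp add: symmetric_pmf_on_def)
  have "map_pmf (\<lambda>x. inv\<^bsub>CR\<^esub> x) sws = map_pmf (\<lambda>x. inv\<^bsub>CG\<^esub> x) sws"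
    using s by (intro map_pmf_cong refl CR_inv_eq_CG_inv) auto
  then show "symmetric_pmf_on CR sws"
    using s CG_carrier_CR switch_walk_switch_symmetric[OF sub sym] by (auto simp: symmetric_pmf_on_def)
qed

lemma sws_convolution_power:
  "convolution_power CG sws n = left_walk CG sws n"
  "convolution_power CR sws n = left_walk CG sws n"
proof -
  show "convolution_power CG sws n = left_walk CG sws n"
    by (rule CG.convolution_power_eq_left_walk[OF switch_walk_switch_carrier[OF sub]])
  moreover have "convolution_power CR sws n = convolution_power CG sws n"
    by (rule convolution_power_cong) (simp_all add: CG_simps)
  ultimately show "convolution_power CR sws n = left_walk CG sws n" by simp
qed

lemma strong_kesten_walk:
  assumes "strong_kesten_property CG (CG_topology M R G) \<or> strong_kesten_property CR (CR_topology M R)"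
    and "r > 0"
  obtains U where "U \<subseteq> dist_ball r"
    "limsup (\<lambda>n. ereal (root n (measure_pmf.prob (left_walk CG sws n) U))) = 1"
  using assms(1)
proof
  assume K: "strong_kesten_property CG (CG_topology M R G)"
  let ?U = "dist_ball r \<inter> carrier CG"
  have "openin (CG_topology M R G) ?U"
    unfolding CG_topology_def openin_subtopology using openin_dist_ball by blast
  moreover have "\<one>\<^bsub>CG\<^esub> \<in> ?U" using one_in_dist_ball[OF assms(2)] CG.one_closed by (simp add: CG_simps(2))
  ultimately have "limsup (\<lambda>n. ereal (root n (measure_pmf.prob (convolution_power CG sws n) ?U))) = 1"
    using K sws_symmetric(1) unfolding strong_kesten_property_def by blast
  then show ?thesis using that[of ?U] by (simp add: sws_convolution_power)
next
  assume K: "strong_kesten_property CR (CR_topology M R)"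
  have "limsup (\<lambda>n. ereal (root n (measure_pmf.prob (convolution_power CR sws n) (dist_ball r)))) = 1"
    using K sws_symmetric(2) openin_dist_ball one_in_dist_ball[OF assms(2)]
    unfolding strong_kesten_property_def by blast
  then show ?thesis using that[of "dist_ball r"] by (simp add: sws_convolution_power)
qed

lemma kesten_walk:
  assumes "kesten_property CG (CG_topology M R G) \<or> kesten_property CR (CR_topology M R)"
    and "r > 0"
  obtains U where "U \<subseteq> dist_ball r"
    "limsup (\<lambda>n. ereal (root n (measure_pmf.prob (left_walk CG sws n) (set_power CR U n)))) = 1"
  using assms(1)
proof
  assume K: "kesten_property CG (CG_topology M R G)"
  let ?U = "dist_ball r \<inter> carrier CG"
  have "openin (CG_topology M R G) ?U"
    unfolding CG_topology_def openin_subtopology using openin_dist_ball by blast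
  moreover have "\<one>\<^bsub>CG\<^esub> \<in> ?U" using one_in_dist_ball[OF assms(2)] CG.one_closed by (simp add: CG_simps(2))
  ultimately have "limsup (\<lambda>n. ereal (root n (measure_pmf.prob (convolution_power CG sws n) (set_power CG ?U n)))) = 1"
    using K sws_symmetric(1) unfolding kesten_property_def by blast
  moreover have "set_power CG ?U n = set_power CR ?U n" for n
    by (rule set_power_cong) (simp_all add: CG_simps)
  ultimately show ?thesis using that[of ?U] by (simp add: sws_convolution_power)
next
  assume K: "kesten_property CR (CR_topology M R)"
  have "limsup (\<lambda>n. ereal (root n (measure_pmf.prob (convolution_power CR sws n) (set_power CR (dist_ball r) n)))) = 1"
    using K sws_symmetric(2) openin_dist_ball one_in_dist_ball[OF assms(2)]
    unfolding kesten_property_def by blast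
  then show ?thesis using that[of "dist_ball r"] by (simp add: sws_convolution_power)
qed

lemma orbit_average_mean_01:
  assumes "\<And>k. \<phi> k \<in> {0..1}"
  shows "(LINT x|M. orbit_average \<nu> n \<phi> x) \<in> {0..1}"
proof -
  have le: "orbit_average \<nu> n \<phi> x \<le> 1" for x
    unfolding orbit_average_def
    using assms by (intro measure_pmf.integral_le_const integrable_measure_pmf_finite finite_replicate_pmf fin) auto
  have ge: "0 \<le> orbit_average \<nu> n \<phi> x" for x
    unfolding orbit_average_def using assms by (intro integral_nonneg_AE) auto
  have "integrable M (orbit_average \<nu> n \<phi>)"
    using assms by (intro integrable_orbit_average[where B = 1] fin sub) (simp add: abs_le_iff)
  then have "(LINT x|M. orbit_average \<nu> n \<phi> x) \<le> 1" using le by (intro integral_le_const) auto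
  moreover have "0 \<le> (LINT x|M. orbit_average \<nu> n \<phi> x)" using ge by (intro integral_nonneg_AE) auto
  ultimately show ?thesis by simp
qed

lemma strong_kesten_decay:
  assumes "strong_kesten_property CG (CG_topology M R G) \<or> strong_kesten_property CR (CR_topology M R)"
  shows "decays_subexponentially (\<lambda>n. LINT x|M.
    measure_pmf.expectation (random_inverted_orbit \<nu> n x) (\<lambda>S. 2 powr - real (card S)))"
proof -
  obtain U where U: "U \<subseteq> dist_ball (1/2)"
    "limsup (\<lambda>n. ereal (root n (measure_pmf.prob (left_walk CG sws n) U))) = 1"
    using strong_kesten_walk[OF assms, of "1/2"] by auto
  show ?thesis
  proof (rule decays_subexponentially_lower_bound[OF _ _ zero_less_one U(2)])
    fix n :: nat assume n: "n \<ge> 1"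
    show "(LINT x|M. measure_pmf.expectation (random_inverted_orbit \<nu> n x) (\<lambda>S. 2 powr - real (card S))) \<in> {0..1}"
      unfolding expectation_random_inverted_orbit[of _ _ _ "\<lambda>k. 2 powr - real k"]
      by (rule orbit_average_mean_01) (auto simp: powr_minus powr_realpow divide_simps)
    have "measure_pmf.prob (left_walk CG sws n) U \<le>
        measure_pmf.prob (left_walk CG sws n) {(c, g). L1_dist M c \<one>\<^bsub>CC\<^esub> < 1/2}"
      using U(1) by (intro measure_pmf.finite_measure_mono) (auto simp: dist_ball_def)
    then have "1/2 * measure_pmf.prob (left_walk CG sws n) U - exp (- 1 * real n) \<le>
        (1 - 1/2) * measure_pmf.prob (left_walk CG sws n) {(c, g). L1_dist M c \<one>\<^bsub>CC\<^esub> < 1/2}"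
      using less_imp_le[OF exp_gt_zero[of "- 1 * real n"]] by argo
    also note prob_small_le_expectation_orbit[OF fin sub n]
    finally show "1/2 * measure_pmf.prob (left_walk CG sws n) U - exp (- 1 * real n) \<le>
        (LINT x|M. measure_pmf.expectation (random_inverted_orbit \<nu> n x) (\<lambda>S. 2 powr - real (card S)))" .
  qed
qed

lemma kesten_decay:
  assumes "kesten_property CG (CG_topology M R G) \<or> kesten_property CR (CR_topology M R)" and \<epsilon>: "\<epsilon> > 0"
  shows "decays_subexponentially (\<lambda>n. LINT x|M.
    measure_pmf.prob (random_inverted_orbit \<nu> n x) {S. real (card S) \<le> \<epsilon> * real n})"
proof -
  let ?e = "\<epsilon> / 4"
  obtain U where U: "U \<subseteq> dist_ball (?e / 2)"
    "limsup (\<lambda>n. ereal (root n (measure_pmf.prob (left_walk CG sws n) (set_power CR U n)))) = 1"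
    using kesten_walk[OF assms(1), of "?e / 2"] \<epsilon> by auto
  have e: "?e / 2 > 0" using \<epsilon> by simp
  show ?thesis
  proof (rule decays_subexponentially_lower_bound[OF _ _ e U(2)])
    fix n :: nat assume n: "n \<ge> 1"
    show "(LINT x|M. measure_pmf.prob (random_inverted_orbit \<nu> n x) {S. real (card S) \<le> \<epsilon> * real n}) \<in> {0..1}"
      unfolding prob_random_inverted_orbit[of _ _ _ "\<lambda>k. real k \<le> \<epsilon> * real n"]
      by (rule orbit_average_mean_01) (simp add: indicator_def)
    have "measure_pmf.prob (left_walk CG sws n) (set_power CR U n) \<le>
        measure_pmf.prob (left_walk CG sws n) {(c, g). L1_dist M c \<one>\<^bsub>CC\<^esub> < ?e / 2 * real n}"
      using set_power_dist_ball[OF U(1) e, of n] n by (intro measure_pmf.finite_measure_mono) auto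
    then have "1/2 * measure_pmf.prob (left_walk CG sws n) (set_power CR U n) - exp (- (?e / 2) * real n) \<le>
        1/2 * measure_pmf.prob (left_walk CG sws n) {(c, g). L1_dist M c \<one>\<^bsub>CC\<^esub> < ?e / 2 * real n}
          - exp (- ?e * real n / 2)"
      by simp
    also have "\<dots> \<le> (LINT x|M. measure_pmf.prob (random_inverted_orbit \<nu> n x) {S. real (card S) \<le> 4 * ?e * real n})"
      using \<epsilon> by (intro prob_sublinear_le_prob_small_orbit[OF fin sub]) simp
    finally show "1/2 * measure_pmf.prob (left_walk CG sws n) (set_power CR U n) - exp (- (?e / 2) * real n) \<le>
        (LINT x|M. measure_pmf.prob (random_inverted_orbit \<nu> n x) {S. real (card S) \<le> \<epsilon> * real n})"
      by simp
  qed
qed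

end

end

theorem theorem6p3:
  fixes M :: "'a measure" and R :: "('a \<times> 'a) set" and \<nu> :: "('a \<Rightarrow> 'a) set pmf"
  assumes "standard_measure_space M"
    and "countable_borel_equiv M R"
    and "quasi_invariant M R"
    and "ergodic M R"
    and "symmetric_pmf_on (full_group M R) \<nu>"
    and "finite (set_pmf \<nu>)"
  shows
    "let G = generate (full_group M R) (set_pmf \<nu>);
         walk = left_walk (CG_group M R G) (switch_walk_switch M R \<nu>);
         d = L1_dist M;
         O\<^sub>\<nu> = random_inverted_orbit \<nu>
     in
       (\<forall>n\<ge>1. \<forall>\<epsilon>::real. 0 < \<epsilon> \<and> \<epsilon> < 1 \<longrightarrow>
          (1 - \<epsilon>) * measure_pmf.prob (walk n) {(c, g). d c \<one>\<^bsub>C_group M R\<^esub> < \<epsilon>}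
            \<le> (LINT x|M. measure_pmf.expectation (O\<^sub>\<nu> n x) (\<lambda>S. 2 powr - real (card S))))
     \<and> (strong_kesten_property (CG_group M R G) (CG_topology M R G) \<or>
         strong_kesten_property (CR_group M R) (CR_topology M R) \<longrightarrow>
          decays_subexponentially
            (\<lambda>n. LINT x|M. measure_pmf.expectation (O\<^sub>\<nu> n x) (\<lambda>S. 2 powr - real (card S))))
     \<and> (\<forall>n. \<forall>\<epsilon>::real. 0 < \<epsilon> \<and> \<epsilon> < 1 \<longrightarrow>
          1/2 * measure_pmf.prob (walk n) {(c, g). d c \<one>\<^bsub>C_group M R\<^esub> < \<epsilon> / 2 * real n}
              - exp (- \<epsilon> * real n / 2)
            \<le> (LINT x|M. measure_pmf.prob (O\<^sub>\<nu> n x) {S. real (card S) \<le> 4 * \<epsilon> * real n}))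
     \<and> (kesten_property (CG_group M R G) (CG_topology M R G) \<or>
         kesten_property (CR_group M R) (CR_topology M R) \<longrightarrow>
          (\<forall>\<epsilon>::real. 0 < \<epsilon> \<longrightarrow>
            decays_subexponentially
              (\<lambda>n. LINT x|M. measure_pmf.prob (O\<^sub>\<nu> n x) {S. real (card S) \<le> \<epsilon> * real n})))"
proof -
  interpret borel_relation M R
    using assms(1,2) by unfold_locales
  have \<nu>: "set_pmf \<nu> \<subseteq> carrier FG" "map_pmf (\<lambda>g. inv\<^bsub>FG\<^esub> g) \<nu> = \<nu>"
    using assms(5) by (auto simp: symmetric_pmf_on_def)
  interpret borel_relation_subgroup M R "generate (full_group M R) (set_pmf \<nu>)"
    by (intro borel_relation_subgroup.intro borel_relation_subgroup_axioms.intro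
        borel_relation_axioms FG.generate_is_subgroup \<nu>(1))
  have sub: "set_pmf \<nu> \<subseteq> generate (full_group M R) (set_pmf \<nu>)"
    by (auto intro: generate.incl)
  show ?thesis
    unfolding Let_def
    using prob_small_le_expectation_orbit[OF assms(6) sub] prob_sublinear_le_prob_small_orbit[OF assms(6) sub]
      strong_kesten_decay[OF assms(6) sub \<nu>(2)] kesten_decay[OF assms(6) sub \<nu>(2)]
    by (intro conjI allI impI) auto
qed

end
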